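(* Let $R$ be a local domain, $s\in\mathbb N$, and let $\mathcal I=\{I_n\}$ be an $s$-divisorial filtration on $R$. Then $\ell(\mathcal I_Q)<\dim(R_Q)$ for all prime ideals $Q$ of $R$ which contain $I_1$ and are not minimal primes of $I_1$.
   Context: Local rings are Noetherian. A filtration $\mathcal I=\{I_n\}_{n\in\mathbb N}$ on a ring $R$ is a descending chain of ideals $R=I_0\supset I_1\supset I_2\supset\cdots$ with $I_iI_j\subset I_{i+j}$ for all $i,j$. Its Rees ring is $R[\mathcal I]=\sum_{n\ge 0}I_nt^n\subset R[t]$ (not assumed Noetherian). For $R$ local with maximal ideal $m_R$, the analytic spread is $\ell(\mathcal I)=\dim R[\mathcal I]/m_RR[\mathcal I]$. For a prime $Q$ of $R$, $\mathcal I_Q=\{I_nR_Q\}$, a filtration on the local ring $R_Q$. Let $R$ be a local domain with quotient field $K$. A divisorial valuation of $R$ is a valuation $\nu$ of $K$ with valuation ring $\mathcal O_\nu$ and maximal ideal $m_\nu$ such that $R\subset\mathcal O_\nu$ and, with $\mathfrak p=m_\nu\cap R$ (the center of $\nu$), $\mathrm{trdeg}_{\kappa(\mathfrak p)}\kappa(\nu)=\mathrm{ht}(\mathfrak p)-1$, where $\kappa(\mathfrak p)$ and $\kappa(\nu)$ are the residue fields of $R_{\mathfrak p}$ and $\mathcal O_\nu$. Such $\nu$ is discrete (value group normalized to $\mathbb Z$). It is an $s$-valuation if $\dim R/\mathfrak p=s$. For $n\in\mathbb N$, $I(\nu)_n=\{f\in R\mid \nu(f)\ge n\}$. An $s$-divisorial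 filtration on $R$ is a filtration $\mathcal I=\{I_n\}$ for which there are $s$-valuations $\nu_1,\dots,\nu_r$ of $R$ and $a_1,\dots,a_r\in\mathbb Z_{\ge 0}$ with $I_n=I(\nu_1)_{na_1}\cap\cdots\cap I(\nu_r)_{na_r}$ for all $n\in\mathbb N$. *)

theory Defs
  imports "HOL-Algebra.Algebra" "HOL-Library.Extended_Nat"
begin

text \<open>A domain is given as a subring \<open>R\<close> of its quotient field \<open>K\<close>; as a structure of its own it is
  \<open>K\<lparr>carrier := R\<rparr>\<close>. Localizations of \<open>R\<close> and valuation rings are subrings of \<open>K\<close> as well.\<close>

abbreviation subring_struct :: "('a, 'b) ring_scheme \<Rightarrow> 'a set \<Rightarrow> ('a, 'b) ring_scheme"
  (infixl \<open>\<downharpoonright>\<close> 70)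
  where "K \<downharpoonright> A \<equiv> K\<lparr>carrier := A\<rparr>"

definition has_quotient_field :: "'a set \<Rightarrow> ('a, 'b) ring_scheme \<Rightarrow> bool"
  where "has_quotient_field R K \<longleftrightarrow> field K \<and> subring R K \<and>
    (\<forall>x\<in>carrier K. \<exists>a\<in>R. \<exists>b\<in>R - {\<zero>\<^bsub>K\<^esub>}. x = a \<otimes>\<^bsub>K\<^esub> inv\<^bsub>K\<^esub> b)"


section \<open>Dimension and local rings\<close>

definition prime_chain :: "('a, 'b) ring_scheme \<Rightarrow> nat \<Rightarrow> (nat \<Rightarrow> 'a set) \<Rightarrow> bool"
  where "prime_chain A n P \<longleftrightarrow> (\<forall>i\<le>n. primeideal (P i) A) \<and> (\<forall>i<n. P i \<subset> P (Suc i))"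

text \<open>The supremum is taken in \<open>enat\<close>; the zero ring gets dimension \<open>0\<close>.\<close>

definition krull_dim :: "('a, 'b) ring_scheme \<Rightarrow> enat"
  where "krull_dim A = Sup {enat n | n. \<exists>P. prime_chain A n P}"

definition height :: "('a, 'b) ring_scheme \<Rightarrow> 'a set \<Rightarrow> enat"
  where "height A p = Sup {enat n | n. \<exists>P. prime_chain A n P \<and> P n = p}"

definition minimal_prime_over :: "('a, 'b) ring_scheme \<Rightarrow> 'a set \<Rightarrow> 'a set \<Rightarrow> bool"
  where "minimal_prime_over A J P \<longleftrightarrow> primeideal P A \<and> J \<subseteq> P \<and>
    (\<forall>P'. primeideal P' A \<and> J \<subseteq> P' \<and> P' \<subseteq> P \<longrightarrow> P' = P)"

definition max_ideal :: "('a, 'b) ring_scheme \<Rightarrow> 'a set"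
  where "max_ideal A = (THE m. maximalideal m A)"

definition local_domain :: "('a, 'b) ring_scheme \<Rightarrow> bool"
  where "local_domain A \<longleftrightarrow> noetherian_domain A \<and> (\<exists>!m. maximalideal m A)"

definition localization_at :: "('a, 'b) ring_scheme \<Rightarrow> 'a set \<Rightarrow> 'a set \<Rightarrow> 'a set"
  where "localization_at K R Q = {a \<otimes>\<^bsub>K\<^esub> inv\<^bsub>K\<^esub> b | a b. a \<in> R \<and> b \<in> R - Q}"


section \<open>Filtrations and analytic spread\<close>

definition filtration :: "('a, 'b) ring_scheme \<Rightarrow> (nat \<Rightarrow> 'a set) \<Rightarrow> bool"
  where "filtration A I \<longleftrightarrow> (\<forall>n. ideal (I n) A) \<and> I 0 = carrier A \<and>
    (\<forall>n. I (Suc n) \<subseteq> I n) \<and> (\<forall>i j. I i \<cdot>\<^bsub>A\<^esub> I j \<subseteq> I (i + j))"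

definition rees_ring :: "('a, 'b) ring_scheme \<Rightarrow> (nat \<Rightarrow> 'a set) \<Rightarrow> ('a, nat \<Rightarrow> 'a) up_ring"
  where "rees_ring A I = UP A \<downharpoonright> {f \<in> carrier (UP A). \<forall>n. coeff (UP A) f n \<in> I n}"

definition analytic_spread :: "('a, 'b) ring_scheme \<Rightarrow> (nat \<Rightarrow> 'a set) \<Rightarrow> enat"
  where "analytic_spread A I = krull_dim (rees_ring A I Quot
    (Idl\<^bsub>rees_ring A I\<^esub> ((\<lambda>a. monom (UP A) a 0) ` max_ideal A)))"

definition localized_filtration ::
    "('a, 'b) ring_scheme \<Rightarrow> 'a set \<Rightarrow> 'a set \<Rightarrow> (nat \<Rightarrow> 'a set) \<Rightarrow> nat \<Rightarrow> 'a set"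
  where "localized_filtration K R Q I n = Idl\<^bsub>K \<downharpoonright> localization_at K R Q\<^esub> (I n)"


section \<open>Transcendence degree\<close>

text \<open>Polynomials over \<open>k\<close> with the elements of \<open>B\<close> as their indeterminates are the elements of
  \<open>ring.indexed_pset L B k\<close>: finitely supported functions on multisets over \<open>B\<close> (the monomials).
  Here each indeterminate is evaluated at itself.\<close>

definition eval_indexed :: "('a, 'b) ring_scheme \<Rightarrow> ('a multiset \<Rightarrow> 'a) \<Rightarrow> 'a"
  where "eval_indexed L P =
    (\<Oplus>\<^bsub>L\<^esub>m\<in>{m. P m \<noteq> \<zero>\<^bsub>L\<^esub>}. P m \<otimes>\<^bsub>L\<^esub> (\<Otimes>\<^bsub>L\<^esub>b\<in>set_mset m. b [^]\<^bsub>L\<^esub> count m b))"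

definition algebraically_independent :: "('a, 'b) ring_scheme \<Rightarrow> 'a set \<Rightarrow> 'a set \<Rightarrow> bool"
  where "algebraically_independent L k B \<longleftrightarrow> B \<subseteq> carrier L \<and>
    (\<forall>P\<in>ring.indexed_pset L B k. eval_indexed L P = \<zero>\<^bsub>L\<^esub> \<longrightarrow> P = ring.indexed_const L \<zero>\<^bsub>L\<^esub>)"

definition trdeg :: "('a, 'b) ring_scheme \<Rightarrow> 'a set \<Rightarrow> enat"
  where "trdeg L k = Sup {enat (card B) | B. finite B \<and> algebraically_independent L k B}"


section \<open>Divisorial valuations\<close>

text \<open>Only the values at nonzero elements of \<open>K\<close> matter; \<open>\<nu> 0 = \<infinity>\<close> is encoded by treating zero
  separately. The last clause normalizes the value group to all of \<open>\<int>\<close>.\<close>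

definition discrete_valuation :: "('a, 'b) ring_scheme \<Rightarrow> ('a \<Rightarrow> int) \<Rightarrow> bool"
  where "discrete_valuation K \<nu> \<longleftrightarrow>
    (\<forall>x\<in>carrier K - {\<zero>\<^bsub>K\<^esub>}. \<forall>y\<in>carrier K - {\<zero>\<^bsub>K\<^esub>}.
       \<nu> (x \<otimes>\<^bsub>K\<^esub> y) = \<nu> x + \<nu> y \<and>
       (x \<oplus>\<^bsub>K\<^esub> y \<noteq> \<zero>\<^bsub>K\<^esub> \<longrightarrow> min (\<nu> x) (\<nu> y) \<le> \<nu> (x \<oplus>\<^bsub>K\<^esub> y))) \<and>
    \<nu> ` (carrier K - {\<zero>\<^bsub>K\<^esub>}) = UNIV"

definition valuation_ring :: "('a, 'b) ring_scheme \<Rightarrow> ('a \<Rightarrow> int) \<Rightarrow> 'a set"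
  where "valuation_ring K \<nu> = {x \<in> carrier K. x = \<zero>\<^bsub>K\<^esub> \<or> 0 \<le> \<nu> x}"

definition valuation_ideal :: "('a, 'b) ring_scheme \<Rightarrow> ('a \<Rightarrow> int) \<Rightarrow> 'a set"
  where "valuation_ideal K \<nu> = {x \<in> carrier K. x = \<zero>\<^bsub>K\<^esub> \<or> 0 < \<nu> x}"

definition valuation_center :: "('a, 'b) ring_scheme \<Rightarrow> 'a set \<Rightarrow> ('a \<Rightarrow> int) \<Rightarrow> 'a set"
  where "valuation_center K R \<nu> = valuation_ideal K \<nu> \<inter> R"

definition center_residue_field :: "('a, 'b) ring_scheme \<Rightarrow> 'a set \<Rightarrow> ('a \<Rightarrow> int) \<Rightarrow> 'a set ring"
  where "center_residue_field K R \<nu> =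
    (let A = K \<downharpoonright> localization_at K R (valuation_center K R \<nu>) in A Quot max_ideal A)"

definition valuation_residue_field :: "('a, 'b) ring_scheme \<Rightarrow> ('a \<Rightarrow> int) \<Rightarrow> 'a set ring"
  where "valuation_residue_field K \<nu> = (K \<downharpoonright> valuation_ring K \<nu>) Quot valuation_ideal K \<nu>"

text \<open>The field \<open>\<kappa>(\<pp>)\<close> embeds into \<open>\<kappa>(\<nu>)\<close> by sending a coset \<open>S\<close> to the coset \<open>m\<^sub>\<nu> + S\<close> of \<open>m\<^sub>\<nu>\<close>;
  the transcendence degree is taken over its image. The degree condition is stated as
  \<open>trdeg + 1 = ht \<pp>\<close>, so that no truncated subtraction occurs.\<close>

definition divisorial_valuation :: "('a, 'b) ring_scheme \<Rightarrow> 'a set \<Rightarrow> ('a \<Rightarrow> int) \<Rightarrow> bool"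
  where "divisorial_valuation K R \<nu> \<longleftrightarrow> discrete_valuation K \<nu> \<and> R \<subseteq> valuation_ring K \<nu> \<and>
    trdeg (valuation_residue_field K \<nu>)
      ((\<lambda>S. valuation_ideal K \<nu> <+>\<^bsub>K\<^esub> S) ` carrier (center_residue_field K R \<nu>)) + 1
    = height (K \<downharpoonright> R) (valuation_center K R \<nu>)"

definition s_valuation :: "('a, 'b) ring_scheme \<Rightarrow> 'a set \<Rightarrow> nat \<Rightarrow> ('a \<Rightarrow> int) \<Rightarrow> bool"
  where "s_valuation K R s \<nu> \<longleftrightarrow> divisorial_valuation K R \<nu> \<and>
    krull_dim ((K \<downharpoonright> R) Quot valuation_center K R \<nu>) = enat s"

definition value_ideal :: "('a, 'b) ring_scheme \<Rightarrow> 'a set \<Rightarrow> ('a \<Rightarrow> int) \<Rightarrow> nat \<Rightarrow> 'a set"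
  where "value_ideal K R \<nu> n = {f \<in> R. f = \<zero>\<^bsub>K\<^esub> \<or> int n \<le> \<nu> f}"

definition s_divisorial_filtration ::
    "('a, 'b) ring_scheme \<Rightarrow> 'a set \<Rightarrow> nat \<Rightarrow> (nat \<Rightarrow> 'a set) \<Rightarrow> bool"
  where "s_divisorial_filtration K R s I \<longleftrightarrow> filtration (K \<downharpoonright> R) I \<and>
    (\<exists>(r::nat) (\<nu> :: nat \<Rightarrow> 'a \<Rightarrow> int) (a :: nat \<Rightarrow> nat).
       1 \<le> r \<and> (\<forall>i\<in>{1..r}. s_valuation K R s (\<nu> i)) \<and>
       (\<forall>n. I n = (\<Inter>i\<in>{1..r}. value_ideal K R (\<nu> i) (n * a i))))"

end

theory Submission
  imports Defs
begin

text \<open>The centres of the valuations are incomparable because they all have dimension \<open>s\<close>. Hence \<open>Q\<close>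
  contains some \<open>y\<close> outside every centre with positive weight, and \<open>y g \<in> I\<^sub>n\<close> implies \<open>g \<in> I\<^sub>n\<close>.
  A chain of primes of length \<open>k\<close> in the fibre of the Rees ring of \<open>R\<^sub>Q\<close> contracts to a chain
  \<open>P\<^sub>0 \<subset> \<dots> \<subset> P\<^sub>k\<close> in the Rees ring \<open>S\<close> of \<open>R\<close> whose members all lie over \<open>Q\<close>. By the choice of \<open>y\<close>,
  elements of \<open>S\<close> with all coefficients in \<open>y R\<close> are in \<open>y S \<subseteq> P\<^sub>0\<close>; from this one gets a prime \<open>q\<close> of \<open>R\<close>
  with \<open>y \<in> q\<close> and \<open>Q\<^sub>0 = S \<inter> q[t] \<subseteq> P\<^sub>0\<close>. Over \<open>R/q\<close> the ring \<open>S/Q\<^sub>0\<close> has transcendence degree at most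
  one, so the dimension inequality, applied to a finitely generated subring of \<open>S\<close> that separates the
  chain, yields a chain from \<open>q\<close> to \<open>Q\<close> of length \<open>k\<close>, and \<open>0 \<subset> q\<close> makes it longer by one. (If \<open>q = Q\<close>, it only
  yields \<open>k \<le> 1\<close>, and \<open>0 \<subset> p \<subset> Q\<close> with \<open>p\<close> a centre below \<open>Q\<close> is long enough.)

  The dimension inequality is obtained by adjoining one generator \<open>z\<close> at a time, and for a single step
  \<open>Q \<subset> Q'\<close> of a chain it only says: if both primes have the same contraction then \<open>z\<close> is transcendental
  modulo \<open>Q\<close> and algebraic modulo \<open>Q'\<close>, and if \<open>z\<close> is algebraic modulo \<open>Q\<close> and transcendental
  modulo \<open>Q'\<close> then there is a prime strictly between the contractions. Both follow by counting
  lengths. Krull's height theorem is needed because the inequality is strict: it makes \<open>dim R\<^sub>Q\<close> finite.\<close>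

section \<open>Lengths up to saturation\<close>

text \<open>The length arguments form neither quotient rings nor localizations. All takes place in
  one ring \<open>C\<close>: \<open>B\<close> is a subring, modules are \<open>B\<close>-submodules
  of \<open>C\<close>, contraction is intersection with \<open>B\<close>, a prime \<open>Q\<close>
  stands for \<open>C/Q\<close>, and a multiplicative set \<open>W\<close> stands for localization.
  The obstacle is that the Rees ring need not be Noetherian. Hence lengths and heights are taken
  only over \<open>R\<close> and over finitely generated extensions of it, and chains with
  prescribed ends replace heights in the dimension inequality. The count behind strictness:
  transcendence degree one may cost one step, but for q different from Q the prime cut out by q[t]
  lies strictly below the fibre chain and gains that step back, so the step from 0 to q is a true
  surplus. In the dimension inequality the delicate step is the one from an algebraic to a
  transcendental prime: the transcendence degree rises, so one step above has to yield two steps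
  below. The extra prime comes from comparing two lengths that grow at different rates.\<close>

locale cring_over = cring C for C (structure) + fixes B
  assumes subring_B: "subring B C"

lemma (in cring) cring_overI: "subring B R \<Longrightarrow> cring_over R B"
  by (intro cring_over.intro cring_over_axioms.intro is_cring)

context cring_over
begin

lemma B_carrier: "B \<subseteq> carrier C" and B_zero [simp]: "\<zero> \<in> B" and B_one [simp]: "\<one> \<in> B"
  and B_add: "\<And>a b. a \<in> B \<Longrightarrow> b \<in> B \<Longrightarrow> a \<oplus> b \<in> B"
  and B_mult: "\<And>a b. a \<in> B \<Longrightarrow> b \<in> B \<Longrightarrow> a \<otimes> b \<in> B"
  and B_neg: "\<And>a. a \<in> B \<Longrightarrow> \<ominus> a \<in> B"
  using subringE[OF subring_B] by auto

lemma B_in [simp]: "b \<in> B \<Longrightarrow> b \<in> carrier C"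
  using B_carrier by auto

lemma B_minus: "a \<in> B \<Longrightarrow> b \<in> B \<Longrightarrow> a \<ominus> b \<in> B"
  by (simp add: minus_eq B_add B_neg)

lemma B_pow: "a \<in> B \<Longrightarrow> a [^] (n::nat) \<in> B"
  by (induction n) (auto simp: B_mult)

section \<open>Submodules over the subring and their saturations\<close>

definition submod :: "'a set \<Rightarrow> bool"
  where "submod M \<longleftrightarrow> M \<subseteq> carrier C \<and> \<zero> \<in> M \<and> (\<forall>x\<in>M. \<forall>y\<in>M. x \<oplus> y \<in> M) \<and>
    (\<forall>b\<in>B. \<forall>x\<in>M. b \<otimes> x \<in> M)"

lemma submodD:
  assumes "submod M"
  shows "M \<subseteq> carrier C" "\<And>x. x \<in> M \<Longrightarrow> x \<in> carrier C" "\<zero> \<in> M"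
    "\<And>x y. x \<in> M \<Longrightarrow> y \<in> M \<Longrightarrow> x \<oplus> y \<in> M" "\<And>b x. b \<in> B \<Longrightarrow> x \<in> M \<Longrightarrow> b \<otimes> x \<in> M"
  using assms by (auto simp: submod_def)

lemma submod_neg:
  assumes "submod M" "x \<in> M"
  shows "\<ominus> x \<in> M"
proof -
  have "(\<ominus> \<one>) \<otimes> x \<in> M"
    using assms submodD(5) B_neg B_one by blast
  then show ?thesis
    using submodD(2)[OF assms] by (simp add: l_minus)
qed

lemma submod_minus:
  assumes "submod M" "x \<in> M" "y \<in> M"
  shows "x \<ominus> y \<in> M"
  using submodD(4)[OF assms(1,2) submod_neg[OF assms(1,3)]] by (simp add: minus_eq)

lemma submod_cancel:
  assumes "submod M" "x \<oplus> y \<in> M" "y \<in> M" "x \<in> carrier C"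
  shows "x \<in> M"
proof -
  have "(x \<oplus> y) \<ominus> y \<in> M"
    using submod_minus assms by blast
  moreover have "(x \<oplus> y) \<ominus> y = x"
    using assms submodD(2) by (simp add: minus_eq a_assoc r_neg)
  ultimately show ?thesis by simp
qed

text \<open>Instead of localizing at \<open>W\<close>, submodules are compared up to saturation by \<open>W\<close>; a simple step is
  a quotient whose localization is zero or simple.\<close>

definition sat :: "'a set \<Rightarrow> 'a set \<Rightarrow> 'a set"
  where "sat W M = {x \<in> carrier C. \<exists>w\<in>W. w \<otimes> x \<in> M}"

definition mult_set :: "'a set \<Rightarrow> bool"
  where "mult_set W \<longleftrightarrow> W \<subseteq> B \<and> \<one> \<in> W \<and> (\<forall>v\<in>W. \<forall>w\<in>W. v \<otimes> w \<in> W)"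

lemma mult_setD:
  assumes "mult_set W"
  shows "\<And>w. w \<in> W \<Longrightarrow> w \<in> B" "\<one> \<in> W" "\<And>v w. v \<in> W \<Longrightarrow> w \<in> W \<Longrightarrow> v \<otimes> w \<in> W"
  using assms by (auto simp: mult_set_def)

lemma sat_mono: "M \<subseteq> N \<Longrightarrow> sat W M \<subseteq> sat W N"
  by (auto simp: sat_def)

lemma sat_incl: "mult_set W \<Longrightarrow> M \<subseteq> carrier C \<Longrightarrow> M \<subseteq> sat W M"
  by (force simp: sat_def mult_set_def)

lemma sat_idem:
  assumes "mult_set W"
  shows "sat W (sat W M) \<subseteq> sat W M"
proof
  fix x assume "x \<in> sat W (sat W M)"
  then obtain v w where *: "x \<in> carrier C" "v \<in> W" "w \<in> W" "w \<otimes> (v \<otimes> x) \<in> M"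
    by (auto simp: sat_def)
  then have "(w \<otimes> v) \<otimes> x \<in> M"
    using mult_setD[OF assms] by (simp add: m_assoc)
  then show "x \<in> sat W M"
    using * mult_setD[OF assms] by (auto simp: sat_def)
qed

lemma submod_sat:
  assumes W: "mult_set W" and M: "submod M"
  shows "submod (sat W M)"
  unfolding submod_def
proof (intro conjI ballI)
  show "sat W M \<subseteq> carrier C" by (auto simp: sat_def)
  show "\<zero> \<in> sat W M"
    using submodD(3)[OF M] mult_setD[OF W] by (auto simp: sat_def)
  fix x assume "x \<in> sat W M"
  then obtain w where x: "x \<in> carrier C" "w \<in> W" "w \<otimes> x \<in> M"
    by (auto simp: sat_def)
  note wB = mult_setD(1)[OF W x(2)]
  { fix b assume b: "b \<in> B"
    have "w \<otimes> (b \<otimes> x) = b \<otimes> (w \<otimes> x)"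
      using x b wB by (simp add: m_lcomm)
    then show "b \<otimes> x \<in> sat W M"
      using x b submodD(5)[OF M b x(3)] by (auto simp: sat_def intro!: bexI[of _ w]) }
  fix y assume "y \<in> sat W M"
  then obtain v where y: "y \<in> carrier C" "v \<in> W" "v \<otimes> y \<in> M"
    by (auto simp: sat_def)
  note vB = mult_setD(1)[OF W y(2)]
  have eq: "(v \<otimes> w) \<otimes> (x \<oplus> y) = v \<otimes> (w \<otimes> x) \<oplus> w \<otimes> (v \<otimes> y)"
    using B_in[OF wB] B_in[OF vB] x(1) y(1) by algebra
  have "(v \<otimes> w) \<otimes> (x \<oplus> y) \<in> M"
    unfolding eq using submodD(4,5)[OF M] x y wB vB by blast
  moreover have "v \<otimes> w \<in> W"
    using mult_setD(3)[OF W y(2) x(2)] .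
  ultimately show "x \<oplus> y \<in> sat W M"
    using x y by (auto simp: sat_def)
qed

text \<open>The last clause says that every \<open>v\<close> with nonzero class in the localized
  quotient generates that quotient. It is vacuous when no such \<open>v\<close> exists, so a zero
  quotient counts as a step, and the length of a series is only an upper bound.\<close>

definition simple_step :: "'a set \<Rightarrow> 'a set \<Rightarrow> 'a set \<Rightarrow> bool"
  where "simple_step W M N \<longleftrightarrow> submod M \<and> submod N \<and> N \<subseteq> M \<and>
    (\<forall>u\<in>M. \<forall>v\<in>M. v \<notin> sat W N \<longrightarrow> (\<exists>w\<in>W. \<exists>r\<in>B. w \<otimes> u \<ominus> r \<otimes> v \<in> N))"

section \<open>Composition series, running from the top module down to the bottom one\<close>

inductive series :: "'a set \<Rightarrow> nat \<Rightarrow> 'a set \<Rightarrow> 'a set \<Rightarrow> bool" for W where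
  series_0: "submod M \<Longrightarrow> series W 0 M M"
| series_Suc: "series W n M N \<Longrightarrow> simple_step W N Z \<Longrightarrow> series W (Suc n) M Z"

lemma series_append: "series W m N Z \<Longrightarrow> series W n M N \<Longrightarrow> series W (n + m) M Z"
  by (induction rule: series.induct) (auto intro: series_Suc)

text \<open>As in the Jordan--Hoelder theorem, the number of steps of a fixed series at which a submodule jumps
  is strictly monotone in the submodule, and so bounds the length of chains of saturated submodules.\<close>

definition jumps :: "'a set \<Rightarrow> 'a set \<Rightarrow> 'a set \<Rightarrow> 'a set \<Rightarrow> bool"
  where "jumps W N Z V \<longleftrightarrow> (\<exists>v\<in>V \<inter> N. v \<notin> sat W Z)"

text \<open>Nested submodules with equal counts jump at the same steps. An element of the larger one
  can then be pushed down the series modulo the smaller one: without a jump a factor from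
  \<open>W\<close> suffices, at a jump a multiple of an element of the smaller submodule is
  subtracted as well.\<close>

lemma series_rank:
  assumes W: "mult_set W" and "series W n M N"
  shows "\<exists>f. (\<forall>V. f V \<le> n) \<and> (\<forall>V V'. V \<subseteq> V' \<longrightarrow> f V \<le> f V') \<and>
    (\<forall>V V'. submod V \<and> submod V' \<and> V \<subseteq> V' \<and> V' \<subseteq> sat W M \<and> f V = f V' \<longrightarrow>
      (\<forall>v'\<in>V'. \<exists>w\<in>W. \<exists>v\<in>V. w \<otimes> v' \<ominus> v \<in> V' \<inter> N))"
  using assms(2)
proof (induction rule: series.induct)
  case (series_0 M)
  show ?case
  proof (intro exI[of _ "\<lambda>_. 0::nat"] conjI allI impI ballI; (simp; fail)?)
    fix V V' v' assume *: "submod V \<and> submod V' \<and> V \<subseteq> V' \<and> V' \<subseteq> sat W M \<and> (0::nat) = 0" "v' \<in> V'"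
    then obtain w where w: "w \<in> W" "w \<otimes> v' \<in> M" "v' \<in> carrier C"
      by (auto simp: sat_def)
    note wB = mult_setD(1)[OF W w(1)]
    have "w \<otimes> v' \<ominus> \<zero> = w \<otimes> v'"
      using w wB by (simp add: minus_eq)
    moreover have "w \<otimes> v' \<in> V'"
      using * submodD(5) wB by blast
    ultimately show "\<exists>w\<in>W. \<exists>v\<in>V. w \<otimes> v' \<ominus> v \<in> V' \<inter> M"
      using w * submodD(3)[of V] by (intro bexI[of _ w] bexI[of _ \<zero>]) auto
  qed
next
  case (series_Suc n M N Z)
  then obtain f where f: "\<And>V. f V \<le> n" "\<And>V V'. V \<subseteq> V' \<Longrightarrow> f V \<le> f V'"
    "\<And>V V' v'. submod V \<Longrightarrow> submod V' \<Longrightarrow> V \<subseteq> V' \<Longrightarrow> V' \<subseteq> sat W M \<Longrightarrow> f V = f V' \<Longrightarrow> v' \<in> V' \<Longrightarrow>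
      \<exists>w\<in>W. \<exists>v\<in>V. w \<otimes> v' \<ominus> v \<in> V' \<inter> N" by metis
  define g where "g V = f V + (if jumps W N Z V then 1 else 0)" for V
  have mono: "jumps W N Z V \<Longrightarrow> V \<subseteq> V' \<Longrightarrow> jumps W N Z V'" for V V'
    by (auto simp: jumps_def)
  show ?case
  proof (intro exI[of _ g] conjI allI impI ballI)
    show "g V \<le> Suc n" for V using f(1)[of V] by (auto simp: g_def)
    show "g V \<le> g V'" if "V \<subseteq> V'" for V V'
      using f(2)[OF that] mono[OF _ that] by (auto simp: g_def)
    fix V V' v'
    assume *: "submod V \<and> submod V' \<and> V \<subseteq> V' \<and> V' \<subseteq> sat W M \<and> g V = g V'" and v': "v' \<in> V'"
    then have VV: "submod V" "submod V'" "V \<subseteq> V'" "V' \<subseteq> sat W M" by auto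
    have "f V = f V'" and jj: "jumps W N Z V' \<Longrightarrow> jumps W N Z V"
      using * f(2)[OF VV(3)] mono[OF _ VV(3)] by (auto simp: g_def split: if_splits)
    then obtain w v where wv: "w \<in> W" "v \<in> V" "w \<otimes> v' \<ominus> v \<in> V'" "w \<otimes> v' \<ominus> v \<in> N"
      using f(3)[OF VV _ v'] by blast
    note cl = submodD(2)[OF VV(1) wv(2)] submodD(2)[OF VV(2) v'] mult_setD(1)[OF W wv(1)]
    define y where "y = w \<otimes> v' \<ominus> v"
    have y: "y \<in> V'" "y \<in> N" "y \<in> carrier C" using wv cl by (auto simp: y_def)
    show "\<exists>w\<in>W. \<exists>v\<in>V. w \<otimes> v' \<ominus> v \<in> V' \<inter> Z"
    proof (cases "y \<in> sat W Z")
      case True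
      then obtain w' where w': "w' \<in> W" "w' \<otimes> y \<in> Z" by (auto simp: sat_def)
      note cl' = mult_setD(1)[OF W w'(1)]
      have eq: "(w' \<otimes> w) \<otimes> v' \<ominus> w' \<otimes> v = w' \<otimes> y"
        unfolding y_def using cl(1,2) B_in[OF cl(3)] B_in[OF cl'] by algebra
      have "w' \<otimes> y \<in> V'" using submodD(5)[OF VV(2) cl' y(1)] .
      moreover have "w' \<otimes> v \<in> V" using submodD(5)[OF VV(1) cl' wv(2)] .
      ultimately show ?thesis
        using w' eq mult_setD(3)[OF W w'(1) wv(1)]
        by (intro bexI[of _ "w' \<otimes> w"] bexI[of _ "w' \<otimes> v"]) auto
    next
      case False
      then have "jumps W N Z V'" using y by (auto simp: jumps_def)
      then obtain v1 where v1: "v1 \<in> V" "v1 \<in> N" "v1 \<notin> sat W Z"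
        using jj by (auto simp: jumps_def)
      then obtain w' r where w': "w' \<in> W" "r \<in> B" "w' \<otimes> y \<ominus> r \<otimes> v1 \<in> Z"
        using series_Suc(2) y unfolding simple_step_def by blast
      note cl' = mult_setD(1)[OF W w'(1)] submodD(2)[OF VV(1) v1(1)]
      have eq: "(w' \<otimes> w) \<otimes> v' \<ominus> (w' \<otimes> v \<oplus> r \<otimes> v1) = w' \<otimes> y \<ominus> r \<otimes> v1"
        unfolding y_def using cl(1,2) B_in[OF cl(3)] B_in[OF cl'(1)] B_in[OF w'(2)] cl'(2) by algebra
      have "w' \<otimes> y \<ominus> r \<otimes> v1 \<in> V'"
        using submod_minus[OF VV(2)] submodD(5)[OF VV(2)] VV(3) cl' w' y v1 by blast
      moreover have "w' \<otimes> v \<oplus> r \<otimes> v1 \<in> V"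
        using submodD(4,5)[OF VV(1)] cl' wv v1 w' by blast
      ultimately show ?thesis
        using w' eq mult_setD(3)[OF W w'(1) wv(1)]
        by (intro bexI[of _ "w' \<otimes> w"] bexI[of _ "w' \<otimes> v \<oplus> r \<otimes> v1"]) auto
    qed
  qed
qed

text \<open>Used to stop descending chains of saturated submodules between \<open>N\<close> and the
  saturation of \<open>M\<close>. Saturation of the smaller submodule is what turns equality up to
  \<open>W\<close> into equality.\<close>

lemma series_length:
  assumes W: "mult_set W" and "series W n M N"
  obtains f :: "'a set \<Rightarrow> nat" where "\<And>V. f V \<le> n" "\<And>V V'. V \<subseteq> V' \<Longrightarrow> f V \<le> f V'"
    "\<And>V V'. submod V \<Longrightarrow> submod V' \<Longrightarrow> V \<subset> V' \<Longrightarrow> V' \<subseteq> sat W M \<Longrightarrow> N \<subseteq> V \<Longrightarrow> sat W V \<subseteq> V \<Longrightarrow> f V < f V'"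
proof -
  obtain f where f: "\<And>V. f V \<le> n" "\<And>V V'. V \<subseteq> V' \<Longrightarrow> f V \<le> f V'"
    "\<And>V V' v'. submod V \<Longrightarrow> submod V' \<Longrightarrow> V \<subseteq> V' \<Longrightarrow> V' \<subseteq> sat W M \<Longrightarrow> f V = f V' \<Longrightarrow> v' \<in> V' \<Longrightarrow>
      \<exists>w\<in>W. \<exists>v\<in>V. w \<otimes> v' \<ominus> v \<in> V' \<inter> N" using series_rank[OF assms] by metis
  have "f V < f V'" if VV: "submod V" "submod V'" "V \<subset> V'" "V' \<subseteq> sat W M" "N \<subseteq> V" "sat W V \<subseteq> V" for V V'
  proof (rule ccontr)
    assume "\<not> f V < f V'"
    then have eq: "f V = f V'" using f(2)[of V V'] VV(3) by auto
    have "V' \<subseteq> V"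
    proof
      fix v' assume v': "v' \<in> V'"
      then obtain w v where wv: "w \<in> W" "v \<in> V" "w \<otimes> v' \<ominus> v \<in> V"
        using f(3)[OF VV(1,2) _ VV(4) eq v'] VV(3,5) by blast
      note cl = mult_setD(1)[OF W wv(1)] submodD(2)[OF VV(1) wv(2)] submodD(2)[OF VV(2) v']
      have "(w \<otimes> v' \<ominus> v) \<oplus> v \<in> V" using submodD(4)[OF VV(1)] wv by blast
      moreover have "(w \<otimes> v' \<ominus> v) \<oplus> v = w \<otimes> v'"
        using B_in[OF cl(1)] cl(2,3) by algebra
      ultimately have "v' \<in> sat W V" using wv cl by (auto simp: sat_def)
      then show "v' \<in> V" using VV(6) by auto
    qed
    then show False using VV(3) by auto
  qed
  with f show ?thesis by (intro that[of f]) blast+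
qed

end

section \<open>Noetherian subrings\<close>

context cring_over
begin

lemma cring_B: "cring (C \<downharpoonright> B)"
  using subcring_iff subcringI' subring_B B_carrier by blast

lemma submod_B: "submod B"
  using B_carrier B_add B_mult by (auto simp: submod_def)

text \<open>Lets ideals of \<open>B\<close> be treated as submodules of \<open>C\<close>, so that
  series and saturations apply to them without a change of ring.\<close>

lemma ideal_iff: "ideal I (C \<downharpoonright> B) \<longleftrightarrow> I \<subseteq> B \<and> submod I"
proof
  assume "ideal I (C \<downharpoonright> B)"
  then interpret I: ideal I "C \<downharpoonright> B" .
  show "I \<subseteq> B \<and> submod I"
    using I.a_subset additive_subgroup.zero_closed[OF I.is_additive_subgroup]
      additive_subgroup.a_closed[OF I.is_additive_subgroup] I.I_l_closed B_carrier
    by (auto simp: submod_def)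
next
  assume *: "I \<subseteq> B \<and> submod I"
  interpret B: cring "C \<downharpoonright> B" by (rule cring_B)
  have inv: "\<ominus>\<^bsub>C \<downharpoonright> B\<^esub> x = \<ominus> x" if "x \<in> B" for x
    using that B_neg r_neg by (intro B.minus_equality) (auto simp: l_neg)
  show "ideal I (C \<downharpoonright> B)"
  proof (rule idealI)
    show "ring (C \<downharpoonright> B)" by unfold_locales
    show "subgroup I (add_monoid (C \<downharpoonright> B))"
    proof (rule B.add.subgroupI)
      show "I \<subseteq> carrier (C \<downharpoonright> B)" using * by simp
      show "I \<noteq> {}" using * submodD(3) by blast
      fix a assume a: "a \<in> I"
      then show "\<ominus>\<^bsub>C \<downharpoonright> B\<^esub> a \<in> I" using * inv[of a] submod_neg[of I a] by auto
      fix b assume "b \<in> I"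
      then show "a \<oplus>\<^bsub>C \<downharpoonright> B\<^esub> b \<in> I" using * a submodD(4)[of I] by simp
    qed
    fix a x assume "a \<in> I" "x \<in> carrier (C \<downharpoonright> B)"
    then show "x \<otimes>\<^bsub>C \<downharpoonright> B\<^esub> a \<in> I" using * submodD(5) by simp
    then show "a \<otimes>\<^bsub>C \<downharpoonright> B\<^esub> x \<in> I"
      using \<open>a \<in> I\<close> \<open>x \<in> carrier (C \<downharpoonright> B)\<close> * m_comm[of a x] by (auto simp: subset_iff)
  qed
qed

lemma prime_iff: "primeideal P (C \<downharpoonright> B) \<longleftrightarrow> P \<subseteq> B \<and> submod P \<and> \<one> \<notin> P \<and>
    (\<forall>a\<in>B. \<forall>b\<in>B. a \<otimes> b \<in> P \<longrightarrow> a \<in> P \<or> b \<in> P)"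
proof
  assume *: "primeideal P (C \<downharpoonright> B)"
  then interpret P: primeideal P "C \<downharpoonright> B" .
  have "P \<subseteq> B \<and> submod P" using P.is_ideal ideal_iff by blast
  moreover have "\<one> \<notin> P" using P.I_notcarr P.one_imp_carrier by auto
  ultimately show "P \<subseteq> B \<and> submod P \<and> \<one> \<notin> P \<and>
      (\<forall>a\<in>B. \<forall>b\<in>B. a \<otimes> b \<in> P \<longrightarrow> a \<in> P \<or> b \<in> P)"
    using P.I_prime by auto
next
  assume "P \<subseteq> B \<and> submod P \<and> \<one> \<notin> P \<and>
      (\<forall>a\<in>B. \<forall>b\<in>B. a \<otimes> b \<in> P \<longrightarrow> a \<in> P \<or> b \<in> P)"
  then show "primeideal P (C \<downharpoonright> B)"
    using ideal_iff cring_B by (intro primeidealI) auto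
qed

lemma primeD:
  assumes "primeideal P (C \<downharpoonright> B)"
  shows "P \<subseteq> B" "submod P" "\<one> \<notin> P" "\<And>x. x \<in> P \<Longrightarrow> x \<in> B"
    "\<And>a b. a \<in> B \<Longrightarrow> b \<in> B \<Longrightarrow> a \<otimes> b \<in> P \<Longrightarrow> a \<in> P \<or> b \<in> P"
    "\<And>x. x \<in> P \<Longrightarrow> x \<in> carrier C"
  using assms B_in by (auto simp: prime_iff)

lemma prime_pow:
  assumes P: "primeideal P (C \<downharpoonright> B)" and "a \<in> B" "a [^] (n::nat) \<in> P"
  shows "a \<in> P"
  using assms(3)
proof (induction n)
  case 0
  then show ?case using primeD(3)[OF P] by simp
next
  case (Suc n)
  then show ?case using primeD(5)[OF P, of "a [^] n" a] B_pow assms(2) by auto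
qed

lemma mult_set_prime: "primeideal P (C \<downharpoonright> B) \<Longrightarrow> mult_set (B - P)"
  using B_mult by (auto simp: prime_iff mult_set_def)

text \<open>Inverting this set means localizing at \<open>P\<close> and inverting \<open>y\<close>
  too. In both applications \<open>y\<close> is an element of \<open>P\<close>.\<close>

lemma mult_set_powers:
  assumes P: "primeideal P (C \<downharpoonright> B)" and y: "y \<in> B"
  shows "mult_set {s \<otimes> y [^] (k::nat) | s k. s \<in> B - P}"
    and "s \<in> B - P \<Longrightarrow> s \<otimes> y [^] (k::nat) \<in> {s \<otimes> y [^] (k::nat) | s k. s \<in> B - P}"
    and "B - P \<subseteq> {s \<otimes> y [^] (k::nat) | s k. s \<in> B - P}"
    and "y \<in> {s \<otimes> y [^] (k::nat) | s k. s \<in> B - P}"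
proof -
  let ?W = "{s \<otimes> y [^] (k::nat) | s k. s \<in> B - P}"
  note W = mult_set_prime[OF P]
  show WI: "s \<otimes> y [^] (k::nat) \<in> ?W" if "s \<in> B - P" for s k using that by blast
  show sub: "B - P \<subseteq> ?W"
  proof
    fix s assume "s \<in> B - P"
    then show "s \<in> ?W" using WI[of s 0] by simp
  qed
  show "y \<in> ?W" using WI[OF mult_setD(2)[OF W], of 1] y by simp
  show "mult_set ?W"
    unfolding mult_set_def
  proof (intro conjI ballI)
    show "?W \<subseteq> B" using B_mult B_pow[OF y] by auto
    show "\<one> \<in> ?W" using sub mult_setD(2)[OF W] by blast
    fix v w assume "v \<in> ?W" "w \<in> ?W"
    then obtain s i t j where *: "v = s \<otimes> y [^] (i::nat)" "s \<in> B - P"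
      "w = t \<otimes> y [^] (j::nat)" "t \<in> B - P" by auto
    have cl: "s \<in> carrier C" "t \<in> carrier C" "y [^] i \<in> carrier C" "y [^] j \<in> carrier C"
      using * y by auto
    have "v \<otimes> w = (s \<otimes> t) \<otimes> (y [^] i \<otimes> y [^] j)" unfolding * using cl by algebra
    also have "\<dots> = (s \<otimes> t) \<otimes> y [^] (i + j)" using y by (simp add: nat_pow_mult)
    finally show "v \<otimes> w \<in> ?W" using WI[OF mult_setD(3)[OF W *(2,4)]] by simp
  qed
qed

text \<open>The module sum M + Bx, not a ring extension; the ring B[x] is \<open>gen\<close>
  below.\<close>

definition adjoin :: "'a set \<Rightarrow> 'a \<Rightarrow> 'a set"
  where "adjoin M x = {m \<oplus> r \<otimes> x | m r. m \<in> M \<and> r \<in> B}"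

lemma adjoinI: "m \<in> M \<Longrightarrow> r \<in> B \<Longrightarrow> y = m \<oplus> r \<otimes> x \<Longrightarrow> y \<in> adjoin M x"
  by (auto simp: adjoin_def)

lemma submod_adjoin:
  assumes M: "submod M" and x: "x \<in> carrier C"
  shows "submod (adjoin M x)"
  unfolding submod_def
proof (intro conjI ballI)
  show "adjoin M x \<subseteq> carrier C"
    using submodD(2)[OF M] x by (auto simp: adjoin_def)
  have "\<zero> = \<zero> \<oplus> \<zero> \<otimes> x" using x by simp
  then show "\<zero> \<in> adjoin M x"
    using submodD(3)[OF M] by (intro adjoinI[of \<zero> M \<zero>]) auto
  fix u assume "u \<in> adjoin M x"
  then obtain m r where u: "u = m \<oplus> r \<otimes> x" "m \<in> M" "r \<in> B" by (auto simp: adjoin_def)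
  note mC = submodD(2)[OF M u(2)] B_in[OF u(3)]
  { fix b assume b: "b \<in> B"
    have "b \<otimes> u = (b \<otimes> m) \<oplus> (b \<otimes> r) \<otimes> x"
      unfolding u(1) using mC x B_in[OF b] by algebra
    then show "b \<otimes> u \<in> adjoin M x"
      using submodD(5)[OF M b u(2)] B_mult[OF b u(3)] by (rule adjoinI[rotated 2]) }
  fix v assume "v \<in> adjoin M x"
  then obtain m' r' where v: "v = m' \<oplus> r' \<otimes> x" "m' \<in> M" "r' \<in> B" by (auto simp: adjoin_def)
  note mC' = submodD(2)[OF M v(2)] B_in[OF v(3)]
  have "u \<oplus> v = (m \<oplus> m') \<oplus> (r \<oplus> r') \<otimes> x"
    unfolding u(1) v(1) using mC mC' x by algebra
  then show "u \<oplus> v \<in> adjoin M x"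
    using submodD(4)[OF M u(2) v(2)] B_add[OF u(3) v(3)] by (rule adjoinI[rotated 2])
qed

lemma adjoin_incl:
  assumes M: "submod M" and x: "x \<in> carrier C"
  shows "M \<subseteq> adjoin M x" "x \<in> adjoin M x"
proof -
  have "m = m \<oplus> \<zero> \<otimes> x" if "m \<in> M" for m
    using submodD(2)[OF M that] x by simp
  then show "M \<subseteq> adjoin M x" using adjoinI[OF _ B_zero] by blast
  have "x = \<zero> \<oplus> \<one> \<otimes> x" using x by simp
  then show "x \<in> adjoin M x" using submodD(3)[OF M] adjoinI[OF _ B_one] by blast
qed

lemma adjoin_least:
  assumes "submod N" "M \<subseteq> N" "x \<in> N"
  shows "adjoin M x \<subseteq> N"
  using submodD[OF assms(1)] assms(2,3) by (auto simp: adjoin_def)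

lemma adjoin_B: "I \<subseteq> B \<Longrightarrow> x \<in> B \<Longrightarrow> adjoin I x \<subseteq> B"
  using B_add B_mult by (auto simp: adjoin_def)

section \<open>Finite generation, the maximal condition and primary ideals\<close>

fun lin_span :: "'a list \<Rightarrow> 'a set" where
  "lin_span [] = {\<zero>}"
| "lin_span (w # ws) = adjoin (lin_span ws) w"

lemma submod_lin_span: "set ws \<subseteq> carrier C \<Longrightarrow> submod (lin_span ws)"
  by (induction ws) (auto simp: submod_adjoin, auto simp: submod_def)

lemma lin_span_incl: "set ws \<subseteq> carrier C \<Longrightarrow> set ws \<subseteq> lin_span ws"
proof (induction ws)
  case (Cons w ws)
  then show ?case using adjoin_incl[of "lin_span ws" w] submod_lin_span[of ws] by auto
qed simp

lemma lin_span_least: "submod M \<Longrightarrow> set ws \<subseteq> M \<Longrightarrow> lin_span ws \<subseteq> M"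
  by (induction ws) (simp_all add: submodD(3) adjoin_least)

lemma fin_gen:
  assumes "noetherian_ring (C \<downharpoonright> B)" "submod I" "I \<subseteq> B"
  obtains ws where "set ws \<subseteq> I" "I = lin_span ws"
proof -
  interpret N: noetherian_ring "C \<downharpoonright> B" by fact
  have I: "ideal I (C \<downharpoonright> B)" using assms ideal_iff by blast
  then obtain A where A: "A \<subseteq> B" "finite A" "I = Idl\<^bsub>C \<downharpoonright> B\<^esub> A"
    using N.finetely_gen by auto
  then obtain ws where ws: "set ws = A" using finite_list by auto
  have sub: "set ws \<subseteq> I" using N.genideal_self A ws by auto
  have wsC: "set ws \<subseteq> carrier C" using A ws by auto
  have "lin_span ws \<subseteq> B" using lin_span_least[OF submod_B] A ws by auto
  then have "ideal (lin_span ws) (C \<downharpoonright> B)" using ideal_iff submod_lin_span[OF wsC] by blast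
  then have "I \<subseteq> lin_span ws" using A ws N.genideal_minimal lin_span_incl[OF wsC] by blast
  moreover have "lin_span ws \<subseteq> I" using lin_span_least[OF assms(2) sub] .
  ultimately show ?thesis using that sub by blast
qed

text \<open>By the Noetherian hypothesis a nonempty chain of ideals contains its own union, so
  Zorn's lemma applies to any nonempty family.\<close>

lemma maximal_ideal_exists:
  assumes "noetherian_ring (C \<downharpoonright> B)" "\<And>I. I \<in> \<A> \<Longrightarrow> submod I \<and> I \<subseteq> B" "\<A> \<noteq> {}"
  obtains M where "M \<in> \<A>" "\<And>I. I \<in> \<A> \<Longrightarrow> M \<subseteq> I \<Longrightarrow> I = M"
proof -
  interpret N: noetherian_ring "C \<downharpoonright> B" by fact
  have "\<exists>M\<in>\<A>. \<forall>I\<in>\<A>. M \<subseteq> I \<longrightarrow> I = M"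
  proof (rule subset_Zorn_nonempty)
    fix \<C> assume *: "\<C> \<noteq> {}" "subset.chain \<A> \<C>"
    then have "subset.chain {I. ideal I (C \<downharpoonright> B)} \<C>"
      using assms(2) by (auto simp: subset.chain_def ideal_iff)
    then have "\<Union>\<C> \<in> \<C>" using N.ideal_chain_is_trivial * by blast
    then show "\<Union>\<C> \<in> \<A>" using * unfolding subset.chain_def by blast
  qed fact
  then show ?thesis using that by blast
qed

text \<open>An ideal maximal among those disjoint from \<open>W\<close> is prime: if two factors lie
  outside it, each enlarged ideal meets \<open>W\<close>, and the product of the two elements found
  lies in \<open>W\<close> and, when the product of the factors is in the ideal, also in the
  ideal.\<close>

lemma prime_avoiding:
  assumes noeth: "noetherian_ring (C \<downharpoonright> B)" and I: "submod I" "I \<subseteq> B"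
    and W: "mult_set W" "I \<inter> W = {}"
  obtains P where "primeideal P (C \<downharpoonright> B)" "I \<subseteq> P" "P \<inter> W = {}"
proof -
  let ?A = "{J. submod J \<and> J \<subseteq> B \<and> I \<subseteq> J \<and> J \<inter> W = {}}"
  obtain P where P: "P \<in> ?A" and max: "\<And>J. J \<in> ?A \<Longrightarrow> P \<subseteq> J \<Longrightarrow> J = P"
    using maximal_ideal_exists[OF noeth, of ?A] I W by blast
  have sP: "submod P" using P by blast
  have meet: "\<exists>p\<in>P. \<exists>r\<in>B. p \<oplus> r \<otimes> a \<in> W" if a: "a \<in> B" "a \<notin> P" for a
  proof (rule ccontr)
    assume "\<not> ?thesis"
    then have "adjoin P a \<inter> W = {}" by (auto simp: adjoin_def)
    then have "adjoin P a \<in> ?A"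
      using P a submod_adjoin[OF sP, of a] adjoin_B[of P a] adjoin_incl[OF sP, of a] by auto
    then have "adjoin P a = P" using max adjoin_incl[OF sP] a by auto
    then show False using adjoin_incl[OF sP, of a] a by auto
  qed
  have "primeideal P (C \<downharpoonright> B)"
    unfolding prime_iff
  proof (intro conjI ballI impI)
    show "P \<subseteq> B" "submod P" "\<one> \<notin> P" using P W by (auto simp: mult_set_def)
    fix a b assume ab: "a \<in> B" "b \<in> B" "a \<otimes> b \<in> P"
    show "a \<in> P \<or> b \<in> P"
    proof (rule ccontr)
      assume "\<not> ?thesis"
      then obtain p r p' r' where *: "p \<in> P" "r \<in> B" "p \<oplus> r \<otimes> a \<in> W"
        "p' \<in> P" "r' \<in> B" "p' \<oplus> r' \<otimes> b \<in> W" using meet ab by metis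
      have cl: "p \<in> carrier C" "r \<in> carrier C" "a \<in> carrier C" "p' \<in> carrier C" "r' \<in> carrier C"
        "b \<in> carrier C" using * ab P by auto
      have pB: "p \<in> B" "p' \<in> B" using * P by auto
      have eq: "(p \<oplus> r \<otimes> a) \<otimes> (p' \<oplus> r' \<otimes> b) =
        (p' \<otimes> p \<oplus> (r' \<otimes> b) \<otimes> p) \<oplus> ((r \<otimes> a) \<otimes> p' \<oplus> (r \<otimes> r') \<otimes> (a \<otimes> b))"
        using cl by algebra
      have "(p \<oplus> r \<otimes> a) \<otimes> (p' \<oplus> r' \<otimes> b) \<in> P"
        unfolding eq
        using submodD(4)[OF sP submodD(4)[OF sP submodD(5)[OF sP pB(2) *(1)] submodD(5)[OF sP B_mult *(1)]]
            submodD(4)[OF sP submodD(5)[OF sP B_mult *(4)] submodD(5)[OF sP B_mult ab(3)]]] * ab by blast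
      then show False using mult_setD(3)[OF W(1)] * P by blast
    qed
  qed
  then show ?thesis using that P by blast
qed

text \<open>Locally at \<open>p\<close> the ideal is primary to the maximal ideal, so its quotient
  has finite length. Noetherian induction: a maximal counterexample \<open>b\<close> is enlarged by
  an element whose annihilator modulo \<open>b\<close> is, up to saturation, exactly
  \<open>p\<close>.\<close>

lemma series_primary:
  assumes noeth: "noetherian_ring (C \<downharpoonright> B)" and p: "primeideal p (C \<downharpoonright> B)"
    and \<aa>: "submod \<aa>" "\<aa> \<subseteq> B"
    and only: "\<And>q. primeideal q (C \<downharpoonright> B) \<Longrightarrow> \<aa> \<subseteq> q \<Longrightarrow> q \<subseteq> p \<Longrightarrow> q = p"
  shows "\<exists>n. series (B - p) n B \<aa>"
proof (rule ccontr)
  let ?W = "B - p"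
  assume no: "\<not> ?thesis"
  let ?A = "{J. submod J \<and> J \<subseteq> B \<and> \<aa> \<subseteq> J \<and> (\<forall>n. \<not> series ?W n B J)}"
  obtain b where b: "b \<in> ?A" and max: "\<And>J. J \<in> ?A \<Longrightarrow> b \<subseteq> J \<Longrightarrow> J = b"
    using maximal_ideal_exists[OF noeth, of ?A] no \<aa> by blast
  have sb: "submod b" and bB: "b \<subseteq> B" using b by auto
  note W = mult_set_prime[OF p]
  \<comment> \<open>Otherwise the quotient by \<open>b\<close> vanishes after localization, and a
    single step already leads from \<open>B\<close> to \<open>b\<close>.\<close>
  have bp: "b \<subseteq> p"
  proof
    fix x assume x: "x \<in> b"
    show "x \<in> p"
    proof (rule ccontr)
      assume "x \<notin> p"
      then have "x \<in> ?W" using x bB by auto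
      have "v \<in> sat ?W b" if "v \<in> B" for v
      proof -
        have "x \<otimes> v = v \<otimes> x" using x that bB by (auto simp: m_comm)
        then have "x \<otimes> v \<in> b" using submodD(5)[OF sb that x] by simp
        then show ?thesis using that \<open>x \<in> ?W\<close> by (auto simp: sat_def)
      qed
      then have "simple_step ?W B b" using sb bB submod_B by (auto simp: simple_step_def)
      then have "series ?W (Suc 0) B b" using series_Suc series_0 submod_B by blast
      then show False using b by blast
    qed
  qed
  define S where "S = sat ?W b"
  have sS: "submod S" unfolding S_def by (rule submod_sat[OF W sb])
  have SS: "w \<otimes> x \<in> S \<Longrightarrow> w \<in> ?W \<Longrightarrow> x \<in> carrier C \<Longrightarrow> x \<in> S" for w x
  proof -
    fix w x assume "w \<otimes> x \<in> S" "w \<in> ?W" "x \<in> carrier C"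
    then have "x \<in> sat ?W S" by (auto simp: sat_def)
    then show "x \<in> S" using sat_idem[OF W, of b] by (auto simp: S_def)
  qed
  have bS: "b \<subseteq> S" unfolding S_def using sat_incl[OF W] sb submodD(1) by blast
  \<comment> \<open>Colon ideals of the saturation. A maximal one among those of elements outside
    \<open>S\<close> is an associated prime.\<close>
  define col where "col x = {r \<in> B. r \<otimes> x \<in> S}" for x
  have subcol: "submod (col x)" "col x \<subseteq> B" if "x \<in> B" for x
  proof -
    show "col x \<subseteq> B" by (auto simp: col_def)
    show "submod (col x)"
      unfolding submod_def col_def
    proof (intro conjI ballI; clarsimp?)
      show "\<zero> \<otimes> x \<in> S" using that submodD(3)[OF sS] by simp
      fix r assume r: "r \<in> B" "r \<otimes> x \<in> S"
      { fix c assume c: "c \<in> B"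
        have "(c \<otimes> r) \<otimes> x = c \<otimes> (r \<otimes> x)" using that c r by (simp add: m_assoc)
        then show "c \<otimes> r \<in> B \<and> c \<otimes> r \<otimes> x \<in> S" using submodD(5)[OF sS c r(2)] B_mult c r by simp }
      fix r' assume r': "r' \<in> B" "r' \<otimes> x \<in> S"
      have "(r \<oplus> r') \<otimes> x = r \<otimes> x \<oplus> r' \<otimes> x" using that r r' by (simp add: l_distr)
      then show "r \<oplus> r' \<in> B \<and> (r \<oplus> r') \<otimes> x \<in> S"
        using submodD(4)[OF sS r(2) r'(2)] B_add r r' by simp
    qed
  qed
  have oneS: "\<one> \<notin> S" using bp p by (auto simp: S_def sat_def dest!: primeD(4))
  let ?F = "{col x | x. x \<in> B \<and> x \<notin> S}"
  obtain c where c: "c \<in> ?F" and cmax: "\<And>J. J \<in> ?F \<Longrightarrow> c \<subseteq> J \<Longrightarrow> J = c"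
    using maximal_ideal_exists[OF noeth, of ?F] subcol oneS B_one by blast
  then obtain x where x: "x \<in> B" "x \<notin> S" "c = col x" by blast
  have "primeideal c (C \<downharpoonright> B)"
    unfolding prime_iff
  proof (intro conjI ballI impI)
    show "c \<subseteq> B" "submod c" using subcol x by auto
    show "\<one> \<notin> c" using x by (auto simp: col_def)
    fix r r' assume r: "r \<in> B" "r' \<in> B" "r \<otimes> r' \<in> c"
    show "r \<in> c \<or> r' \<in> c"
    proof (cases "r' \<in> c")
      case False
      then have "r' \<otimes> x \<notin> S" using x r by (auto simp: col_def)
      moreover have "c \<subseteq> col (r' \<otimes> x)"
      proof
        fix t assume t: "t \<in> c"
        then have tB: "t \<in> B" "t \<otimes> x \<in> S" using x by (auto simp: col_def)
        have "t \<otimes> (r' \<otimes> x) = r' \<otimes> (t \<otimes> x)" using tB r x by (simp add: m_lcomm)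
        then show "t \<in> col (r' \<otimes> x)" using submodD(5)[OF sS r(2) tB(2)] tB by (simp add: col_def)
      qed
      ultimately have "col (r' \<otimes> x) = c" using cmax B_mult r x by blast
      moreover have "r \<in> col (r' \<otimes> x)"
        using r x by (simp add: col_def m_assoc[symmetric])
      ultimately show ?thesis by simp
    qed simp
  qed
  moreover have "\<aa> \<subseteq> c"
  proof
    fix t assume "t \<in> \<aa>"
    then have t: "t \<in> S" "t \<in> B" using b bS \<aa> by auto
    have "t \<otimes> x = x \<otimes> t" using t x by (simp add: m_comm)
    then show "t \<in> c" using submodD(5)[OF sS x(1) t(1)] t x by (simp add: col_def)
  qed
  moreover have "c \<subseteq> p"
  proof
    fix r assume "r \<in> c"
    then have "r \<in> B" "r \<otimes> x \<in> S" using x by (auto simp: col_def)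
    then show "r \<in> p" using SS[of r x] x by auto
  qed
  ultimately have cp: "c = p" using only by blast
  \<comment> \<open>Since the annihilator of \<open>x\<close> is \<open>p\<close>, this quotient
    localizes to the residue field of \<open>p\<close>. It therefore extends any series that ends at
    b + Bx by one step.\<close>
  have ss: "simple_step ?W (adjoin b x) b"
    unfolding simple_step_def
  proof (intro conjI ballI impI)
    show "submod (adjoin b x)" "submod b" "b \<subseteq> adjoin b x"
      using submod_adjoin[OF sb] adjoin_incl[OF sb] sb x by auto
    fix u v assume "u \<in> adjoin b x" "v \<in> adjoin b x" and vS: "v \<notin> sat ?W b"
    then obtain m r m' r' where u: "u = m \<oplus> r \<otimes> x" "m \<in> b" "r \<in> B"
      and v: "v = m' \<oplus> r' \<otimes> x" "m' \<in> b" "r' \<in> B" by (auto simp: adjoin_def)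
    have "r' \<notin> p"
    proof
      assume "r' \<in> p"
      then have "r' \<otimes> x \<in> S" using cp x by (auto simp: col_def)
      then have "v \<in> S" using v submodD(4)[OF sS] bS by blast
      then show False using vS S_def by simp
    qed
    then have rW: "r' \<in> ?W" using v by simp
    have cl: "m \<in> carrier C" "m' \<in> carrier C" "r \<in> carrier C" "r' \<in> carrier C" "x \<in> carrier C"
      using u v x submodD(2)[OF sb] by auto
    have "r' \<otimes> u \<ominus> r \<otimes> v = r' \<otimes> m \<ominus> r \<otimes> m'"
      unfolding u(1) v(1) using cl by algebra
    also have "\<dots> \<in> b" using submod_minus[OF sb] submodD(5)[OF sb] u v by blast
    finally show "\<exists>w\<in>?W. \<exists>r\<in>B. w \<otimes> u \<ominus> r \<otimes> v \<in> b" using rW u by blast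
  qed
  have "x \<in> adjoin b x" "x \<notin> b" using adjoin_incl[OF sb] x bS by auto
  then have "adjoin b x \<noteq> b" by blast
  then have "adjoin b x \<notin> ?A" using max[OF _ adjoin_incl(1)[OF sb, of x]] x(1) B_in by blast
  moreover have "submod (adjoin b x)" "adjoin b x \<subseteq> B" "\<aa> \<subseteq> adjoin b x"
    using submod_adjoin[OF sb] adjoin_B[OF bB] adjoin_incl[OF sb, of x] b x by auto
  ultimately obtain n where "series ?W n B (adjoin b x)" by blast
  then have "series ?W (Suc n) B b" using series_Suc ss by blast
  then show False using b by blast
qed

end

section \<open>Krull's height theorem\<close>

context cring_over
begin

section \<open>Nakayama's lemma\<close>

definition lin_span_in :: "'a set \<Rightarrow> 'a list \<Rightarrow> 'a set"
  where "lin_span_in p ws = foldr (\<lambda>w M. {m \<oplus> r \<otimes> w | m r. m \<in> M \<and> r \<in> p}) ws {\<zero>}"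

lemma lin_span_in_simps [simp]: "lin_span_in p [] = {\<zero>}"
  "lin_span_in p (w # ws) = {m \<oplus> r \<otimes> w | m r. m \<in> lin_span_in p ws \<and> r \<in> p}"
  by (auto simp: lin_span_in_def)

lemma submod_lin_span_in:
  assumes p: "submod p" "p \<subseteq> B" and "set ws \<subseteq> carrier C"
  shows "submod (lin_span_in p ws)"
  using assms(3)
proof (induction ws)
  case Nil
  then show ?case by (auto simp: submod_def)
next
  case (Cons w ws)
  then have S: "submod (lin_span_in p ws)" and w: "w \<in> carrier C" by auto
  note SC = submodD(2)[OF S]
  have pC: "r \<in> carrier C" if "r \<in> p" for r using that p by auto
  show ?case
    unfolding submod_def
  proof (intro conjI ballI)
    show "lin_span_in p (w # ws) \<subseteq> carrier C" using SC pC w by auto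
    have "\<zero> = \<zero> \<oplus> \<zero> \<otimes> w" using w by simp
    then show "\<zero> \<in> lin_span_in p (w # ws)" using submodD(3)[OF S] submodD(3)[OF p(1)] by auto
    fix u assume "u \<in> lin_span_in p (w # ws)"
    then obtain m r where u: "u = m \<oplus> r \<otimes> w" "m \<in> lin_span_in p ws" "r \<in> p" by auto
    { fix b assume b: "b \<in> B"
      have "b \<otimes> u = (b \<otimes> m) \<oplus> (b \<otimes> r) \<otimes> w"
        unfolding u(1) using SC[OF u(2)] pC[OF u(3)] w B_in[OF b] by algebra
      then show "b \<otimes> u \<in> lin_span_in p (w # ws)"
        using submodD(5)[OF S b u(2)] submodD(5)[OF p(1) b u(3)] by auto }
    fix v assume "v \<in> lin_span_in p (w # ws)"
    then obtain m' r' where v: "v = m' \<oplus> r' \<otimes> w" "m' \<in> lin_span_in p ws" "r' \<in> p" by auto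
    have "u \<oplus> v = (m \<oplus> m') \<oplus> (r \<oplus> r') \<otimes> w"
      unfolding u(1) v(1) using SC[OF u(2)] pC[OF u(3)] SC[OF v(2)] pC[OF v(3)] w by algebra
    then show "u \<oplus> v \<in> lin_span_in p (w # ws)"
      using submodD(4)[OF S u(2) v(2)] submodD(4)[OF p(1) u(3) v(3)] by auto
  qed
qed

lemma mult_lin_span:
  assumes p: "submod p" "p \<subseteq> B" "x \<in> p" and "set ws \<subseteq> carrier C" "m \<in> lin_span ws"
  shows "x \<otimes> m \<in> lin_span_in p ws"
  using assms(4,5)
proof (induction ws arbitrary: m)
  case Nil
  then show ?case using p by auto
next
  case (Cons w ws)
  then obtain n r where m: "m = n \<oplus> r \<otimes> w" "n \<in> lin_span ws" "r \<in> B" by (auto simp: adjoin_def)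
  have cl: "n \<in> carrier C" "w \<in> carrier C" "x \<in> carrier C"
    using submodD(2)[OF submod_lin_span m(2)] Cons(2) p by auto
  have "x \<otimes> m = x \<otimes> n \<oplus> (r \<otimes> x) \<otimes> w"
    unfolding m(1) using cl B_in[OF m(3)] by algebra
  moreover have "x \<otimes> n \<in> lin_span_in p ws" using Cons m by simp
  moreover have "r \<otimes> x \<in> p" using submodD(5)[OF p(1) m(3) p(3)] .
  ultimately show ?case by auto
qed

text \<open>Elimination of the generators one at a time replaces the usual determinant argument.\<close>

lemma nakayama_aux:
  assumes p: "primeideal p (C \<downharpoonright> B)" and N: "submod N" and "set ws \<subseteq> carrier C"
    and "\<And>w. w \<in> set ws \<Longrightarrow> \<exists>s\<in>B - p. \<exists>c\<in>lin_span_in p ws. s \<otimes> w \<ominus> c \<in> N"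
  shows "set ws \<subseteq> sat (B - p) N"
  using assms(3,4)
proof (induction ws)
  case (Cons w ws)
  let ?W = "B - p"
  have sp: "submod p" "p \<subseteq> B" using primeD[OF p] by auto
  note W = mult_set_prime[OF p]
  have wsC: "set ws \<subseteq> carrier C" and wC: "w \<in> carrier C" using Cons(2) by auto
  note P = submod_lin_span_in[OF sp wsC]
  note PC = submodD(2)[OF P]
  have pC: "r \<in> carrier C" if "r \<in> p" for r using that sp by auto
  note NC = submodD(2)[OF N]
  obtain s c where sc: "s \<in> ?W" "c \<in> lin_span_in p (w # ws)" "s \<otimes> w \<ominus> c \<in> N"
    using Cons(3)[of w] by auto
  obtain c' c1 where c: "c = c' \<oplus> c1 \<otimes> w" "c' \<in> lin_span_in p ws" "c1 \<in> p" using sc by auto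
  \<comment> \<open>The coefficient of \<open>w\<close> after its own contribution \<open>c1\<close>
    is moved to the left. It is outside \<open>p\<close>, because \<open>s\<close> is outside and
    \<open>c1\<close> is inside, so the relation can be solved for \<open>w\<close> locally.\<close>
  define s1 where "s1 = s \<ominus> c1"
  have s1: "s1 \<in> ?W"
  proof -
    have "s1 \<in> B" using sc c sp B_minus by (auto simp: s1_def)
    moreover have "s \<in> p" if "s1 \<in> p"
    proof -
      have "s1 \<oplus> c1 \<in> p" using that c submodD(4)[OF sp(1)] by blast
      moreover have "s \<in> carrier C" using sc by auto
      then have "s1 \<oplus> c1 = s" unfolding s1_def using pC[OF c(3)] by algebra
      ultimately show ?thesis by simp
    qed
    ultimately show ?thesis using sc by auto
  qed
  define n where "n = s \<otimes> w \<ominus> c"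
  have n: "n \<in> N" using sc n_def by simp
  have s1C: "s1 \<in> carrier C" using s1 by auto
  have cl: "s \<in> carrier C" "c' \<in> carrier C" "c1 \<in> carrier C" "n \<in> carrier C"
    using sc c PC pC NC n by auto
  have s1w: "s1 \<otimes> w = c' \<oplus> n"
    unfolding s1_def n_def c(1) using cl(1-3) wC by algebra
  have "set ws \<subseteq> sat ?W N"
  proof (rule Cons(1)[OF wsC])
    fix v assume v: "v \<in> set ws"
    then obtain t d where td: "t \<in> ?W" "d \<in> lin_span_in p (w # ws)" "t \<otimes> v \<ominus> d \<in> N"
      using Cons(3)[of v] by auto
    obtain d' d1 where d: "d = d' \<oplus> d1 \<otimes> w" "d' \<in> lin_span_in p ws" "d1 \<in> p" using td by auto
    have cl': "v \<in> carrier C" "t \<in> carrier C" "d' \<in> carrier C" "d1 \<in> carrier C"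
      using v wsC td d PC pC by auto
    \<comment> \<open>Multiplying the relation for \<open>v\<close> by \<open>s1\<close> allows
      \<open>s1 w\<close> to be replaced by \<open>c'\<close> modulo \<open>N\<close>, which removes
      \<open>w\<close>.\<close>
    have "(s1 \<otimes> t) \<otimes> v \<ominus> (d1 \<otimes> c' \<oplus> s1 \<otimes> d') =
      s1 \<otimes> (t \<otimes> v \<ominus> (d' \<oplus> d1 \<otimes> w)) \<oplus> d1 \<otimes> (s1 \<otimes> w \<ominus> c')"
      using cl cl' s1C wC by algebra
    also have "\<dots> = s1 \<otimes> (t \<otimes> v \<ominus> d) \<oplus> d1 \<otimes> n"
      unfolding s1w d(1) using cl by algebra
    also have "\<dots> \<in> N"
      using submodD(4,5)[OF N] td n s1 d sp by blast
    finally have "(s1 \<otimes> t) \<otimes> v \<ominus> (d1 \<otimes> c' \<oplus> s1 \<otimes> d') \<in> N" .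
    moreover have "d1 \<otimes> c' \<oplus> s1 \<otimes> d' \<in> lin_span_in p ws"
      using submodD(4,5)[OF P] c d s1 sp by blast
    moreover have "s1 \<otimes> t \<in> ?W" using mult_setD(3)[OF W s1 td(1)] .
    ultimately show "\<exists>s\<in>?W. \<exists>c\<in>lin_span_in p ws. s \<otimes> v \<ominus> c \<in> N" by blast
  qed
  moreover have sS: "submod (sat ?W N)" using submod_sat[OF W N] .
  moreover have "lin_span_in p ws \<subseteq> sat ?W N"
  proof -
    have "lin_span_in p vs \<subseteq> sat ?W N" if "set vs \<subseteq> sat ?W N" for vs
      using that
    proof (induction vs)
      case (Cons v vs)
      have "m \<oplus> r \<otimes> v \<in> sat ?W N" if "m \<in> lin_span_in p vs" "r \<in> p" for m r
        using that Cons sp submodD(4)[OF sS, of m "r \<otimes> v"] submodD(5)[OF sS, of r v] by auto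
      then show ?case by auto
    qed (use submodD(3)[OF sS] in auto)
    then show ?thesis using calculation by blast
  qed
  ultimately have "s1 \<otimes> w \<in> sat ?W N"
    unfolding s1w using submodD(4)[OF sS, of c' n] c n sat_incl[OF W submodD(1)[OF N]] by blast
  then have "w \<in> sat ?W (sat ?W N)" using s1 wC unfolding sat_def by blast
  then have "w \<in> sat ?W N" using sat_idem[OF W] by blast
  then show ?case using \<open>set ws \<subseteq> sat ?W N\<close> by simp
qed simp

text \<open>The hypothesis says that M lies in xM + N locally at \<open>p\<close>. Over a finite
  generating set, \<open>x\<close> times an element of M becomes a combination with coefficients in
  \<open>p\<close>.\<close>

lemma nakayama:
  assumes noeth: "noetherian_ring (C \<downharpoonright> B)" and p: "primeideal p (C \<downharpoonright> B)" and x: "x \<in> p"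
    and M: "submod M" "M \<subseteq> B" and N: "submod N"
    and step: "\<And>w. w \<in> M \<Longrightarrow> \<exists>s\<in>B - p. \<exists>r\<in>M. s \<otimes> w \<ominus> x \<otimes> r \<in> N"
  shows "M \<subseteq> sat (B - p) N"
proof -
  obtain ws where ws: "set ws \<subseteq> M" "M = lin_span ws" using fin_gen[OF noeth M] .
  have wsC: "set ws \<subseteq> carrier C" using ws M submodD(1) by blast
  have sp: "submod p" "p \<subseteq> B" using primeD[OF p] by auto
  have "set ws \<subseteq> sat (B - p) N"
  proof (rule nakayama_aux[OF p N wsC])
    fix w assume "w \<in> set ws"
    then obtain s r where "s \<in> B - p" "r \<in> M" "s \<otimes> w \<ominus> x \<otimes> r \<in> N" using step ws by blast
    then show "\<exists>s\<in>B - p. \<exists>c\<in>lin_span_in p ws. s \<otimes> w \<ominus> c \<in> N"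
      using mult_lin_span[OF sp x wsC] ws by blast
  qed
  then show ?thesis
    using lin_span_least[OF submod_sat[OF mult_set_prime[OF p] N]] ws by blast
qed

text \<open>Krull's theorem for the domain B/q0. The quotient by q0 + xB has finite length at
  \<open>p\<close>, so the ideals b_k + xB stabilize there, and Nakayama removes the summand xB.
  Then a^k lies in b_(k+1), and cancelling a^k puts some s x^j with s outside \<open>p\<close> into
  \<open>q\<close>, although neither s nor x is in \<open>q\<close>.\<close>

theorem principal_ideal_theorem:
  assumes noeth: "noetherian_ring (C \<downharpoonright> B)"
    and pr: "primeideal q0 (C \<downharpoonright> B)" "primeideal q (C \<downharpoonright> B)" "primeideal p (C \<downharpoonright> B)"
    and strict: "q0 \<subset> q" "q \<subset> p" and x: "x \<in> p"
    and min: "\<And>q'. primeideal q' (C \<downharpoonright> B) \<Longrightarrow> q0 \<subseteq> q' \<Longrightarrow> x \<in> q' \<Longrightarrow> q' \<subseteq> p \<Longrightarrow> q' = p"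
  shows False
proof -
  let ?W = "B - p"
  note W = mult_set_prime[OF pr(3)]
  have s0: "submod q0" "q0 \<subseteq> B" using primeD[OF pr(1)] by auto
  have xB: "x \<in> B" and xC: "x \<in> carrier C" and xq: "x \<notin> q"
    using primeD(4)[OF pr(3) x] min[OF pr(2)] strict by auto
  let ?a0 = "adjoin q0 x"
  have sa: "submod ?a0" "?a0 \<subseteq> B" using submod_adjoin[OF s0(1)] adjoin_B[OF s0(2) xB] xB by auto
  have q0a: "q0 \<subseteq> ?a0" "x \<in> ?a0" using adjoin_incl[OF s0(1) xC] .
  obtain n where ser: "series ?W n B ?a0"
    using series_primary[OF noeth pr(3) sa] min q0a by blast
  obtain f :: "'a set \<Rightarrow> nat" where f: "\<And>V V'. submod V \<Longrightarrow> submod V' \<Longrightarrow> V \<subset> V' \<Longrightarrow>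
      V' \<subseteq> sat ?W B \<Longrightarrow> ?a0 \<subseteq> V \<Longrightarrow> sat ?W V \<subseteq> V \<Longrightarrow> f V < f V'"
    using series_length[OF W ser] by metis
  obtain a where a: "a \<in> q" "a \<notin> q0" using strict by blast
  have aB: "a \<in> B" using primeD(4)[OF pr(2) a(1)] .
  define W' where "W' = {s \<otimes> x [^] j | s (j::nat). s \<in> ?W}"
  note W'_lems = mult_set_powers[OF pr(3) xB, folded W'_def]
  note W' = W'_lems(1) and xW' = W'_lems(4)
  have WW': "s \<in> W'" if "s \<in> ?W" for s using W'_lems(3) that by blast
  \<comment> \<open>\<open>b k\<close> is the ideal \<open>(a\<^sup>k R + q\<^sub>0) : x\<^sup>\<infinity>\<close>, used in place of the symbolic powers of \<open>q\<close>.\<close>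
  define b where "b k = sat W' (adjoin q0 (a [^] (k::nat))) \<inter> B" for k
  have sad: "submod (adjoin q0 (a [^] k))" for k :: nat using submod_adjoin[OF s0(1)] aB by simp
  have sb: "submod (b k)" and bB: "b k \<subseteq> B" for k
  proof -
    show "b k \<subseteq> B" by (simp add: b_def)
    have "submod (sat W' (adjoin q0 (a [^] k)))" by (rule submod_sat[OF W' sad])
    then show "submod (b k)" using submod_B by (auto simp: b_def submod_def)
  qed
  have bsat: "y \<in> b k" if "w \<in> W'" "y \<in> B" "w \<otimes> y \<in> b k" for w y k
  proof -
    have "y \<in> sat W' (sat W' (adjoin q0 (a [^] k)))" using that by (auto simp: b_def sat_def[of _ "sat _ _"])
    then show ?thesis using sat_idem[OF W'] that by (auto simp: b_def)
  qed
  have q0b: "q0 \<subseteq> b k" for k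
    using adjoin_incl(1)[OF s0(1), of "a [^] k"] aB sat_incl[OF W' submodD(1)[OF sad[of k]]] s0(2)
    by (auto simp: b_def)
  have ab: "a [^] k \<in> b k" for k
    using adjoin_incl(2)[OF s0(1), of "a [^] k"] aB sat_incl[OF W' submodD(1)[OF sad[of k]]] B_pow[OF aB]
    by (auto simp: b_def)
  have dec: "b (Suc k) \<subseteq> b k" for k
  proof -
    have "a [^] Suc k = a \<otimes> a [^] k" using aB by (simp add: m_comm)
    then have "a [^] Suc k \<in> adjoin q0 (a [^] k)"
      using submodD(5)[OF sad aB adjoin_incl(2)[OF s0(1), of "a [^] k"]] aB by simp
    then have "adjoin q0 (a [^] Suc k) \<subseteq> adjoin q0 (a [^] k)"
      using adjoin_least[OF sad[of k]] adjoin_incl(1)[OF s0(1), of "a [^] k"] aB by simp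
    then show ?thesis using sat_mono unfolding b_def by blast
  qed
  \<comment> \<open>The descending chain to which the length bound is applied; every member contains
    q0 + xB.\<close>
  define V where "V k = sat ?W (adjoin (b k) x)" for k
  have sV: "submod (V k)" for k unfolding V_def by (intro submod_sat[OF W] submod_adjoin sb xC)
  have mono: "adjoin M x \<subseteq> adjoin M' x" if "M \<subseteq> M'" for M M' using that by (auto simp: adjoin_def)
  have decV: "V (Suc k) \<subseteq> V k" for k unfolding V_def by (intro sat_mono mono dec)
  have "\<exists>k. V (Suc k) = V k"
  proof (rule ccontr)
    assume "\<not> ?thesis"
    then have st: "V (Suc k) \<subset> V k" for k using decV by blast
    have "f (V (Suc k)) < f (V k)" for k
    proof (rule f[OF sV sV st])
      show "V k \<subseteq> sat ?W B" unfolding V_def by (intro sat_mono adjoin_B bB xB)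
      show "?a0 \<subseteq> V (Suc k)"
        using mono[OF q0b] sat_incl[OF W submodD(1)[OF submod_adjoin[OF sb xC]]] unfolding V_def by blast
      show "sat ?W (V (Suc k)) \<subseteq> V (Suc k)" unfolding V_def by (rule sat_idem[OF W])
    qed
    then have "f (V k) + k \<le> f (V 0)" for k
    proof (induction k)
      case (Suc k)
      then show ?case using Suc(2)[of k] Suc(1) by fastforce
    qed simp
    from this[of "Suc (f (V 0))"] show False by simp
  qed
  then obtain k where k: "V (Suc k) = V k" by blast
  have "b k \<subseteq> sat ?W (b (Suc k))"
  proof (rule nakayama[OF noeth pr(3) x sb bB sb])
    fix w assume w: "w \<in> b k"
    have "adjoin (b k) x \<subseteq> V k" unfolding V_def by (intro sat_incl[OF W] submodD(1) submod_adjoin sb xC)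
    then have "w \<in> V (Suc k)" using w adjoin_incl(1)[OF sb xC] k by blast
    then obtain s where s: "s \<in> ?W" "s \<otimes> w \<in> adjoin (b (Suc k)) x" by (auto simp: V_def sat_def)
    then obtain c r where c: "s \<otimes> w = c \<oplus> r \<otimes> x" "c \<in> b (Suc k)" "r \<in> B" by (auto simp: adjoin_def)
    have cl: "s \<in> carrier C" "w \<in> carrier C" "c \<in> carrier C" "r \<in> carrier C"
      using s w c submodD(2)[OF sb] by auto
    \<comment> \<open>As \<open>x\<close> is in \<open>W'\<close> and \<open>b k\<close> is
      saturated by \<open>W'\<close>, a product \<open>x r\<close> in \<open>b k\<close> forces
      \<open>r\<close> into \<open>b k\<close>. Hence the error term needed for Nakayama is x times
      an element of \<open>b k\<close> itself.\<close>
    have "x \<otimes> r = s \<otimes> w \<ominus> c" unfolding c(1) using cl xC by algebra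
    also have "\<dots> \<in> b k" using submod_minus[OF sb] submodD(5)[OF sb] s w c dec by blast
    finally have "r \<in> b k" using bsat[OF xW' c(3)] by blast
    moreover have "s \<otimes> w \<ominus> x \<otimes> r = c" unfolding c(1) using cl xC by algebra
    ultimately show "\<exists>s\<in>?W. \<exists>r\<in>b k. s \<otimes> w \<ominus> x \<otimes> r \<in> b (Suc k)" using s c by blast
  qed
  then obtain s where s: "s \<in> ?W" "s \<otimes> a [^] k \<in> b (Suc k)" using ab[of k] by (auto simp: sat_def)
  then have "a [^] k \<in> b (Suc k)" using bsat[OF WW' B_pow[OF aB]] by blast
  then obtain w where w: "w \<in> W'" "w \<otimes> a [^] k \<in> adjoin q0 (a [^] Suc k)" by (auto simp: b_def sat_def)
  then obtain c r where c: "w \<otimes> a [^] k = c \<oplus> r \<otimes> a [^] Suc k" "c \<in> q0" "r \<in> B" by (auto simp: adjoin_def)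
  have wB: "w \<in> B" using mult_setD(1)[OF W' w(1)] .
  have cl: "w \<in> carrier C" "r \<in> carrier C" "c \<in> carrier C" "a \<in> carrier C" "a [^] k \<in> carrier C"
    using wB c s0 aB by auto
  \<comment> \<open>From \<open>w\<close> times a^k congruent to \<open>r\<close> times a^(k+1)
    modulo \<open>q0\<close>, the factor a^k is cancelled because \<open>a\<close> is outside the
    prime \<open>q0\<close>.\<close>
  have "(w \<ominus> r \<otimes> a) \<otimes> a [^] k = w \<otimes> a [^] k \<ominus> r \<otimes> (a [^] k \<otimes> a)" using cl by algebra
  also have "\<dots> = c \<oplus> r \<otimes> (a [^] k \<otimes> a) \<ominus> r \<otimes> (a [^] k \<otimes> a)" using c(1) by simp
  also have "\<dots> = c" using cl by algebra
  finally have "(w \<ominus> r \<otimes> a) \<otimes> a [^] k \<in> q0" using c by simp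
  moreover have wra: "w \<ominus> r \<otimes> a \<in> B" using wB c aB B_minus B_mult by blast
  ultimately have "w \<ominus> r \<otimes> a \<in> q0"
    using primeD(5)[OF pr(1) wra B_pow[OF aB]] prime_pow[OF pr(1) aB] a by blast
  then have "(w \<ominus> r \<otimes> a) \<oplus> r \<otimes> a \<in> q"
    using strict submodD(4,5)[OF primeD(2)[OF pr(2)]] a c by blast
  moreover have "(w \<ominus> r \<otimes> a) \<oplus> r \<otimes> a = w" using cl by algebra
  ultimately have "w \<in> q" by simp
  moreover obtain s j where s: "w = s \<otimes> x [^] (j::nat)" "s \<in> ?W" using w by (auto simp: W'_def)
  ultimately have "s \<in> q \<or> x [^] j \<in> q" using primeD(5)[OF pr(2)] B_pow[OF xB] by auto
  then show False using s strict prime_pow[OF pr(2) xB] xq by blast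
qed

text \<open>Induction on the number of generators. The last step of the chain is refined to a prime
  \<open>q\<close> directly below \<open>p\<close>; one generator \<open>x\<close> lies outside
  \<open>q\<close>, and the remaining ones are replaced by elements of \<open>q\<close> that make
  \<open>q\<close> minimal over one generator fewer.\<close>

theorem height_theorem:
  assumes noeth: "noetherian_ring (C \<downharpoonright> B)"
    and "primeideal p (C \<downharpoonright> B)" "set xs \<subseteq> p"
    and "\<And>q. primeideal q (C \<downharpoonright> B) \<Longrightarrow> set xs \<subseteq> q \<Longrightarrow> q \<subseteq> p \<Longrightarrow> q = p"
    and "prime_chain (C \<downharpoonright> B) n P" "P n = p"
  shows "n \<le> length xs"
  using assms(2-)
proof (induction "length xs" arbitrary: p xs n P)
  case 0
  show ?case
  proof (cases n)
    case (Suc m)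
    then have "primeideal (P m) (C \<downharpoonright> B)" "P m \<subset> p" using 0 by (auto simp: prime_chain_def)
    moreover have "set xs \<subseteq> P m" using 0(1) by simp
    ultimately show ?thesis using 0(4) by blast
  qed simp
next
  case (Suc r)
  note p = Suc(3) and xsp = Suc(4) and pmin = Suc(5) and chain = Suc(6,7)
  show ?case
  proof (cases n)
    case n: (Suc m)
    have Pm: "primeideal (P m) (C \<downharpoonright> B)" "P m \<subset> p" using chain n by (auto simp: prime_chain_def)
    \<comment> \<open>Choosing \<open>q\<close> maximal in this family leaves no prime strictly
      between \<open>q\<close> and \<open>p\<close>, so \<open>p\<close> is minimal over q +
      xB.\<close>
    let ?A = "{q. primeideal q (C \<downharpoonright> B) \<and> P m \<subseteq> q \<and> q \<subset> p}"
    obtain q where q: "q \<in> ?A" and qmax: "\<And>I. I \<in> ?A \<Longrightarrow> q \<subseteq> I \<Longrightarrow> I = q"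
    proof (rule maximal_ideal_exists[OF noeth, of ?A])
      show "I \<in> ?A \<Longrightarrow> submod I \<and> I \<subseteq> B" for I using primeD(1,2) by blast
      show "?A \<noteq> {}" using Pm by blast
    qed blast
    have qp: "primeideal q (C \<downharpoonright> B)" "P m \<subseteq> q" "q \<subset> p" using q by auto
    note sq = primeD(1,2)[OF qp(1)]
    have "\<not> set xs \<subseteq> q" using pmin[OF qp(1)] qp by blast
    then obtain x where x: "x \<in> set xs" "x \<notin> q" by blast
    have xp: "x \<in> p" using x xsp by blast
    have xB: "x \<in> B" using primeD(4)[OF p xp] .
    let ?a = "adjoin q x"
    have sa: "submod ?a" "?a \<subseteq> B" using submod_adjoin[OF sq(2)] adjoin_B[OF sq(1) xB] xB by auto
    have qa: "q \<subseteq> ?a" "x \<in> ?a" using adjoin_incl[OF sq(2)] xB by auto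
    have only: "q' = p" if "primeideal q' (C \<downharpoonright> B)" "?a \<subseteq> q'" "q' \<subseteq> p" for q'
      using qmax[of q'] that qa qp x by blast
    \<comment> \<open>Locally at \<open>p\<close>, every element of \<open>p\<close> is nilpotent
      modulo q + xB: otherwise a prime over that ideal would avoid all s y^k, hence lie inside
      \<open>p\<close> and miss \<open>y\<close>.\<close>
    have ex: "\<exists>s\<in>B - p. \<exists>k::nat. s \<otimes> y [^] k \<in> ?a" if y: "y \<in> p" for y
    proof (rule ccontr)
      assume no: "\<not> ?thesis"
      have yB: "y \<in> B" using primeD(4)[OF p y] .
      let ?W = "{s \<otimes> y [^] k | s (k::nat). s \<in> B - p}"
      note W2 = mult_set_powers[OF p yB]
      have disj: "?a \<inter> ?W = {}" using no by blast
      obtain q' where q': "primeideal q' (C \<downharpoonright> B)" "?a \<subseteq> q'" "q' \<inter> ?W = {}"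
        by (rule prime_avoiding[OF noeth sa W2(1) disj])
      have "q' \<subseteq> p"
      proof
        fix s assume s: "s \<in> q'"
        then have "s \<in> B" using primeD(4)[OF q'(1)] by blast
        then show "s \<in> p" using W2(3) s q'(3) by blast
      qed
      then have "q' = p" using only q' by blast
      then show False using q'(3) y W2(4) by blast
    qed
    have ex': "\<exists>w\<in>q. \<exists>s\<in>B - p. \<exists>k::nat. \<exists>r\<in>B. s \<otimes> y [^] k = w \<oplus> r \<otimes> x" if y: "y \<in> p" for y
    proof -
      obtain s k where s: "s \<in> B - p" "s \<otimes> y [^] (k::nat) \<in> ?a" using ex[OF y] by blast
      then obtain w r where "s \<otimes> y [^] k = w \<oplus> r \<otimes> x" "w \<in> q" "r \<in> B"
        unfolding adjoin_def by blast
      then show ?thesis using s(1) by (intro bexI exI)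
    qed
    then obtain g where g: "\<And>y. y \<in> p \<Longrightarrow> g y \<in> q"
      "\<And>y. y \<in> p \<Longrightarrow> \<exists>s\<in>B - p. \<exists>k::nat. \<exists>r\<in>B. s \<otimes> y [^] k = g y \<oplus> r \<otimes> x" by metis
    \<comment> \<open>A replacement \<open>g y\<close> agrees with s y^k up to a multiple of
      \<open>x\<close>. A prime inside \<open>p\<close> containing \<open>x\<close> and
      \<open>g y\<close> therefore contains \<open>y\<close>.\<close>
    define ys where "ys = map g (remove1 x xs)"
    have len: "length ys = r" using Suc(2) x by (simp add: ys_def length_remove1)
    have "set (remove1 x xs) \<subseteq> p" using xsp set_remove1_subset[of x xs] by blast
    then have ysq: "set ys \<subseteq> q" using g by (auto simp: ys_def)
    have "m \<le> length ys"
    proof (rule Suc(1)[of ys q m "P(m := q)"])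
      show "r = length ys" "primeideal q (C \<downharpoonright> B)" "set ys \<subseteq> q" using len qp ysq by auto
      show "prime_chain (C \<downharpoonright> B) m (P(m := q))"
        unfolding prime_chain_def
      proof (intro conjI allI impI)
        fix i
        show "primeideal ((P(m := q)) i) (C \<downharpoonright> B)" if "i \<le> m"
          using that chain n qp by (auto simp: prime_chain_def)
        assume i: "i < m"
        then have "P i \<subset> P (Suc i)" using chain n by (auto simp: prime_chain_def)
        then show "(P(m := q)) i \<subset> (P(m := q)) (Suc i)" using i qp by auto
      qed
      show "(P(m := q)) m = q" by simp
      fix q' assume q': "primeideal q' (C \<downharpoonright> B)" "set ys \<subseteq> q'" "q' \<subseteq> q"
      show "q' = q"
      proof (rule ccontr)
        assume "q' \<noteq> q"
        then have "q' \<subset> q" using q' by blast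
        \<comment> \<open>A smaller prime over \<open>ys\<close> would give three primes q' < q < p
          with \<open>p\<close> minimal over q' and \<open>x\<close>.\<close>
        then show False
        proof (rule principal_ideal_theorem[OF noeth q'(1) qp(1) p _ qp(3) xp])
          fix p' assume p': "primeideal p' (C \<downharpoonright> B)" "q' \<subseteq> p'" "x \<in> p'" "p' \<subseteq> p"
          have "set xs \<subseteq> p'"
          proof
            fix y assume y: "y \<in> set xs"
            show "y \<in> p'"
            proof (cases "y = x")
              case False
              then have "y \<in> set (remove1 x xs)" using y by simp
              then have "g y \<in> p'" using q' p' by (auto simp: ys_def)
              moreover have yp: "y \<in> p" using y xsp by blast
              then obtain s k t where s: "s \<in> B - p" "t \<in> B" "s \<otimes> y [^] (k::nat) = g y \<oplus> t \<otimes> x"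
                using g(2) by blast
              ultimately have "s \<otimes> y [^] k \<in> p'"
                using submodD(4,5)[OF primeD(2)[OF p'(1)]] p' by simp
              then show ?thesis
                using primeD(5)[OF p'(1), of s "y [^] k"] s p' primeD(4)[OF p yp] B_pow prime_pow[OF p'(1)]
                by blast
            qed (use p' in simp)
          qed
          then show "p' = p" using pmin p' by blast
        qed
      qed
    qed
    then show ?thesis using len n Suc(2) by simp
  qed simp
qed

text \<open>A finite generating set of \<open>p\<close> is used: \<open>p\<close> is trivially
  minimal over its own generators.\<close>

corollary finite_height:
  assumes noeth: "noetherian_ring (C \<downharpoonright> B)" and p: "primeideal p (C \<downharpoonright> B)"
  obtains N where "\<And>n P. prime_chain (C \<downharpoonright> B) n P \<Longrightarrow> P n = p \<Longrightarrow> n \<le> N"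
proof -
  obtain ws where ws: "set ws \<subseteq> p" "p = lin_span ws" using fin_gen[OF noeth primeD(2,1)[OF p]] .
  have "q = p" if q: "primeideal q (C \<downharpoonright> B)" "set ws \<subseteq> q" "q \<subseteq> p" for q
    using lin_span_least[OF primeD(2)[OF q(1)] q(2)] ws q(3) by blast
  then show ?thesis using height_theorem[OF noeth p ws(1)] that by blast
qed

end

section \<open>Adjoining one element\<close>

context cring_over
begin

text \<open>The submodule N + aM. With a prime \<open>Q\<close> for \<open>N\<close> it represents
  the multiple by \<open>a\<close> of the image of M in C/Q.\<close>

definition scale :: "'a set \<Rightarrow> 'a \<Rightarrow> 'a set \<Rightarrow> 'a set"
  where "scale N a M = {q \<oplus> m \<otimes> a | q m. q \<in> N \<and> m \<in> M}"

lemma scaleI: "q \<in> N \<Longrightarrow> m \<in> M \<Longrightarrow> y = q \<oplus> m \<otimes> a \<Longrightarrow> y \<in> scale N a M"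
  by (auto simp: scale_def)

lemma scaleE:
  assumes "x \<in> scale N a M"
  obtains q m where "x = q \<oplus> m \<otimes> a" "q \<in> N" "m \<in> M"
  using assms by (auto simp: scale_def)

lemma scale_B: "scale N a B = adjoin N a"
  by (simp add: scale_def adjoin_def)

lemma submod_scale:
  assumes N: "submod N" and M: "submod M" and a: "a \<in> carrier C"
  shows "submod (scale N a M)"
  unfolding submod_def
proof (intro conjI ballI)
  show "scale N a M \<subseteq> carrier C"
    using submodD(2)[OF M] submodD(2)[OF N] a by (auto simp: scale_def)
  show "\<zero> \<in> scale N a M"
    using submodD(3)[OF M] submodD(3)[OF N] a by (intro scaleI[of \<zero> _ \<zero>]) auto
  fix u assume "u \<in> scale N a M"
  then obtain q m where u: "u = q \<oplus> m \<otimes> a" "q \<in> N" "m \<in> M" by (rule scaleE)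
  note cu = submodD(2)[OF N u(2)] submodD(2)[OF M u(3)]
  { fix b assume b: "b \<in> B"
    have "b \<otimes> u = (b \<otimes> q) \<oplus> (b \<otimes> m) \<otimes> a"
      unfolding u(1) using cu a B_in[OF b] by algebra
    then show "b \<otimes> u \<in> scale N a M"
      using submodD(5)[OF N b u(2)] submodD(5)[OF M b u(3)] by (rule scaleI[rotated 2]) }
  fix v assume "v \<in> scale N a M"
  then obtain q' m' where v: "v = q' \<oplus> m' \<otimes> a" "q' \<in> N" "m' \<in> M" by (rule scaleE)
  note cv = submodD(2)[OF N v(2)] submodD(2)[OF M v(3)]
  have "u \<oplus> v = (q \<oplus> q') \<oplus> (m \<oplus> m') \<otimes> a"
    unfolding u(1) v(1) using cu cv a by algebra
  then show "u \<oplus> v \<in> scale N a M"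
    using submodD(4)[OF N u(2) v(2)] submodD(4)[OF M u(3) v(3)] by (rule scaleI[rotated 2])
qed

lemma scale_incl: "submod N \<Longrightarrow> submod M \<Longrightarrow> a \<in> carrier C \<Longrightarrow> N \<subseteq> scale N a M"
  by (auto intro!: scaleI[of _ _ \<zero>] simp: submodD)

lemma scale_mono: "M \<subseteq> M' \<Longrightarrow> scale N a M \<subseteq> scale N a M'"
  by (auto simp: scale_def)

lemma scale_least:
  assumes "submod T" "N \<subseteq> T" "\<And>m. m \<in> M \<Longrightarrow> m \<otimes> a \<in> T"
  shows "scale N a M \<subseteq> T"
  using submodD(4)[OF assms(1)] assms(2,3) by (auto simp: scale_def)

text \<open>Multiplication by \<open>a\<close> maps each quotient of the given series onto the
  corresponding quotient of the scaled one, and an image of a simple or zero module is simple or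
  zero.\<close>

lemma series_scale:
  assumes W: "mult_set W" and N: "submod N" and a: "a \<in> carrier C" and "series W n M M'"
  shows "series W n (scale N a M) (scale N a M')"
  using assms(4)
proof (induction rule: series.induct)
  case (series_0 M)
  then show ?case using series.series_0 submod_scale[OF N _ a] by blast
next
  case (series_Suc n M S T)
  have S: "submod S" and T: "submod T" "T \<subseteq> S" using series_Suc(2) by (auto simp: simple_step_def)
  have "simple_step W (scale N a S) (scale N a T)"
    unfolding simple_step_def
  proof (intro conjI ballI impI submod_scale N S T a scale_mono)
    fix u v assume "u \<in> scale N a S" "v \<in> scale N a S" and v': "v \<notin> sat W (scale N a T)"
    then obtain q m q' m' where u: "u = q \<oplus> m \<otimes> a" "q \<in> N" "m \<in> S"
      and v: "v = q' \<oplus> m' \<otimes> a" "q' \<in> N" "m' \<in> S" by (auto elim!: scaleE)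
    note cu = submodD(2)[OF N u(2)] submodD(2)[OF S u(3)] submodD(2)[OF N v(2)] submodD(2)[OF S v(3)]
    have "m' \<notin> sat W T"
    proof
      assume "m' \<in> sat W T"
      then obtain w where w: "w \<in> W" "w \<otimes> m' \<in> T" by (auto simp: sat_def)
      note wB = mult_setD(1)[OF W w(1)]
      have "w \<otimes> v = w \<otimes> q' \<oplus> (w \<otimes> m') \<otimes> a" unfolding v(1) using cu a B_in[OF wB] by algebra
      then have "w \<otimes> v \<in> scale N a T" using submodD(5)[OF N wB v(2)] w by (intro scaleI)
      then show False using v' w v cu a by (auto simp: sat_def)
    qed
    then obtain w r where w: "w \<in> W" "r \<in> B" "w \<otimes> m \<ominus> r \<otimes> m' \<in> T"
      using series_Suc(2) u v unfolding simple_step_def by blast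
    note wB = mult_setD(1)[OF W w(1)]
    have "w \<otimes> u \<ominus> r \<otimes> v = (w \<otimes> q \<ominus> r \<otimes> q') \<oplus> (w \<otimes> m \<ominus> r \<otimes> m') \<otimes> a"
      unfolding u(1) v(1) using cu a B_in[OF wB] B_in[OF w(2)] by algebra
    moreover have "w \<otimes> q \<ominus> r \<otimes> q' \<in> N"
      using submod_minus[OF N] submodD(5)[OF N] wB w u v by blast
    ultimately have "w \<otimes> u \<ominus> r \<otimes> v \<in> scale N a T" using w(3) by (intro scaleI)
    then show "\<exists>w\<in>W. \<exists>r\<in>B. w \<otimes> u \<ominus> r \<otimes> v \<in> scale N a T" using w by blast
  qed
  then show ?case using series.series_Suc[OF series_Suc(3)] by blast
qed

lemma submod_zero: "submod {\<zero>}"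
  by (auto simp: submod_def)

text \<open>Polynomials in \<open>z\<close> of degree less than \<open>n\<close> with coefficients
  in \<open>B\<close>, plus \<open>N\<close>. For \<open>n = 0\<close> only \<open>N\<close>
  remains, so a constant needs \<open>n\<close> positive.\<close>

fun polys_lt :: "'a set \<Rightarrow> 'a \<Rightarrow> nat \<Rightarrow> 'a set" where
  "polys_lt N z 0 = N"
| "polys_lt N z (Suc n) = adjoin (polys_lt N z n) (z [^] n)"

context
  fixes z assumes z: "z \<in> carrier C"
begin

lemma submod_polys_lt: "submod N \<Longrightarrow> submod (polys_lt N z n)"
  by (induction n) (use z in \<open>auto intro: submod_adjoin\<close>)

lemma polys_lt_mono: "submod N \<Longrightarrow> m \<le> n \<Longrightarrow> polys_lt N z m \<subseteq> polys_lt N z n"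
proof (induction n)
  case (Suc n)
  then show ?case
    using adjoin_incl(1)[OF submod_polys_lt, of N "z [^] n" n] z by (cases "m = Suc n") auto
qed simp

lemma polys_lt_base_mono: "N \<subseteq> N' \<Longrightarrow> polys_lt N z n \<subseteq> polys_lt N' z n"
  by (induction n) (auto simp: adjoin_def)

lemma polys_lt_incl: "submod N \<Longrightarrow> N \<subseteq> polys_lt N z n"
  using polys_lt_mono[of N 0 n] by simp

lemma pow_in_polys_lt: "submod N \<Longrightarrow> i < n \<Longrightarrow> z [^] i \<in> polys_lt N z n"
  using polys_lt_mono[of N "Suc i" n] adjoin_incl(2)[OF submod_polys_lt, of N "z [^] i" i] z by auto

lemma polys_lt_least:
  assumes "submod T" "N \<subseteq> T" "\<And>i. i < n \<Longrightarrow> z [^] i \<in> T"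
  shows "polys_lt N z n \<subseteq> T"
  using assms(3)
proof (induction n)
  case (Suc n)
  then show ?case using adjoin_least[OF assms(1)] by simp
qed (use assms in simp)

lemma polys_lt_split:
  assumes N: "submod N" and x: "x \<in> polys_lt N z n"
  obtains q l where "q \<in> N" "l \<in> polys_lt {\<zero>} z n" "x = q \<oplus> l"
proof -
  have "x \<in> polys_lt N z n \<Longrightarrow> \<exists>q\<in>N. \<exists>l\<in>polys_lt {\<zero>} z n. x = q \<oplus> l"
  proof (induction n arbitrary: x)
    case 0
    then show ?case using submodD(2)[OF N] by (auto intro!: bexI[of _ x])
  next
    case (Suc n)
    then obtain m r where m: "x = m \<oplus> r \<otimes> z [^] n" "m \<in> polys_lt N z n" "r \<in> B" by (auto simp: adjoin_def)
    then obtain q l where q: "q \<in> N" "l \<in> polys_lt {\<zero>} z n" "m = q \<oplus> l" using Suc by blast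
    have cl: "q \<in> carrier C" "l \<in> carrier C" "r \<in> carrier C" "z [^] n \<in> carrier C"
      using submodD(2)[OF N q(1)] submodD(2)[OF submod_polys_lt[OF submod_zero] q(2)] m z by auto
    have "x = q \<oplus> (l \<oplus> r \<otimes> z [^] n)" unfolding m(1) q(3) using cl by algebra
    moreover have "l \<oplus> r \<otimes> z [^] n \<in> polys_lt {\<zero>} z (Suc n)" using q m by (auto intro: adjoinI)
    ultimately show ?case using q(1) by blast
  qed
  then show ?thesis using x that by blast
qed

lemma polys_lt_shift:
  assumes "l \<in> polys_lt {\<zero>} z n"
  shows "z [^] k \<otimes> l \<in> polys_lt {\<zero>} z (n + k)"
  using assms
proof (induction n arbitrary: l)
  case 0
  then show ?case using z submodD(3)[OF submod_polys_lt[OF submod_zero]] by auto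
next
  case (Suc n)
  then obtain m r where m: "l = m \<oplus> r \<otimes> z [^] n" "m \<in> polys_lt {\<zero>} z n" "r \<in> B" by (auto simp: adjoin_def)
  have cl: "m \<in> carrier C" "r \<in> carrier C" "z [^] n \<in> carrier C" "z [^] k \<in> carrier C"
    using submodD(2)[OF submod_polys_lt[OF submod_zero] m(2)] m z by auto
  have "z [^] k \<otimes> l = z [^] k \<otimes> m \<oplus> r \<otimes> (z [^] n \<otimes> z [^] k)" unfolding m(1) using cl by algebra
  also have "\<dots> = z [^] k \<otimes> m \<oplus> r \<otimes> z [^] (n + k)" using z by (simp add: nat_pow_mult)
  finally show ?case using Suc(1)[OF m(2)] m(3) by (auto intro: adjoinI)
qed

lemma polys_lt_mult:
  assumes "l \<in> polys_lt {\<zero>} z n" "l' \<in> polys_lt {\<zero>} z m"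
  shows "l \<otimes> l' \<in> polys_lt {\<zero>} z (n + m)"
  using assms(1)
proof (induction n arbitrary: l)
  case 0
  then show ?case using submodD(2,3)[OF submod_polys_lt[OF submod_zero]] assms(2) by auto
next
  case (Suc n)
  then obtain k r where k: "l = k \<oplus> r \<otimes> z [^] n" "k \<in> polys_lt {\<zero>} z n" "r \<in> B" by (auto simp: adjoin_def)
  note S = submod_polys_lt[OF submod_zero]
  have cl: "k \<in> carrier C" "l' \<in> carrier C" "r \<in> carrier C" "z [^] n \<in> carrier C"
    using submodD(2)[OF S k(2)] submodD(2)[OF S assms(2)] k z by auto
  have "l \<otimes> l' = k \<otimes> l' \<oplus> r \<otimes> (z [^] n \<otimes> l')" unfolding k(1) using cl by algebra
  moreover have "k \<otimes> l' \<in> polys_lt {\<zero>} z (Suc n + m)"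
    using Suc(1)[OF k(2)] polys_lt_mono[OF submod_zero, of "n + m" "Suc n + m"] by auto
  moreover have "z [^] n \<otimes> l' \<in> polys_lt {\<zero>} z (Suc n + m)"
    using polys_lt_shift[OF assms(2), of n] polys_lt_mono[OF submod_zero, of "m + n" "Suc n + m"] by auto
  ultimately show ?case using submodD(4,5)[OF S] k(3) by presburger
qed

text \<open>The ring B[z]. The element \<open>z\<close> is arbitrary, so an element may have many
  polynomial representations.\<close>

definition gen :: "'a set" where "gen = (\<Union>n. polys_lt {\<zero>} z n)"

lemma gen_ex2:
  assumes "x \<in> gen" "y \<in> gen"
  obtains n where "x \<in> polys_lt {\<zero>} z n" "y \<in> polys_lt {\<zero>} z n"
proof -
  obtain n m where "x \<in> polys_lt {\<zero>} z n" "y \<in> polys_lt {\<zero>} z m" using assms by (auto simp: gen_def)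
  then have "x \<in> polys_lt {\<zero>} z (max n m)" "y \<in> polys_lt {\<zero>} z (max n m)"
    using polys_lt_mono[OF submod_zero, of n "max n m"] polys_lt_mono[OF submod_zero, of m "max n m"] by auto
  then show ?thesis by (rule that)
qed

lemma B_polys_lt: "b \<in> B \<Longrightarrow> 0 < n \<Longrightarrow> b \<in> polys_lt {\<zero>} z n"
  using submodD(5)[OF submod_polys_lt[OF submod_zero], of b "z [^] (0::nat)" n]
    pow_in_polys_lt[OF submod_zero, of 0 n] by auto

lemma gen_subring: "subring gen C" and B_gen: "B \<subseteq> gen" and z_gen: "z \<in> gen"
proof -
  note S = submod_polys_lt[OF submod_zero]
  have B1: "b \<in> polys_lt {\<zero>} z 1" if "b \<in> B" for b by (rule B_polys_lt[OF that]) simp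
  then show "B \<subseteq> gen" unfolding gen_def by blast
  show "z \<in> gen" using pow_in_polys_lt[OF submod_zero, of 1 2] z unfolding gen_def by auto
  show "subring gen C"
  proof (rule subringI)
    show "gen \<subseteq> carrier C" using submodD(1)[OF S] unfolding gen_def by blast
    show "\<one> \<in> gen" using B1[OF B_one] unfolding gen_def by blast
    show "\<ominus> x \<in> gen" if "x \<in> gen" for x
      using that submod_neg[OF S] unfolding gen_def by blast
    fix x y assume xy: "x \<in> gen" "y \<in> gen"
    obtain n where n: "x \<in> polys_lt {\<zero>} z n" "y \<in> polys_lt {\<zero>} z n" using gen_ex2[OF xy] .
    show "x \<otimes> y \<in> gen" using polys_lt_mult[OF n] unfolding gen_def by blast
    show "x \<oplus> y \<in> gen" using submodD(4)[OF S n] unfolding gen_def by blast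
  qed
qed

text \<open>Each of the \<open>e\<close> powers of \<open>z\<close> contributes a quotient of B/r,
  of length at most \<open>c\<close>, because \<open>r\<close> times that power already lies in
  \<open>N\<close>.\<close>

lemma series_polys_lt:
  assumes W: "mult_set W" and ser: "series W c B r" and N: "submod N" and r: "submod r"
    and "\<And>n x. n < e \<Longrightarrow> x \<in> r \<Longrightarrow> x \<otimes> z [^] n \<in> N"
  shows "series W (c * e) (polys_lt N z e) N"
  using assms(5)
proof (induction e)
  case 0
  then show ?case using series_0 N by simp
next
  case (Suc e)
  let ?M = "polys_lt N z e"
  note M = submod_polys_lt[OF N, of e]
  have zC: "z [^] e \<in> carrier C" using z by simp
  \<comment> \<open>Scaling the series of B/r by the power of \<open>z\<close> runs from the next
    module of polynomials to this one, and its bottom collapses to \<open>?M\<close>.\<close>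
  have "scale ?M (z [^] e) r = ?M"
  proof
    show "?M \<subseteq> scale ?M (z [^] e) r" by (rule scale_incl[OF M r zC])
    show "scale ?M (z [^] e) r \<subseteq> ?M"
      using Suc(2) polys_lt_incl[OF N] by (intro scale_least M) auto
  qed
  then have "series W c (polys_lt N z (Suc e)) ?M"
    using series_scale[OF W M zC ser] by (simp add: scale_B)
  moreover have "series W (c * e) ?M N" using Suc by simp
  ultimately show ?case using series_append by fastforce
qed

end

end

section \<open>Hilbert's basis theorem\<close>

context cring_over
begin

text \<open>The argument by leading coefficients works for any \<open>z\<close>: membership in
  \<open>lead T n\<close> only asks for some representation with leading term of degree
  \<open>n\<close>, so algebraic relations for \<open>z\<close> do no harm.\<close>

theorem hilbert_basis:
  assumes z: "z \<in> carrier C" and noeth: "noetherian_ring (C \<downharpoonright> B)"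
  shows "noetherian_ring (C \<downharpoonright> gen z)"
proof -
  interpret G: cring_over C "gen z"
    by (rule cring_overI[OF gen_subring[OF z]])
  interpret GR: cring "C \<downharpoonright> gen z" by (rule G.cring_B)
  note pm = polys_lt_mono[OF z submod_zero] and S = submod_polys_lt[OF z submod_zero]
  have down: "submod T" if "G.submod T" for T
    using that B_gen[OF z] by (auto simp: submod_def G.submod_def)
  define lead where "lead T n = {c \<in> B. \<exists>l\<in>polys_lt {\<zero>} z n. l \<oplus> c \<otimes> z [^] n \<in> T}" for T and n :: nat
  have zC: "z [^] n \<in> carrier C" for n :: nat using z by simp
  have leadI: "c \<in> B \<Longrightarrow> l \<in> polys_lt {\<zero>} z n \<Longrightarrow> l \<oplus> c \<otimes> z [^] n \<in> T \<Longrightarrow> c \<in> lead T n" for c l n T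
    by (auto simp: lead_def)
  have lead_sub: "submod (lead T n)" if T: "G.submod T" for T n
    unfolding submod_def
  proof (intro conjI ballI)
    note T' = down[OF T]
    show "lead T n \<subseteq> carrier C" by (auto simp: lead_def)
    show "\<zero> \<in> lead T n"
      using submodD(3)[OF T'] submodD(3)[OF S] zC by (auto simp: lead_def intro!: bexI[of _ \<zero>])
    fix c assume "c \<in> lead T n"
    then obtain l where c: "c \<in> B" "l \<in> polys_lt {\<zero>} z n" "l \<oplus> c \<otimes> z [^] n \<in> T" by (auto simp: lead_def)
    note lC = submodD(2)[OF S c(2)]
    { fix b assume b: "b \<in> B"
      have "b \<otimes> l \<oplus> (b \<otimes> c) \<otimes> z [^] n = b \<otimes> (l \<oplus> c \<otimes> z [^] n)"
        using lC B_in[OF b] B_in[OF c(1)] zC[of n] by algebra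
      then show "b \<otimes> c \<in> lead T n"
        using submodD(5)[OF T' b c(3)] by (intro leadI[OF B_mult[OF b c(1)] submodD(5)[OF S b c(2)]]) simp }
    fix d assume "d \<in> lead T n"
    then obtain k where d: "d \<in> B" "k \<in> polys_lt {\<zero>} z n" "k \<oplus> d \<otimes> z [^] n \<in> T" by (auto simp: lead_def)
    note kC = submodD(2)[OF S d(2)]
    have "(l \<oplus> k) \<oplus> (c \<oplus> d) \<otimes> z [^] n = (l \<oplus> c \<otimes> z [^] n) \<oplus> (k \<oplus> d \<otimes> z [^] n)"
      using lC kC B_in[OF c(1)] B_in[OF d(1)] zC[of n] by algebra
    then show "c \<oplus> d \<in> lead T n"
      using submodD(4)[OF T' c(3) d(3)]
      by (intro leadI[OF B_add[OF c(1) d(1)] submodD(4)[OF S c(2) d(2)]]) simp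
  qed
  have lead_B: "lead T n \<subseteq> B" for T n by (auto simp: lead_def)
  have lead_inc: "lead T m \<subseteq> lead T n" if T: "G.submod T" and mn: "m \<le> n" for T m n
  proof
    fix c assume "c \<in> lead T m"
    then obtain l where c: "c \<in> B" "l \<in> polys_lt {\<zero>} z m" "l \<oplus> c \<otimes> z [^] m \<in> T" by (auto simp: lead_def)
    define k where "k = n - m"
    have n: "n = m + k" using mn by (simp add: k_def)
    note lC = submodD(2)[OF S c(2)]
    have zg: "z [^] k \<in> gen z" using G.B_pow[OF z_gen[OF z]] .
    have "z [^] k \<otimes> (l \<oplus> c \<otimes> z [^] m) = z [^] k \<otimes> l \<oplus> c \<otimes> (z [^] m \<otimes> z [^] k)"
      using lC B_in[OF c(1)] zC[of m] zC[of k] by algebra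
    also have "\<dots> = z [^] k \<otimes> l \<oplus> c \<otimes> z [^] n" using z by (simp add: nat_pow_mult n)
    finally have "z [^] k \<otimes> l \<oplus> c \<otimes> z [^] n \<in> T" using G.submodD(5)[OF T zg c(3)] by simp
    then show "c \<in> lead T n" using c(1) polys_lt_shift[OF z c(2), of k] n by (auto simp: lead_def)
  qed
  \<comment> \<open>Nested ideals with the same leading coefficients in every degree agree: subtract
    an element of \<open>J\<close> with the same leading term and continue in lower degree.\<close>
  have compare: "I \<subseteq> J" if I: "G.submod I" "I \<subseteq> gen z" and J: "G.submod J" "J \<subseteq> I"
    and le: "\<And>n. lead I n \<subseteq> lead J n" for I J
  proof -
    have "x \<in> J" if "x \<in> I" "x \<in> polys_lt {\<zero>} z n" for x n
      using that
    proof (induction n arbitrary: x)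
      case 0
      then show ?case using G.submodD(3)[OF J(1)] by simp
    next
      case (Suc n)
      then obtain l c where x: "x = l \<oplus> c \<otimes> z [^] n" "l \<in> polys_lt {\<zero>} z n" "c \<in> B" by (auto simp: adjoin_def)
      then have "c \<in> lead J n" using Suc(2) le by (auto simp: lead_def)
      then obtain k where k: "k \<in> polys_lt {\<zero>} z n" "k \<oplus> c \<otimes> z [^] n \<in> J" by (auto simp: lead_def)
      have cl: "l \<in> carrier C" "k \<in> carrier C" using submodD(2)[OF S] x k by auto
      have "x \<ominus> (k \<oplus> c \<otimes> z [^] n) = l \<ominus> k"
        unfolding x(1) using cl B_in[OF x(3)] zC[of n] by algebra
      moreover have "x \<ominus> (k \<oplus> c \<otimes> z [^] n) \<in> I" using G.submod_minus[OF I(1) Suc(2)] k J(2) by blast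
      moreover have "l \<ominus> k \<in> polys_lt {\<zero>} z n" using submod_minus[OF S x(2) k(1)] .
      ultimately have "l \<ominus> k \<in> J" using Suc(1) by simp
      then have "(l \<ominus> k) \<oplus> (k \<oplus> c \<otimes> z [^] n) \<in> J" using G.submodD(4)[OF J(1)] k by blast
      moreover have "(l \<ominus> k) \<oplus> (k \<oplus> c \<otimes> z [^] n) = x"
        unfolding x(1) using cl B_in[OF x(3)] zC[of n] by algebra
      ultimately show ?case by simp
    qed
    then show ?thesis using I(2) by (auto simp: gen_def[OF z])
  qed
  show ?thesis
  proof (rule GR.noetherian_ringI)
    fix I assume "ideal I (C \<downharpoonright> gen z)"
    then have I: "I \<subseteq> gen z" "G.submod I" using G.ideal_iff by auto
    \<comment> \<open>The ideals of leading coefficients increase with the degree. Beyond the degree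
      \<open>N\<close> at which the maximal one occurs they are constant, so generators for degrees
      up to \<open>N\<close> suffice.\<close>
    obtain M where M: "M \<in> range (lead I)" and max': "\<And>T. T \<in> range (lead I) \<Longrightarrow> M \<subseteq> T \<Longrightarrow> T = M"
    proof (rule maximal_ideal_exists[OF noeth, of "range (lead I)"])
      show "T \<in> range (lead I) \<Longrightarrow> submod T \<and> T \<subseteq> B" for T
        using lead_sub[OF I(2)] lead_B by auto
    qed auto
    have max: "M \<subseteq> lead I n \<Longrightarrow> lead I n = M" for n using max' by simp
    obtain N where N: "M = lead I N" using M by auto
    have "\<exists>F. finite F \<and> F \<subseteq> I \<and> (\<forall>J. G.submod J \<and> F \<subseteq> J \<longrightarrow> lead I n \<subseteq> lead J n)" for n
    proof -
      obtain ws where ws: "set ws \<subseteq> lead I n" "lead I n = lin_span ws"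
        using fin_gen[OF noeth lead_sub[OF I(2)] lead_B] .
      then have "\<forall>w\<in>set ws. \<exists>l\<in>polys_lt {\<zero>} z n. l \<oplus> w \<otimes> z [^] n \<in> I" by (auto simp: lead_def)
      then obtain g where g: "\<And>w. w \<in> set ws \<Longrightarrow> g w \<in> polys_lt {\<zero>} z n \<and> g w \<oplus> w \<otimes> z [^] n \<in> I" by metis
      let ?F = "(\<lambda>w. g w \<oplus> w \<otimes> z [^] n) ` set ws"
      have "lead I n \<subseteq> lead J n" if J: "G.submod J" "?F \<subseteq> J" for J
      proof -
        have "set ws \<subseteq> lead J n" using J(2) g ws(1) lead_B by (auto simp: lead_def)
        then show ?thesis using lin_span_least[OF lead_sub[OF J(1)]] ws(2) by blast
      qed
      then show ?thesis using g by (intro exI[of _ ?F]) auto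
    qed
    then obtain F where F: "\<And>n. finite (F n)" "\<And>n. F n \<subseteq> I"
      "\<And>n J. G.submod J \<Longrightarrow> F n \<subseteq> J \<Longrightarrow> lead I n \<subseteq> lead J n" by metis
    let ?A = "\<Union>n\<le>N. F n"
    let ?J = "Idl\<^bsub>C \<downharpoonright> gen z\<^esub> ?A"
    have A: "?A \<subseteq> I" using F(2) by blast
    then have AG: "?A \<subseteq> carrier (C \<downharpoonright> gen z)" using I by simp
    have JI: "?J \<subseteq> I" by (rule GR.genideal_minimal[OF _ A]) (use I G.ideal_iff in blast)
    have J: "G.submod ?J" using GR.genideal_ideal[OF AG] G.ideal_iff by blast
    have AJ: "?A \<subseteq> ?J" using GR.genideal_self[OF AG] .
    have "lead I n \<subseteq> lead ?J n" for n
    proof (cases "n \<le> N")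
      case True
      then show ?thesis using F(3)[OF J, of n] AJ by blast
    next
      case False
      then have "lead I n = lead I N" using max[of n] lead_inc[OF I(2), of N n] N by simp
      also have "\<dots> \<subseteq> lead ?J N" using F(3)[OF J, of N] AJ by blast
      also have "\<dots> \<subseteq> lead ?J n" using lead_inc[OF J, of N n] False by simp
      finally show ?thesis .
    qed
    then have "I \<subseteq> ?J" using compare[OF I(2,1) J JI] by blast
    then show "\<exists>A\<subseteq>carrier (C \<downharpoonright> gen z). finite A \<and> I = Idl\<^bsub>C \<downharpoonright> gen z\<^esub> A"
      using JI AG F(1) by (intro exI[of _ ?A]) auto
  qed
qed

end

section \<open>Algebraic and transcendental steps\<close>

context cring_over
begin

text \<open>The image of \<open>z\<close> in C/Q is algebraic over the image of \<open>B\<close>.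
  Degree zero cannot occur: there \<open>l\<close> is zero, and the relation would put
  \<open>c\<close> into \<open>Q\<close>.\<close>

definition alg_mod :: "'a set \<Rightarrow> 'a \<Rightarrow> bool"
  where "alg_mod Q z \<longleftrightarrow> (\<exists>n. \<exists>l\<in>polys_lt {\<zero>} z n. \<exists>c\<in>B. c \<notin> Q \<and> l \<oplus> c \<otimes> z [^] n \<in> Q)"

lemma prime_full:
  assumes "primeideal Q C"
  shows "submod Q" "\<one> \<notin> Q" "\<And>a b. a \<in> carrier C \<Longrightarrow> b \<in> Q \<Longrightarrow> a \<otimes> b \<in> Q"
    "\<And>a b. a \<in> carrier C \<Longrightarrow> b \<in> carrier C \<Longrightarrow> a \<otimes> b \<in> Q \<Longrightarrow> a \<in> Q \<or> b \<in> Q"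
    "primeideal (Q \<inter> B) (C \<downharpoonright> B)" "\<And>x. x \<in> Q \<Longrightarrow> x \<in> carrier C"
proof -
  interpret T: cring_over C "carrier C"
    by (rule cring_overI[OF carrier_is_subring])
  have "C \<downharpoonright> carrier C = C" by simp
  then have Q: "Q \<subseteq> carrier C \<and> T.submod Q \<and> \<one> \<notin> Q \<and>
    (\<forall>a\<in>carrier C. \<forall>b\<in>carrier C. a \<otimes> b \<in> Q \<longrightarrow> a \<in> Q \<or> b \<in> Q)"
    using assms T.prime_iff[of Q] by simp
  then show sQ: "submod Q" using B_carrier by (auto simp: submod_def T.submod_def)
  show "\<one> \<notin> Q" "\<And>a b. a \<in> carrier C \<Longrightarrow> b \<in> Q \<Longrightarrow> a \<otimes> b \<in> Q"
    "\<And>a b. a \<in> carrier C \<Longrightarrow> b \<in> carrier C \<Longrightarrow> a \<otimes> b \<in> Q \<Longrightarrow> a \<in> Q \<or> b \<in> Q"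
    "\<And>x. x \<in> Q \<Longrightarrow> x \<in> carrier C"
    using Q T.submodD(5) by auto
  show "primeideal (Q \<inter> B) (C \<downharpoonright> B)"
    using Q sQ submod_B by (auto simp: prime_iff submod_def)
qed

lemma prime_full_pow:
  assumes Q: "primeideal Q C" and "a \<in> carrier C" "a [^] (n::nat) \<in> Q"
  shows "a \<in> Q"
  using assms(3)
proof (induction n)
  case (Suc n)
  then show ?case using prime_full(4)[OF Q, of "a [^] n" a] assms(2) by auto
qed (use prime_full(2)[OF Q] in simp)

context
  fixes z assumes z: "z \<in> carrier C" and full: "gen z = carrier C"
begin

lemma zpow: "z [^] (n::nat) \<in> carrier C"
  using z by simp

text \<open>The relation multiplied by a power of \<open>z\<close>: from degree \<open>e\<close> on,
  the factor \<open>y\<close> lowers the degree of a power modulo \<open>Q\<close>.\<close>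

lemma alg_shift:
  assumes Q: "primeideal Q C" and l: "l \<in> polys_lt {\<zero>} z e" and y: "y \<in> B" and rel: "l \<oplus> y \<otimes> z [^] e \<in> Q"
    and n: "e \<le> n"
  shows "y \<otimes> z [^] n \<in> polys_lt Q z n"
proof -
  note sQ = prime_full(1)[OF Q]
  define k where "k = n - e"
  have nk: "n = e + k" using n by (simp add: k_def)
  note lC = submodD(2)[OF submod_polys_lt[OF z submod_zero] l]
  have "z [^] k \<otimes> (l \<oplus> y \<otimes> z [^] e) = y \<otimes> (z [^] e \<otimes> z [^] k) \<oplus> z [^] k \<otimes> l"
    using lC B_in[OF y] zpow[of e] zpow[of k] by algebra
  also have "\<dots> = y \<otimes> z [^] n \<oplus> z [^] k \<otimes> l" using z by (simp add: nat_pow_mult nk)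
  finally have eq: "y \<otimes> z [^] n \<oplus> z [^] k \<otimes> l = z [^] k \<otimes> (l \<oplus> y \<otimes> z [^] e)" by simp
  have "z [^] k \<otimes> (l \<oplus> y \<otimes> z [^] e) \<in> Q" using prime_full(3)[OF Q zpow rel] .
  then have "y \<otimes> z [^] n \<oplus> z [^] k \<otimes> l \<in> polys_lt Q z n" using eq polys_lt_incl[OF z sQ] by auto
  moreover have "z [^] k \<otimes> l \<in> polys_lt Q z n"
    using polys_lt_shift[OF z l, of k] polys_lt_base_mono[OF z, of "{\<zero>}" Q n] submodD(3)[OF sQ] nk by auto
  ultimately show ?thesis
    using submod_cancel[OF submod_polys_lt[OF z sQ]] B_in[OF y] zpow by blast
qed

text \<open>Over the common contraction the fibre is a quotient of a polynomial ring in one variable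
  over a field. If \<open>z\<close> is transcendental modulo the upper prime, all coefficients of
  its elements are in the contraction, hence in the lower prime. If \<open>z\<close> is algebraic
  modulo the lower prime, that quotient has finite length, so a domain, hence a field, and admits no
  larger prime.\<close>

lemma primes_same_contraction:
  assumes noeth: "noetherian_ring (C \<downharpoonright> B)" and Q: "primeideal Q C" and Q': "primeideal Q' C"
    and sub: "Q \<subset> Q'" and same: "Q \<inter> B = Q' \<inter> B"
  shows "\<not> alg_mod Q z" "alg_mod Q' z"
proof -
  note sQ = prime_full(1)[OF Q] and sQ' = prime_full(1)[OF Q']
  note S = submod_polys_lt[OF z submod_zero]
  show "alg_mod Q' z"
  proof (rule ccontr)
    assume na: "\<not> alg_mod Q' z"
    have "u \<in> Q" if "u \<in> Q'" "u \<in> polys_lt {\<zero>} z n" for u n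
      using that
    proof (induction n arbitrary: u)
      case 0
      then show ?case using submodD(3)[OF sQ] by simp
    next
      case (Suc n)
      then obtain l c where u: "u = l \<oplus> c \<otimes> z [^] n" "l \<in> polys_lt {\<zero>} z n" "c \<in> B" by (auto simp: adjoin_def)
      then have "c \<in> Q'" using na Suc(2) by (auto simp: alg_mod_def)
      then have cQ: "c \<in> Q" using same u(3) by blast
      have "z [^] n \<otimes> c \<in> Q" using prime_full(3)[OF Q zpow cQ] .
      then have cz: "c \<otimes> z [^] n \<in> Q" using m_comm[OF zpow B_in[OF u(3)], of n] by simp
      then have "l \<in> Q'" using submod_cancel[OF sQ'] Suc(2) u sub submodD(2)[OF S u(2)] by blast
      then have "l \<in> Q" using Suc(1) u by blast
      then show ?case using cz u submodD(4)[OF sQ] by blast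
    qed
    moreover have "\<exists>n. u \<in> polys_lt {\<zero>} z n" if "u \<in> Q'" for u
      using prime_full(6)[OF Q' that] full gen_def[OF z] by blast
    ultimately show False using sub by blast
  qed
  show "\<not> alg_mod Q z"
  proof
    assume "alg_mod Q z"
    then obtain e l y where rel: "l \<in> polys_lt {\<zero>} z e" "y \<in> B" "y \<notin> Q" "l \<oplus> y \<otimes> z [^] e \<in> Q"
      by (auto simp: alg_mod_def)
    let ?q = "Q \<inter> B"
    note pq = prime_full(5)[OF Q]
    let ?W = "B - ?q"
    note W = mult_set_prime[OF pq]
    have yW: "y \<in> ?W" using rel by blast
    \<comment> \<open>Here the primary ideal is the prime \<open>?q\<close> itself.\<close>
    obtain c where ser: "series ?W c B ?q"
      using series_primary[OF noeth pq primeD(2,1)[OF pq]] by blast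
    let ?M = "polys_lt Q z e"
    note M = submod_polys_lt[OF z sQ]
    have "series ?W (c * e) ?M Q"
    proof (rule series_polys_lt[OF z W ser sQ primeD(2)[OF pq]])
      fix n :: nat and x assume "x \<in> ?q"
      then show "x \<otimes> z [^] n \<in> Q" using prime_full(3)[OF Q zpow, of x n] m_comm[OF zpow, of x n] by simp
    qed
    then obtain f :: "'a set \<Rightarrow> nat" where f: "\<And>V V'. submod V \<Longrightarrow> submod V' \<Longrightarrow> V \<subset> V' \<Longrightarrow>
      V' \<subseteq> sat ?W ?M \<Longrightarrow> Q \<subseteq> V \<Longrightarrow> sat ?W V \<subseteq> V \<Longrightarrow> f V < f V'"
      using series_length[OF W] by metis
    note sM = submod_sat[OF W M[of e]]
    \<comment> \<open>The leading coefficient \<open>y\<close> belongs to \<open>?W\<close>, so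
      reducing a power of \<open>z\<close> by the relation loses nothing up to saturation.\<close>
    have zs: "z [^] n \<in> sat ?W ?M" for n :: nat
    proof (induction n rule: less_induct)
      case (less n)
      show ?case
      proof (cases "n < e")
        case True
        then show ?thesis using pow_in_polys_lt[OF z sQ True] sat_incl[OF W submodD(1)[OF M]] by blast
      next
        case False
        then have "y \<otimes> z [^] n \<in> polys_lt Q z n" using alg_shift[OF Q rel(1,2,4)] by simp
        also have "polys_lt Q z n \<subseteq> sat ?W ?M"
          using polys_lt_least[OF z sM, of Q n] less polys_lt_incl[OF z sQ] sat_incl[OF W submodD(1)[OF M]] by blast
        finally have "z [^] n \<in> sat ?W (sat ?W ?M)" using yW zpow by (auto simp: sat_def[of _ "sat _ _"])
        then show ?thesis using sat_idem[OF W] by blast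
      qed
    qed
    have all: "carrier C \<subseteq> sat ?W ?M"
    proof -
      have "polys_lt {\<zero>} z n \<subseteq> sat ?W ?M" for n
        using polys_lt_least[OF z sM, of "{\<zero>}" n] zs submodD(3)[OF sM] by blast
      then show ?thesis using full gen_def[OF z] by blast
    qed
    obtain u where u: "u \<in> Q'" "u \<notin> Q" using sub by blast
    have uC: "u \<in> carrier C" using prime_full(6)[OF Q' u(1)] .
    have upC: "u [^] j \<in> carrier C" for j :: nat using uC by simp
    have sC: "submod (carrier C)" by (auto simp: submod_def)
    \<comment> \<open>Powers of the principal ideal generated by \<open>u\<close> modulo
      \<open>Q\<close>. Finite length makes them stabilize, which makes \<open>u\<close> invertible
      modulo \<open>Q\<close> up to \<open>?W\<close>.\<close>
    define V where "V j = sat ?W (scale Q (u [^] (j::nat)) (carrier C))" for j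
    note ss = submod_scale[OF sQ sC upC]
    have sV: "submod (V j)" for j unfolding V_def by (intro submod_sat[OF W] ss)
    have dec: "V (Suc j) \<subseteq> V j" for j
      unfolding V_def
    proof (rule sat_mono, rule scale_least[OF ss])
      show "Q \<subseteq> scale Q (u [^] j) (carrier C)" by (rule scale_incl[OF sQ sC upC])
      fix m assume m: "m \<in> carrier C"
      have "m \<otimes> u [^] Suc j = \<zero> \<oplus> (m \<otimes> u) \<otimes> u [^] j"
        using m uC upC[of j] by (simp add: m_ac)
      then show "m \<otimes> u [^] Suc j \<in> scale Q (u [^] j) (carrier C)"
        using submodD(3)[OF sQ] m uC by (intro scaleI[of \<zero> _ "m \<otimes> u"]) auto
    qed
    have "\<exists>j. V (Suc j) = V j"
    proof (rule ccontr)
      assume "\<not> ?thesis"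
      then have st: "V (Suc j) \<subset> V j" for j using dec by blast
      have "f (V (Suc j)) < f (V j)" for j
      proof (rule f[OF sV sV st])
        show "V j \<subseteq> sat ?W ?M" using submodD(1)[OF sV] all by blast
        show "Q \<subseteq> V (Suc j)"
          using scale_incl[OF sQ sC upC] sat_incl[OF W submodD(1)[OF ss]] unfolding V_def by blast
        show "sat ?W (V (Suc j)) \<subseteq> V (Suc j)" unfolding V_def by (rule sat_idem[OF W])
      qed
      then have "f (V j) + j \<le> f (V 0)" for j
      proof (induction j)
        case (Suc j)
        then show ?case using Suc(2)[of j] Suc(1) by fastforce
      qed simp
      from this[of "Suc (f (V 0))"] show False by simp
    qed
    then obtain j where j: "V (Suc j) = V j" by blast
    have "u [^] j \<in> scale Q (u [^] j) (carrier C)"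
      using submodD(3)[OF sQ] upC by (intro scaleI[of \<zero> _ \<one>]) auto
    then have "u [^] j \<in> V (Suc j)" unfolding j unfolding V_def using sat_incl[OF W submodD(1)[OF ss]] by blast
    then obtain s where s: "s \<in> ?W" "s \<otimes> u [^] j \<in> scale Q (u [^] Suc j) (carrier C)"
      by (auto simp: V_def sat_def)
    then obtain q v where q: "s \<otimes> u [^] j = q \<oplus> v \<otimes> u [^] Suc j" "q \<in> Q" "v \<in> carrier C"
      by (auto elim: scaleE)
    have cl: "s \<in> carrier C" "q \<in> carrier C" using s q prime_full(6)[OF Q] by auto
    \<comment> \<open>Cancelling u^j modulo \<open>Q\<close> shows that \<open>s\<close> is
      congruent to \<open>v u\<close>, so \<open>s\<close> lies in \<open>Q'\<close> although it is
      outside the contraction.\<close>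
    have "(s \<ominus> v \<otimes> u) \<otimes> u [^] j = s \<otimes> u [^] j \<ominus> v \<otimes> (u [^] j \<otimes> u)"
      using cl q(3) uC upC[of j] by algebra
    also have "\<dots> = q \<oplus> v \<otimes> (u [^] j \<otimes> u) \<ominus> v \<otimes> (u [^] j \<otimes> u)" using q(1) by simp
    also have "\<dots> = q" using cl q(3) uC upC[of j] by algebra
    finally have "(s \<ominus> v \<otimes> u) \<otimes> u [^] j \<in> Q" using q by simp
    then have "s \<ominus> v \<otimes> u \<in> Q"
      using prime_full(4)[OF Q, of "s \<ominus> v \<otimes> u" "u [^] j"] prime_full_pow[OF Q uC] u cl q uC upC by auto
    then have "(s \<ominus> v \<otimes> u) \<oplus> v \<otimes> u \<in> Q'"
      using sub submodD(4)[OF sQ'] prime_full(3)[OF Q' q(3) u(1)] by blast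
    moreover have "(s \<ominus> v \<otimes> u) \<oplus> v \<otimes> u = s" using cl q(3) uC by algebra
    ultimately have "s \<in> Q' \<inter> B" using s by simp
    then show False using same s by blast
  qed
qed

text \<open>The analogue of the Krull--Akizuki theorem: with \<open>S\<^sub>k\<close> the saturation of the polynomials of
  degree less than \<open>k\<close>, every quotient \<open>S\<^sub>k / y S\<^sub>k\<close> would have length at least \<open>k\<close>, whereas
  comparing \<open>y\<^sup>P S\<^sub>k\<close> with \<open>y\<^sup>P S\<^sub>e\<close> for large \<open>P\<close> bounds that length independently of \<open>k\<close>.\<close>

lemma exists_prime_between:
  assumes noeth: "noetherian_ring (C \<downharpoonright> B)" and Q: "primeideal Q C" and Q': "primeideal Q' C"
    and sub: "Q \<subseteq> Q'" and strict: "Q \<inter> B \<subset> Q' \<inter> B" and alg: "alg_mod Q z" and trans: "\<not> alg_mod Q' z"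
  obtains p where "primeideal p (C \<downharpoonright> B)" "Q \<inter> B \<subset> p" "p \<subset> Q' \<inter> B"
proof (rule ccontr)
  assume "\<not> thesis"
  then have between: "p = Q' \<inter> B" if "primeideal p (C \<downharpoonright> B)" "Q \<inter> B \<subset> p" "p \<subseteq> Q' \<inter> B" for p
    using \<open>\<not> thesis\<close> that(1,2,3) \<open>\<And>p. primeideal p (C \<downharpoonright> B) \<Longrightarrow> Q \<inter> B \<subset> p \<Longrightarrow> p \<subset> Q' \<inter> B \<Longrightarrow> thesis\<close> by blast
  note sQ = prime_full(1)[OF Q] and sQ' = prime_full(1)[OF Q']
  note S = submod_polys_lt[OF z submod_zero] and SQ = submod_polys_lt[OF z sQ] and SQ' = submod_polys_lt[OF z sQ']
  let ?q = "Q \<inter> B" and ?q' = "Q' \<inter> B"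
  note pq = prime_full(5)[OF Q] and pq' = prime_full(5)[OF Q']
  let ?W = "B - ?q'"
  note W = mult_set_prime[OF pq']
  note sincl = sat_incl[OF W submodD(1)]
  obtain e l y where rel: "l \<in> polys_lt {\<zero>} z e" "y \<in> B" "y \<notin> Q" "l \<oplus> y \<otimes> z [^] e \<in> Q"
    using alg by (auto simp: alg_mod_def)
  \<comment> \<open>The relation also lies in \<open>Q'\<close>, so a leading coefficient outside
    \<open>Q'\<close> would make \<open>z\<close> algebraic there.\<close>
  have yQ': "y \<in> Q'" using trans rel sub by (auto simp: alg_mod_def)
  have yC: "y \<in> carrier C" using rel by simp
  have ypB: "y [^] j \<in> B" and ypC: "y [^] j \<in> carrier C" for j :: nat using B_pow[OF rel(2)] by auto
  let ?a = "adjoin ?q y"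
  have sa: "submod ?a" "?a \<subseteq> B" "?q \<subseteq> ?a" "y \<in> ?a"
    using submod_adjoin[OF primeD(2)[OF pq] yC] adjoin_B[OF primeD(1)[OF pq] rel(2)]
      adjoin_incl[OF primeD(2)[OF pq] yC] by auto
  obtain c where ser: "series ?W c B ?a"
    \<comment> \<open>This is where the absence of an intermediate prime is used: \<open>y\<close>
      is outside \<open>?q\<close>, so a prime over ?q + yB inside \<open>?q'\<close> can only be
      \<open>?q'\<close>.\<close>
    using series_primary[OF noeth pq' sa(1,2)] between sa(3,4) rel by blast
  let ?M = "polys_lt Q z e"
  let ?d = "c * e"
  have base: "series ?W ?d ?M (scale Q y ?M)"
  proof -
    let ?N = "scale Q y ?M"
    have sN: "submod ?N" by (rule submod_scale[OF sQ SQ yC])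
    have QN: "Q \<subseteq> ?N" by (rule scale_incl[OF sQ SQ yC])
    have "series ?W (c * e) (polys_lt ?N z e) ?N"
    proof (rule series_polys_lt[OF z W ser sN sa(1)])
      fix n :: nat and x assume n: "n < e" and "x \<in> ?a"
      then obtain t b where x: "x = t \<oplus> b \<otimes> y" "t \<in> ?q" "b \<in> B" by (auto simp: adjoin_def)
      have cl: "t \<in> carrier C" "b \<in> carrier C" using x by auto
      have eq: "x \<otimes> z [^] n = z [^] n \<otimes> t \<oplus> (b \<otimes> z [^] n) \<otimes> y"
        unfolding x(1) using cl yC zpow[of n] by algebra
      have "z [^] n \<otimes> t \<in> Q" using prime_full(3)[OF Q zpow] x by blast
      moreover have "b \<otimes> z [^] n \<in> ?M" using submodD(5)[OF SQ x(3) pow_in_polys_lt[OF z sQ n]] .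
      ultimately show "x \<otimes> z [^] n \<in> ?N" unfolding eq by (auto intro: scaleI)
    qed
    moreover have "polys_lt ?N z e = ?M"
    proof
      show "?M \<subseteq> polys_lt ?N z e" using polys_lt_base_mono[OF z QN] .
      have "?N \<subseteq> ?M"
      proof (rule scale_least[OF SQ polys_lt_incl[OF z sQ]])
        fix m assume m: "m \<in> ?M"
        have "m \<otimes> y = y \<otimes> m" using submodD(2)[OF SQ m] yC by (rule m_comm)
        then show "m \<otimes> y \<in> ?M" using submodD(5)[OF SQ rel(2) m] by simp
      qed
      then show "polys_lt ?N z e \<subseteq> ?M" using polys_lt_least[OF z SQ] pow_in_polys_lt[OF z sQ] by blast
    qed
    ultimately show ?thesis by simp
  qed
  \<comment> \<open>The estimate for M/yM is multiplied by successive powers of \<open>y\<close>;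
    the length of M modulo y^r M grows by at most \<open>?d\<close> for each factor.\<close>
  have long: "series ?W (?d * r) ?M (scale Q (y [^] r) ?M)" for r :: nat
  proof (induction r)
    case 0
    have "scale Q (y [^] (0::nat)) ?M = ?M"
    proof
      show "scale Q (y [^] (0::nat)) ?M \<subseteq> ?M"
        using submodD(2)[OF SQ] by (intro scale_least[OF SQ polys_lt_incl[OF z sQ]]) simp
      show "?M \<subseteq> scale Q (y [^] (0::nat)) ?M"
        using submodD(2)[OF SQ] submodD(3)[OF sQ] by (auto intro!: scaleI[of \<zero>])
    qed
    then show ?case using series_0[OF SQ] by simp
  next
    case (Suc r)
    have "scale Q (y [^] r) (scale Q y ?M) = scale Q (y [^] Suc r) ?M" (is "?L = ?R")
    proof
      have sR: "submod ?R" and sN: "submod (scale Q y ?M)" by (intro submod_scale sQ SQ ypC yC)+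
      have sL: "submod ?L" by (intro submod_scale sQ sN ypC)
      show "?L \<subseteq> ?R"
      proof (rule scale_least[OF sR scale_incl[OF sQ SQ ypC]])
        fix m assume "m \<in> scale Q y ?M"
        then obtain q k where m: "m = q \<oplus> k \<otimes> y" "q \<in> Q" "k \<in> ?M" by (rule scaleE)
        have cl: "q \<in> carrier C" "k \<in> carrier C" using m prime_full(6)[OF Q] submodD(2)[OF SQ] by auto
        have "m \<otimes> y [^] r = y [^] r \<otimes> q \<oplus> k \<otimes> (y [^] r \<otimes> y)"
          unfolding m(1) using cl yC ypC[of r] by algebra
        then show "m \<otimes> y [^] r \<in> ?R" using prime_full(3)[OF Q ypC m(2)] m(3) by (intro scaleI) auto
      qed
      show "?R \<subseteq> ?L"
      proof (rule scale_least[OF sL scale_incl[OF sQ sN ypC]])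
        fix m assume m: "m \<in> ?M"
        have "m \<otimes> y \<in> scale Q y ?M"
          using m submodD(3)[OF sQ] submodD(2)[OF SQ m] yC by (intro scaleI[of \<zero>]) auto
        moreover have "m \<otimes> y [^] Suc r = \<zero> \<oplus> (m \<otimes> y) \<otimes> y [^] r"
          using submodD(2)[OF SQ m] yC ypC[of r] by (simp add: m_ac)
        ultimately show "m \<otimes> y [^] Suc r \<in> ?L" by (rule scaleI[OF submodD(3)[OF sQ]])
      qed
    qed
    then show ?case
      using series_append[OF series_scale[OF W sQ ypC base, of r] Suc] by (simp add: add.commute)
  qed
  \<comment> \<open>The part \<open>?d + 1\<close> makes the gain \<open>k\<close> per factor
    \<open>y\<close> exceed the cost \<open>?d\<close>; the summand \<open>e\<close> ensures that
    \<open>?M\<close> lies in \<open>V 0\<close>. The choice of \<open>P\<close> lets the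
    accumulated surplus exceed \<open>?d * k\<close>, the cost of the first \<open>k\<close>
    factors, after which y^k brings \<open>V 0\<close> into the saturation of
    \<open>?M\<close>.\<close>
  define k where "k = ?d + 1 + e"
  define P where "P = ?d * k + 1"
  define r where "r = k + P"
  obtain f :: "'a set \<Rightarrow> nat" where fb: "\<And>V. f V \<le> ?d * r" and fm: "\<And>V V'. V \<subseteq> V' \<Longrightarrow> f V \<le> f V'"
    and f: "\<And>V V'. submod V \<Longrightarrow> submod V' \<Longrightarrow> V \<subset> V' \<Longrightarrow> V' \<subseteq> sat ?W ?M \<Longrightarrow>
      scale Q (y [^] r) ?M \<subseteq> V \<Longrightarrow> sat ?W V \<subseteq> V \<Longrightarrow> f V < f V'"
    using series_length[OF W long[of r]] by metis
  \<comment> \<open>\<open>V 0\<close> is the saturation of the polynomials of degree below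
    \<open>k\<close>. The members filter it by the degree of the residue modulo \<open>Q'\<close>,
    and \<open>V k\<close> consists of the elements that vanish modulo \<open>Q'\<close> up to
    \<open>?W\<close>.\<close>
  define V where "V i = sat ?W (polys_lt Q z k) \<inter> sat ?W (polys_lt Q' z (k - i))" for i
  have sV: "submod (V i)" for i
    using submod_sat[OF W SQ[of k]] submod_sat[OF W SQ'[of "k - i"]] by (auto simp: V_def submod_def)
  have V0: "V 0 = sat ?W (polys_lt Q z k)"
    using sat_mono[OF polys_lt_base_mono[OF z sub]] by (auto simp: V_def)
  have decV: "V (Suc i) \<subseteq> V i" for i
  proof -
    have "k - Suc i \<le> k - i" by simp
    then show ?thesis using sat_mono[OF polys_lt_mono[OF z sQ']] unfolding V_def by blast
  qed
  define Y where "Y p i = sat ?W (scale Q (y [^] (p::nat)) (V i))" for p i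
  note ss = submod_scale[OF sQ sV ypC]
  have sY: "submod (Y p i)" for p i unfolding Y_def by (intro submod_sat[OF W] ss)
  have satY: "sat ?W (Y p i) \<subseteq> Y p i" for p i unfolding Y_def by (rule sat_idem[OF W])
  have decY: "Y p (Suc i) \<subseteq> Y p i" for p i unfolding Y_def by (intro sat_mono scale_mono decV)
  have decY0: "i \<le> j \<Longrightarrow> Y p j \<subseteq> Y p i" for p i j
    by (induction j) (use decY in \<open>auto simp: le_Suc_eq\<close>)
  \<comment> \<open>As \<open>y\<close> is in \<open>Q'\<close>, multiplying \<open>V 0\<close> by
    \<open>y\<close> lands in the last member \<open>V k\<close>. Thus the filtration for exponent p
    continues with the one for p + 1.\<close>
  have wrap: "Y (Suc p) 0 \<subseteq> Y p k" for p
    unfolding Y_def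
  proof (rule sat_mono, rule scale_least[OF ss scale_incl[OF sQ sV ypC]])
    fix v assume v: "v \<in> V 0"
    have vC: "v \<in> carrier C" using submodD(2)[OF sV v] .
    have "y \<otimes> v \<in> V 0" using submodD(5)[OF sV rel(2) v] .
    moreover have "y \<otimes> v \<in> Q'" using prime_full(3)[OF Q' vC yQ'] m_comm[OF vC yC] by simp
    then have "y \<otimes> v \<in> sat ?W (polys_lt Q' z (k - k))" using sincl[OF sQ'] by auto
    ultimately have "y \<otimes> v \<in> V k" using V0 by (auto simp: V_def)
    moreover have "v \<otimes> y [^] Suc p = \<zero> \<oplus> (y \<otimes> v) \<otimes> y [^] p"
      using vC yC ypC[of p] by (simp add: m_ac)
    ultimately show "v \<otimes> y [^] Suc p \<in> scale Q (y [^] p) (V k)"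
      using submodD(3)[OF sQ] by (intro scaleI[of \<zero>])
  qed
  have strictY: "Y p (Suc i) \<subset> Y p i" if i: "i < k" for p i
  proof -
    define n where "n = k - Suc i"
    have n: "k - i = Suc n" "n < k" using i by (auto simp: n_def)
    \<comment> \<open>With \<open>n = k - Suc i\<close>, this power has residue degree exactly
      \<open>n\<close>: allowed in \<open>V i\<close>, excluded from \<open>V (Suc i)\<close>
      because \<open>z\<close> is transcendental modulo \<open>Q'\<close>.\<close>
    have "z [^] n \<in> V i"
      using pow_in_polys_lt[OF z sQ n(2)] pow_in_polys_lt[OF z sQ', of n "Suc n"] sincl[OF SQ] sincl[OF SQ'] n
      unfolding V_def by fastforce
    then have "z [^] n \<otimes> y [^] p \<in> scale Q (y [^] p) (V i)"
      using submodD(3)[OF sQ] zpow ypC by (intro scaleI[of \<zero>]) auto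
    then have "z [^] n \<otimes> y [^] p \<in> Y p i" unfolding Y_def using sincl[OF ss] by blast
    moreover have "z [^] n \<otimes> y [^] p \<notin> Y p (Suc i)"
    proof
      assume "z [^] n \<otimes> y [^] p \<in> Y p (Suc i)"
      then obtain w where w: "w \<in> ?W" "w \<otimes> (z [^] n \<otimes> y [^] p) \<in> scale Q (y [^] p) (V (Suc i))"
        by (auto simp: Y_def sat_def)
      then obtain q v where q: "w \<otimes> (z [^] n \<otimes> y [^] p) = q \<oplus> v \<otimes> y [^] p" "q \<in> Q" "v \<in> V (Suc i)"
        by (auto elim: scaleE)
      have cl: "w \<in> carrier C" "q \<in> carrier C" "v \<in> carrier C"
        using w q prime_full(6)[OF Q] submodD(2)[OF sV] by auto
      have "(w \<otimes> z [^] n \<ominus> v) \<otimes> y [^] p = w \<otimes> (z [^] n \<otimes> y [^] p) \<ominus> v \<otimes> y [^] p"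
        using cl zpow[of n] ypC[of p] by algebra
      also have "\<dots> = q \<oplus> v \<otimes> y [^] p \<ominus> v \<otimes> y [^] p" using q(1) by simp
      also have "\<dots> = q" using cl ypC[of p] by algebra
      finally have "(w \<otimes> z [^] n \<ominus> v) \<otimes> y [^] p \<in> Q" using q by simp
      \<comment> \<open>The factor y^p cancels modulo \<open>Q\<close> since \<open>y\<close> is
        outside \<open>Q\<close>; the question returns to \<open>V (Suc i)\<close> itself.\<close>
      then have "w \<otimes> z [^] n \<ominus> v \<in> Q"
        using prime_full(4)[OF Q, of "w \<otimes> z [^] n \<ominus> v" "y [^] p"] prime_full_pow[OF Q yC] rel cl zpow ypC
        by auto
      then have d: "w \<otimes> z [^] n \<ominus> v \<in> polys_lt Q' z n" using sub polys_lt_incl[OF z sQ'] by blast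
      obtain w' where w': "w' \<in> ?W" "w' \<otimes> v \<in> polys_lt Q' z n"
        using q(3) by (auto simp: V_def sat_def n_def)
      have w'B: "w' \<in> B" using w' by blast
      have "(w' \<otimes> w) \<otimes> z [^] n = w' \<otimes> (w \<otimes> z [^] n \<ominus> v) \<oplus> w' \<otimes> v"
        using cl B_in[OF w'B] zpow[of n] by algebra
      also have "\<dots> \<in> polys_lt Q' z n" using submodD(4,5)[OF SQ'] d w' w'B by blast
      finally have "(w' \<otimes> w) \<otimes> z [^] n \<in> polys_lt Q' z n" .
      then obtain q' m where q': "q' \<in> Q'" "m \<in> polys_lt {\<zero>} z n" "(w' \<otimes> w) \<otimes> z [^] n = q' \<oplus> m"
        using polys_lt_split[OF z sQ'] by blast
      have ww: "w' \<otimes> w \<in> ?W" using mult_setD(3)[OF W w'(1) w(1)] .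
      have cl': "q' \<in> carrier C" "m \<in> carrier C"
        using prime_full(6)[OF Q' q'(1)] submodD(2)[OF S q'(2)] by auto
      have "\<ominus> m \<oplus> (w' \<otimes> w) \<otimes> z [^] n = q'" unfolding q'(3) using cl' by algebra
      then have "\<ominus> m \<oplus> (w' \<otimes> w) \<otimes> z [^] n \<in> Q'" using q' by simp
      moreover have "\<ominus> m \<in> polys_lt {\<zero>} z n" using submod_neg[OF S q'(2)] .
      ultimately show False using trans ww unfolding alg_mod_def by blast
    qed
    ultimately show ?thesis using decY by blast
  qed
  \<comment> \<open>Each factor \<open>y\<close> lowers the degree bound by one until it reaches
    \<open>e\<close>, so \<open>n\<close> factors are enough.\<close>
  have low: "x \<otimes> y [^] n \<in> ?M" if "x \<in> polys_lt Q z n" for x n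
    using that
  proof (induction n arbitrary: x)
    case 0
    then show ?case using prime_full(6)[OF Q] polys_lt_incl[OF z sQ] by auto
  next
    case (Suc n)
    then obtain m b where x: "x = m \<oplus> b \<otimes> z [^] n" "m \<in> polys_lt Q z n" "b \<in> B" by (auto simp: adjoin_def)
    have mC: "m \<in> carrier C" using submodD(2)[OF SQ x(2)] .
    have "(y \<otimes> z [^] n) \<otimes> y [^] n \<in> ?M"
    proof (cases "e \<le> n")
      case True
      then show ?thesis using Suc(1)[OF alg_shift[OF Q rel(1,2,4)]] by blast
    next
      case False
      have "(y \<otimes> z [^] n) \<otimes> y [^] n = (y \<otimes> y [^] n) \<otimes> z [^] n"
        using yC ypC[of n] zpow[of n] by algebra
      then show ?thesis using submodD(5)[OF SQ B_mult[OF rel(2) ypB] pow_in_polys_lt[OF z sQ, of n e]] False by simp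
    qed
    then have "b \<otimes> ((y \<otimes> z [^] n) \<otimes> y [^] n) \<in> ?M" by (rule submodD(5)[OF SQ x(3)])
    moreover have "y \<otimes> (m \<otimes> y [^] n) \<in> ?M" using submodD(5)[OF SQ rel(2) Suc(1)[OF x(2)]] .
    moreover have "x \<otimes> y [^] Suc n = y \<otimes> (m \<otimes> y [^] n) \<oplus> b \<otimes> ((y \<otimes> z [^] n) \<otimes> y [^] n)"
      unfolding x(1) nat_pow_Suc using mC B_in[OF x(3)] yC ypC[of n] zpow[of n] by algebra
    ultimately show ?case using submodD(4)[OF SQ] by simp
  qed
  have top: "Y p i \<subseteq> sat ?W ?M" if p: "k \<le> p" for p i
  proof -
    have sM: "submod (sat ?W ?M)" by (rule submod_sat[OF W SQ])
    have "scale Q (y [^] p) (V 0) \<subseteq> sat ?W ?M"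
    proof (rule scale_least[OF sM])
      show "Q \<subseteq> sat ?W ?M" using polys_lt_incl[OF z sQ] sincl[OF SQ] by blast
      fix v assume v: "v \<in> V 0"
      then obtain w where w: "w \<in> ?W" "w \<otimes> v \<in> polys_lt Q z k" "v \<in> carrier C" unfolding V0 by (auto simp: sat_def)
      have wC: "w \<in> carrier C" using w by auto
      have "(w \<otimes> v) \<otimes> y [^] k \<in> ?M" using low[OF w(2)] .
      then have "y [^] (p - k) \<otimes> ((w \<otimes> v) \<otimes> y [^] k) \<in> ?M" by (rule submodD(5)[OF SQ ypB])
      also have "y [^] (p - k) \<otimes> ((w \<otimes> v) \<otimes> y [^] k) = w \<otimes> (v \<otimes> (y [^] k \<otimes> y [^] (p - k)))"
        using wC w(3) ypC[of k] ypC[of "p - k"] by algebra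
      also have "\<dots> = w \<otimes> (v \<otimes> y [^] p)" using yC p by (simp add: nat_pow_mult)
      finally show "v \<otimes> y [^] p \<in> sat ?W ?M" using w ypC by (auto simp: sat_def)
    qed
    then have "Y p 0 \<subseteq> sat ?W (sat ?W ?M)" unfolding Y_def by (rule sat_mono)
    then show ?thesis using sat_idem[OF W] decY0[of 0 i p] by blast
  qed
  have bottom0: "scale Q (y [^] r) ?M \<subseteq> Y r 0"
  proof -
    have "?M \<subseteq> V 0" using polys_lt_mono[OF z sQ, of e k] sincl[OF SQ, of k] unfolding V0 k_def by auto
    then have "scale Q (y [^] r) ?M \<subseteq> scale Q (y [^] r) (V 0)" by (rule scale_mono)
    then show ?thesis unfolding Y_def using sincl[OF ss] by blast
  qed
  have step: "Y (Suc p) 0 \<subseteq> Y p i" if "i \<le> k" for p i using wrap decY0[OF that] by blast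
  have "Y (p + j) 0 \<subseteq> Y p 0" for p j
    by (induction j) (use step[of 0] in auto)
  from this[of _ "r - _"] have decp: "Y r 0 \<subseteq> Y p 0" if "p \<le> r" for p
    using that by (metis le_add_diff_inverse)
  have fstep: "f (Y (Suc p) 0) + k \<le> f (Y p 0)" if p: "k \<le> p" "p < r" for p
  proof -
    have "f (Y p (Suc i)) < f (Y p i)" if i: "i < k" for i
    proof (rule f[OF sY sY strictY[OF i] top[OF p(1)] _ satY])
      have "Y r 0 \<subseteq> Y (Suc p) 0" using decp p by simp
      then show "scale Q (y [^] r) ?M \<subseteq> Y p (Suc i)" using bottom0 step[of "Suc i" p] i by auto
    qed
    then have "f (Y p i) + i \<le> f (Y p 0)" if "i \<le> k" for i
      using that
    proof (induction i)
      case (Suc i)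
      then show ?case using Suc(2)[of i] by fastforce
    qed simp
    from this[of k] show ?thesis using fm[OF wrap[of p]] by simp
  qed
  \<comment> \<open>\<open>P\<close> factors, each with \<open>k\<close> strict steps, all inside
    the range covered by the series of length \<open>?d * r\<close>.\<close>
  have "f (Y (k + j) 0) + k * j \<le> f (Y k 0)" if "j \<le> P" for j
    using that
  proof (induction j)
    case (Suc j)
    then show ?case using fstep[of "k + j"] by (simp add: r_def)
  qed simp
  from this[of P] have "k * P \<le> ?d * r" using fb[of "Y k 0"] by simp
  moreover have "k * P = ?d * P + P + e * P" by (simp add: k_def algebra_simps)
  moreover have "?d * r = ?d * k + ?d * P" by (simp add: r_def algebra_simps)
  ultimately have "P \<le> ?d * k" by simp
  then show False by (simp add: P_def)
qed

end

end

section \<open>The dimension inequality\<close>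

definition chain_between :: "('a, 'b) ring_scheme \<Rightarrow> nat \<Rightarrow> 'a set \<Rightarrow> 'a set \<Rightarrow> bool"
  where "chain_between A n p q \<longleftrightarrow> (\<exists>P. prime_chain A n P \<and> P 0 = p \<and> P n = q)"

lemma chain_between_0: "primeideal p A \<Longrightarrow> chain_between A 0 p p"
  unfolding chain_between_def by (rule exI[of _ "\<lambda>_. p"]) (simp add: prime_chain_def)

lemma chain_between_Suc:
  assumes "chain_between A n p q" "primeideal r A" "q \<subset> r"
  shows "chain_between A (Suc n) p r"
proof -
  obtain P where P: "prime_chain A n P" "P 0 = p" "P n = q"
    using assms(1) by (auto simp: chain_between_def)
  have "prime_chain A (Suc n) (P(Suc n := r))"
    using P assms(2,3) by (auto simp: prime_chain_def le_Suc_eq less_Suc_eq)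
  then show ?thesis
    unfolding chain_between_def using P by (intro exI[of _ "P(Suc n := r)"]) simp
qed

lemma chain_between_Cons:
  assumes "chain_between A n q r" "primeideal p A" "p \<subset> q"
  shows "chain_between A (Suc n) p r"
proof -
  obtain P where P: "prime_chain A n P" "P 0 = q" "P n = r"
    using assms(1) by (auto simp: chain_between_def)
  have "prime_chain A (Suc n) (case_nat p P)"
    using P assms(2,3) by (auto simp: prime_chain_def split: nat.splits)
  then show ?thesis
    unfolding chain_between_def using P by (intro exI[of _ "case_nat p P"]) simp
qed

context cring_over
begin

text \<open>The terms 0 and 1 are the transcendence degrees of \<open>z\<close> modulo the two ends.
  Induction along the chain balances each step: equal contractions lower the degree by one, and a
  rise of the degree is paid for by an intermediate prime.\<close>

theorem dimension_inequality:
  assumes z: "z \<in> carrier C" and full: "gen z = carrier C" and noeth: "noetherian_ring (C \<downharpoonright> B)"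
    and chain: "prime_chain C n P"
  shows "\<exists>l. chain_between (C \<downharpoonright> B) l (P 0 \<inter> B) (P n \<inter> B) \<and>
    n + (if alg_mod (P n) z then 0 else 1) \<le> l + (if alg_mod (P 0) z then 0 else 1)"
  using chain
proof (induction n)
  case 0
  then have "primeideal (P 0) C" by (simp add: prime_chain_def)
  then have "chain_between (C \<downharpoonright> B) 0 (P 0 \<inter> B) (P 0 \<inter> B)"
    using chain_between_0 prime_full(5) by blast
  then show ?case by (intro exI[of _ 0]) simp
next
  case (Suc n)
  have "prime_chain C n P" using Suc(2) by (simp add: prime_chain_def)
  then obtain l where l: "chain_between (C \<downharpoonright> B) l (P 0 \<inter> B) (P n \<inter> B)"
    "n + (if alg_mod (P n) z then 0 else 1) \<le> l + (if alg_mod (P 0) z then 0 else 1)"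
    using Suc(1) by blast
  let ?Q = "P n" and ?Q' = "P (Suc n)"
  have Q: "primeideal ?Q C" "primeideal ?Q' C" "?Q \<subset> ?Q'" using Suc(2) by (auto simp: prime_chain_def)
  show ?case
  proof (cases "?Q \<inter> B = ?Q' \<inter> B")
    case True
    then have "\<not> alg_mod ?Q z" "alg_mod ?Q' z"
      using primes_same_contraction[OF z full noeth Q True] by auto
    then show ?thesis using l True by (intro exI[of _ l]) auto
  next
    case False
    then have st: "?Q \<inter> B \<subset> ?Q' \<inter> B" using Q(3) by blast
    note p' = prime_full(5)[OF Q(2)]
    show ?thesis
    proof (cases "alg_mod ?Q z \<and> \<not> alg_mod ?Q' z")
      case True
      then obtain p where p: "primeideal p (C \<downharpoonright> B)" "?Q \<inter> B \<subset> p" "p \<subset> ?Q' \<inter> B"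
        using exists_prime_between[OF z full noeth Q(1,2) _ st] Q(3) by blast
      have "chain_between (C \<downharpoonright> B) (Suc (Suc l)) (P 0 \<inter> B) (?Q' \<inter> B)"
        by (intro chain_between_Suc[OF _ p' p(3)] chain_between_Suc[OF l(1) p(1,2)])
      then show ?thesis using l(2) True by (intro exI[of _ "Suc (Suc l)"]) simp
    next
      case False
      \<comment> \<open>The degree does not rise at this step, so a single step below is
        enough.\<close>
      have "chain_between (C \<downharpoonright> B) (Suc l) (P 0 \<inter> B) (?Q' \<inter> B)"
        by (rule chain_between_Suc[OF l(1) p' st])
      then show ?thesis using l(2) False by (intro exI[of _ "Suc l"]) auto
    qed
  qed
qed

lemma nat_pow_sub: "x [^]\<^bsub>C \<downharpoonright> D\<^esub> (n::nat) = x [^] n"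
  by (simp add: nat_pow_def)

text \<open>Replacing the ambient ring by an intermediate ring changes neither the operations nor
  zero, so these notions stay the same. This allows the inequality for C = B[z] to be used inside a
  larger ring.\<close>

lemma
  assumes D: "subring D C" "B \<subseteq> D"
  shows cring_over_sub: "cring_over (C \<downharpoonright> D) B"
    and alg_mod_sub: "cring_over.alg_mod (C \<downharpoonright> D) B Q z = alg_mod Q z"
    and gen_sub: "z \<in> D \<Longrightarrow> cring_over.gen (C \<downharpoonright> D) B z = gen z"
proof -
  interpret D: cring_over C D by (rule cring_overI[OF D(1)])
  have "subring B (C \<downharpoonright> D)"
    using subring_iff[OF B_carrier] ring.subring_iff[OF D.cring_B[THEN cring.axioms(1)], of B] D(2) subring_B
    by simp
  then show *: "cring_over (C \<downharpoonright> D) B"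
    by (rule cring.cring_overI[OF D.cring_B])
  interpret S: cring_over "C \<downharpoonright> D" B by (rule *)
  have ad: "S.adjoin M x = adjoin M x" for M x by (simp add: S.adjoin_def adjoin_def)
  have polys_lt: "S.polys_lt M x k = polys_lt M x k" for M x k
    by (induction k) (simp_all add: ad nat_pow_sub)
  show "S.alg_mod Q z = alg_mod Q z" by (simp add: S.alg_mod_def alg_mod_def polys_lt nat_pow_sub)
  assume z: "z \<in> D"
  then have "z \<in> carrier C" "z \<in> carrier (C \<downharpoonright> D)" using subringE(1)[OF D(1)] by auto
  then show "S.gen z = gen z" by (simp add: S.gen_def gen_def polys_lt)
qed

lemma dimension_inequality_gen:
  assumes z: "z \<in> carrier C" and noeth: "noetherian_ring (C \<downharpoonright> B)"
    and chain: "chain_between (C \<downharpoonright> gen z) n Q Q'"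
  shows "\<exists>l. chain_between (C \<downharpoonright> B) l (Q \<inter> B) (Q' \<inter> B) \<and> n \<le> l + (if alg_mod Q z then 0 else 1)"
proof -
  note D = gen_subring[OF z] B_gen[OF z]
  interpret S: cring_over "C \<downharpoonright> gen z" B by (rule cring_over_sub[OF D])
  have zS: "z \<in> carrier (C \<downharpoonright> gen z)" using z_gen[OF z] by simp
  obtain P where P: "prime_chain (C \<downharpoonright> gen z) n P" "P 0 = Q" "P n = Q'"
    using chain by (auto simp: chain_between_def)
  have "S.gen z = carrier (C \<downharpoonright> gen z)" using gen_sub[OF D z_gen[OF z]] by simp
  from S.dimension_inequality[OF zS this _ P(1)] noeth P(2,3)
  obtain l where "chain_between (C \<downharpoonright> B) l (Q \<inter> B) (Q' \<inter> B)"
    "n + (if alg_mod Q' z then 0 else 1) \<le> l + (if alg_mod Q z then 0 else 1)"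
    by (auto simp: alg_mod_sub[OF D])
  then show ?thesis by (intro exI[of _ l]) (auto split: if_splits)
qed

end

section \<open>Finitely generated extensions\<close>

fun adjoin_list :: "('a, 'b) ring_scheme \<Rightarrow> 'a set \<Rightarrow> 'a list \<Rightarrow> 'a set" where
  "adjoin_list C B [] = B"
| "adjoin_list C B (z # zs) = adjoin_list C (cring_over.gen C B z) zs"

lemma adjoin_list_subring:
  assumes "cring_over C B" "set zs \<subseteq> carrier C"
  shows "cring_over C (adjoin_list C B zs)" "B \<subseteq> adjoin_list C B zs" "set zs \<subseteq> adjoin_list C B zs"
proof -
  have "cring_over C (adjoin_list C B zs) \<and> B \<subseteq> adjoin_list C B zs \<and> set zs \<subseteq> adjoin_list C B zs"
    using assms
  proof (induction zs arbitrary: B)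
    case (Cons z zs)
    interpret cring_over C B by fact
    have z: "z \<in> carrier C" using Cons by simp
    have "cring_over C (gen z)"
      by (rule cring_overI[OF gen_subring[OF z]])
    from Cons(1)[OF this] Cons(3) B_gen[OF z] z_gen[OF z] show ?case by auto
  qed simp
  then show "cring_over C (adjoin_list C B zs)" "B \<subseteq> adjoin_list C B zs" "set zs \<subseteq> adjoin_list C B zs"
    by auto
qed

lemma alg_mod_mono:
  assumes "cring_over C B" "cring_over C D" "B \<subseteq> D" "cring_over.alg_mod C B Q z"
  shows "cring_over.alg_mod C D Q z"
proof -
  interpret B: cring_over C B by fact
  interpret D: cring_over C D by fact
  have "B.adjoin M x \<subseteq> D.adjoin M' x" if "M \<subseteq> M'" for M M' x
    using assms(3) that by (auto simp: B.adjoin_def D.adjoin_def)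
  then have "B.polys_lt N z n \<subseteq> D.polys_lt N z n" for N n by (induction n) simp_all
  then show ?thesis using assms(3,4) unfolding B.alg_mod_def D.alg_mod_def by blast
qed

text \<open>An algebraic relation for an element of \<open>D\<close> is itself an element of
  \<open>D\<close>, and so are its coefficients; intersecting the prime with \<open>D\<close> loses
  nothing.\<close>

lemma alg_mod_restrict:
  assumes "cring_over C B" "B \<subseteq> D" "subring D C" "z \<in> D"
  shows "cring_over.alg_mod C B (Q \<inter> D) z = cring_over.alg_mod C B Q z"
proof -
  interpret cring_over C B by fact
  interpret D: cring_over C D by (rule cring_overI[OF assms(3)])
  have DD: "submod D" using D.submod_B assms(2) by (auto simp: submod_def D.submod_def)
  have zp: "z [^]\<^bsub>C\<^esub> n \<in> D" for n :: nat using D.B_pow assms(4) by blast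
  have z: "z \<in> carrier C" using assms(4) D.B_carrier by blast
  have pD: "polys_lt {\<zero>\<^bsub>C\<^esub>} z n \<subseteq> D" for n
    using polys_lt_least[OF z DD, of "{\<zero>\<^bsub>C\<^esub>}" n] zp submodD(3)[OF DD] by blast
  have "l \<oplus>\<^bsub>C\<^esub> c \<otimes>\<^bsub>C\<^esub> z [^]\<^bsub>C\<^esub> n \<in> D" if "l \<in> polys_lt {\<zero>\<^bsub>C\<^esub>} z n" "c \<in> B" for l c and n :: nat
    using that pD submodD(4,5)[OF DD] zp by blast
  then show ?thesis using assms(2) unfolding alg_mod_def by blast
qed

text \<open>Elements algebraic over \<open>B\<close> stay algebraic over the enlarged base, so each
  generator in turn contributes no transcendence degree, and no step is lost.\<close>

theorem dimension_inequality_algebraic: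
  assumes "cring_over C B" "set zs \<subseteq> carrier C" "noetherian_ring (C \<downharpoonright> B)"
    and "chain_between (C \<downharpoonright> adjoin_list C B zs) n Q Q'"
    and "\<And>z. z \<in> set zs \<Longrightarrow> cring_over.alg_mod C B Q z"
  shows "\<exists>l\<ge>n. chain_between (C \<downharpoonright> B) l (Q \<inter> B) (Q' \<inter> B)"
  using assms
proof (induction zs arbitrary: B)
  case Nil
  interpret cring_over C B by fact
  obtain P where P: "prime_chain (C \<downharpoonright> B) n P" "P 0 = Q" "P n = Q'"
    using Nil(4) by (auto simp: chain_between_def)
  then have "Q \<subseteq> B" "Q' \<subseteq> B" using primeD(1) by (auto simp: prime_chain_def)
  then show ?case using Nil(4) by (auto simp: Int_absorb2)
next
  case (Cons z zs)
  interpret cring_over C B by fact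
  have z: "z \<in> carrier C" using Cons(3) by simp
  have G: "cring_over C (gen z)"
    by (rule cring_overI[OF gen_subring[OF z]])
  have "\<exists>l\<ge>n. chain_between (C \<downharpoonright> gen z) l (Q \<inter> gen z) (Q' \<inter> gen z)"
  proof (rule Cons(1)[OF G])
    show "set zs \<subseteq> carrier C" using Cons(3) by simp
    show "noetherian_ring (C \<downharpoonright> gen z)" by (rule hilbert_basis[OF z Cons(4)])
    show "chain_between (C \<downharpoonright> adjoin_list C (gen z) zs) n Q Q'" using Cons(5) by simp
    fix x assume "x \<in> set zs"
    then show "cring_over.alg_mod C (gen z) Q x"
      using alg_mod_mono[OF Cons(2) G B_gen[OF z]] Cons(6) by simp
  qed
  then obtain m where m: "n \<le> m" "chain_between (C \<downharpoonright> gen z) m (Q \<inter> gen z) (Q' \<inter> gen z)" by blast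
  have "alg_mod (Q \<inter> gen z) z"
    using alg_mod_restrict[OF Cons(2) B_gen[OF z] gen_subring[OF z] z_gen[OF z]] Cons(6) by simp
  with dimension_inequality_gen[OF z Cons(4) m(2)]
  obtain l where "m \<le> l" "chain_between (C \<downharpoonright> B) l (Q \<inter> gen z \<inter> B) (Q' \<inter> gen z \<inter> B)" by auto
  moreover have "Q \<inter> gen z \<inter> B = Q \<inter> B" "Q' \<inter> gen z \<inter> B = Q' \<inter> B" using B_gen[OF z] by auto
  ultimately show ?case using m(1) by (intro exI[of _ l]) auto
qed

text \<open>Only the first generator may be transcendental, at a cost of at most one step. The
  others are required to be algebraic over the ring that already contains it.\<close>

corollary dimension_inequality_transcendental:
  assumes B: "cring_over C B" and zs: "set (z # zs) \<subseteq> carrier C" and noeth: "noetherian_ring (C \<downharpoonright> B)"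
    and chain: "chain_between (C \<downharpoonright> adjoin_list C B (z # zs)) n Q Q'"
    and alg: "\<And>x. x \<in> set zs \<Longrightarrow> cring_over.alg_mod C (cring_over.gen C B z) Q x"
  shows "\<exists>l. n \<le> Suc l \<and> chain_between (C \<downharpoonright> B) l (Q \<inter> B) (Q' \<inter> B)"
proof -
  interpret cring_over C B by fact
  have z: "z \<in> carrier C" using zs by simp
  have G: "cring_over C (gen z)"
    by (rule cring_overI[OF gen_subring[OF z]])
  have "\<exists>l\<ge>n. chain_between (C \<downharpoonright> gen z) l (Q \<inter> gen z) (Q' \<inter> gen z)"
    using dimension_inequality_algebraic[OF G _ hilbert_basis[OF z noeth], of zs n Q Q'] zs chain alg by simp
  then obtain m where m: "n \<le> m" "chain_between (C \<downharpoonright> gen z) m (Q \<inter> gen z) (Q' \<inter> gen z)" by blast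
  from dimension_inequality_gen[OF z noeth m(2)]
  obtain l where l: "m \<le> l + (if alg_mod (Q \<inter> gen z) z then 0 else 1)"
    "chain_between (C \<downharpoonright> B) l (Q \<inter> gen z \<inter> B) (Q' \<inter> gen z \<inter> B)"
    by blast
  then have "m \<le> l + 1" by (auto split: if_splits)
  moreover note l(2)
  moreover have "Q \<inter> gen z \<inter> B = Q \<inter> B" "Q' \<inter> gen z \<inter> B = Q' \<inter> B" using B_gen[OF z] by auto
  ultimately show ?thesis using m(1) by (intro exI[of _ l]) simp
qed

section \<open>Rees rings\<close>

lemma surj_hom_noetherian:
  assumes h: "ring_hom_ring R S h" and surj: "h ` carrier R = carrier S" and noeth: "noetherian_ring R"
  shows "noetherian_ring S"
proof -
  interpret ring_hom_ring R S h by fact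
  interpret N: noetherian_ring R by fact
  show ?thesis
  proof (rule S.noetherian_ringI)
    fix J assume J: "ideal J S"
    then have JS: "J \<subseteq> carrier S" by (rule ideal.Icarr[THEN subsetI])
    let ?v = "\<lambda>J. {r \<in> carrier R. h r \<in> J}"
    obtain F where F: "F \<subseteq> carrier R" "finite F" "?v J = Idl\<^bsub>R\<^esub> F"
      using N.finetely_gen[OF ideal_vimage[OF J]] by blast
    have hF: "h ` F \<subseteq> carrier S" using F(1) by auto
    have "F \<subseteq> ?v J" using F R.genideal_self by blast
    then have 1: "Idl\<^bsub>S\<^esub> (h ` F) \<subseteq> J" by (intro S.genideal_minimal[OF J]) blast
    have "F \<subseteq> ?v (Idl\<^bsub>S\<^esub> (h ` F))" using S.genideal_self[OF hF] F(1) by blast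
    then have "?v J \<subseteq> ?v (Idl\<^bsub>S\<^esub> (h ` F))"
      unfolding F(3) by (intro R.genideal_minimal ideal_vimage S.genideal_ideal[OF hF])
    then have "x \<in> Idl\<^bsub>S\<^esub> (h ` F)" if "x \<in> J" for x
    proof -
      have "x \<in> h ` carrier R" using that JS surj by auto
      then show ?thesis using \<open>?v J \<subseteq> _\<close> that by auto
    qed
    then have "J \<subseteq> Idl\<^bsub>S\<^esub> (h ` F)" by blast
    then show "\<exists>A\<subseteq>carrier S. finite A \<and> J = Idl\<^bsub>S\<^esub> A"
      using 1 hF F(2) by (intro exI[of _ "h ` F"]) auto
  qed
qed

text \<open>Surjectivity keeps the inclusions strict: a separating element has a preimage.\<close>

lemma prime_chain_vimage:
  assumes h: "ring_hom_ring R S h" and surj: "h ` carrier R = carrier S" and R: "cring R"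
    and chain: "prime_chain S n P"
  shows "prime_chain R n (\<lambda>i. {r \<in> carrier R. h r \<in> P i})"
proof -
  interpret ring_hom_ring R S h by fact
  interpret cring R by fact
  have pr: "primeideal {r \<in> carrier R. h r \<in> Q} R" if "primeideal Q S" for Q
  proof -
    interpret Q: primeideal Q S by fact
    show ?thesis
    proof (rule primeidealI[OF ideal_vimage[OF Q.is_ideal] R])
      have "\<one>\<^bsub>S\<^esub> \<notin> Q" using Q.I_notcarr Q.one_imp_carrier by auto
      then have "\<one>\<^bsub>R\<^esub> \<notin> {r \<in> carrier R. h r \<in> Q}" by simp
      then show "carrier R \<noteq> {r \<in> carrier R. h r \<in> Q}" using R.one_closed by metis
    qed (use Q.I_prime in auto)
  qed
  show ?thesis
    unfolding prime_chain_def
  proof (intro conjI allI impI)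
    show "primeideal {r \<in> carrier R. h r \<in> P i} R" if "i \<le> n" for i
      using pr chain that by (auto simp: prime_chain_def)
    fix i assume i: "i < n"
    then have "P i \<subset> P (Suc i)" "primeideal (P (Suc i)) S" using chain by (auto simp: prime_chain_def)
    moreover from this(2) have "P (Suc i) \<subseteq> carrier S"
      by (auto dest!: ideal.Icarr[OF primeideal.axioms(1)])
    ultimately obtain x where "x \<in> carrier S" "x \<in> P (Suc i)" "x \<notin> P i" by blast
    moreover from this obtain r where "r \<in> carrier R" "x = h r" using surj by auto
    ultimately have "r \<in> carrier R" "h r \<in> P (Suc i)" "h r \<notin> P i" by auto
    then show "{r \<in> carrier R. h r \<in> P i} \<subset> {r \<in> carrier R. h r \<in> P (Suc i)}"
      using \<open>P i \<subset> P (Suc i)\<close> by blast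
  qed
qed

lemma (in cring_over) finsum_submod:
  assumes M: "submod M" and "finite F" "\<And>i. i \<in> F \<Longrightarrow> g i \<in> M"
  shows "(\<Oplus>i\<in>F. g i) \<in> M"
  using assms(2,3)
proof (induction F rule: finite_induct)
  case (insert x F)
  then have "g \<in> F \<rightarrow> carrier C" "g x \<in> carrier C" using submodD(2)[OF M] by auto
  then show ?case using insert submodD(4)[OF M] by (simp add: finsum_insert)
qed (simp add: submodD(3)[OF M])

lemma (in cring) cring_over_carrier: "cring_over R (carrier R)"
  by (rule cring_overI[OF carrier_is_subring])

context UP_domain
begin

lemma UP_over: "cring_over P (carrier P)"
  by (rule P.cring_over_carrier)

lemma R_over: "cring_over R (carrier R)"
  by (rule R.cring_over_carrier)

abbreviation "polys J \<equiv> {f \<in> carrier P. \<forall>n. up_ring.coeff P f n \<in> J}"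

text \<open>Gauss's argument with lowest coefficients: take the first coefficient of each factor
  outside \<open>q\<close> and look at the coefficient of the product in the sum of these
  degrees.\<close>

lemma polys_prime:
  assumes q: "primeideal q R"
  shows "primeideal (polys q) P"
proof -
  interpret RO: cring_over R "carrier R" by (rule R_over)
  interpret PO: cring_over P "carrier P" by (rule UP_over)
  interpret q: primeideal q R by fact
  have q': "primeideal q (R \<downharpoonright> carrier R)" using q by simp
  note sq = RO.primeD(2)[OF q']
  have oneq: "\<one> \<notin> q" using q.I_notcarr q.one_imp_carrier by auto
  have "primeideal (polys q) (P \<downharpoonright> carrier P)"
    unfolding PO.prime_iff
  proof (intro conjI ballI impI)
    show "polys q \<subseteq> carrier P" by auto
    show "PO.submod (polys q)"
      unfolding PO.submod_def
    proof (intro conjI ballI)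
      show "\<zero>\<^bsub>P\<^esub> \<in> polys q" using RO.submodD(3)[OF sq] by simp
      show "x \<oplus>\<^bsub>P\<^esub> y \<in> polys q" if "x \<in> polys q" "y \<in> polys q" for x y
        using that RO.submodD(4)[OF sq] by simp
      fix b x assume b: "b \<in> carrier P" "x \<in> polys q"
      have "up_ring.coeff P (b \<otimes>\<^bsub>P\<^esub> x) n \<in> q" for n
      proof -
        have "(\<Oplus>i\<in>{..n}. up_ring.coeff P b i \<otimes> up_ring.coeff P x (n - i)) \<in> q"
          using b RO.submodD(5)[OF sq] by (intro RO.finsum_submod[OF sq]) auto
        then show ?thesis using b by simp
      qed
      then show "b \<otimes>\<^bsub>P\<^esub> x \<in> polys q" using b by simp
    qed auto
    show "\<one>\<^bsub>P\<^esub> \<notin> polys q" using oneq by auto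
    fix f g assume fg: "f \<in> carrier P" "g \<in> carrier P" "f \<otimes>\<^bsub>P\<^esub> g \<in> polys q"
    show "f \<in> polys q \<or> g \<in> polys q"
    proof (rule ccontr)
      assume "\<not> ?thesis"
      then have ex: "\<exists>n. up_ring.coeff P f n \<notin> q" "\<exists>n. up_ring.coeff P g n \<notin> q" using fg by auto
      define i where "i = (LEAST n. up_ring.coeff P f n \<notin> q)"
      define j where "j = (LEAST n. up_ring.coeff P g n \<notin> q)"
      have i: "up_ring.coeff P f i \<notin> q" "\<And>n. n < i \<Longrightarrow> up_ring.coeff P f n \<in> q"
        unfolding i_def using LeastI_ex[OF ex(1)] not_less_Least by blast+
      have j: "up_ring.coeff P g j \<notin> q" "\<And>n. n < j \<Longrightarrow> up_ring.coeff P g n \<in> q"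
        unfolding j_def using LeastI_ex[OF ex(2)] not_less_Least by blast+
      let ?t = "\<lambda>k. up_ring.coeff P f k \<otimes> up_ring.coeff P g (i + j - k)"
      have fC: "up_ring.coeff P f k \<in> carrier R" and gC: "up_ring.coeff P g k \<in> carrier R" for k using fg by auto
      have rest: "(\<Oplus>k\<in>{..i + j} - {i}. ?t k) \<in> q"
      proof (rule RO.finsum_submod[OF sq])
        fix k assume k: "k \<in> {..i + j} - {i}"
        show "?t k \<in> q"
        proof (cases "k < i")
          case True
          then show ?thesis
            using RO.submodD(5)[OF sq gC[of "i + j - k"] i(2)[of k]] R.m_comm[OF fC gC] by simp
        next
          case False
          then have "i + j - k < j" using k by auto
          then show ?thesis using RO.submodD(5)[OF sq fC j(2)] by simp
        qed
      qed simp
      have all: "(\<Oplus>k\<in>{..i + j}. ?t k) \<in> q" using fg by (simp flip: coeff_mult)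
      have split: "(\<Oplus>k\<in>{..i + j}. ?t k) = ?t i \<oplus> (\<Oplus>k\<in>{..i + j} - {i}. ?t k)"
      proof -
        have "(\<Oplus>k\<in>insert i ({..i + j} - {i}). ?t k) = ?t i \<oplus> (\<Oplus>k\<in>{..i + j} - {i}. ?t k)"
          using fC gC by (intro R.finsum_insert) auto
        moreover have "insert i ({..i + j} - {i}) = {..i + j}" by auto
        ultimately show ?thesis by simp
      qed
      have "?t i \<in> q"
        by (rule RO.submod_cancel[OF sq all[unfolded split] rest]) (rule R.m_closed[OF fC gC])
      then show False using q.I_prime[OF fC gC] i(1) j(1) by auto
    qed
  qed
  then show ?thesis by simp
qed

end

locale rees = UP_domain +
  fixes I :: "nat \<Rightarrow> 'a set"
  assumes filt: "filtration R I"
begin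

text \<open>Kept as a subset of the polynomial ring, so that contraction of q[t] is an intersection
  and the finitely generated subrings live in the same ring.\<close>

definition S where "S = {f \<in> carrier P. \<forall>n. up_ring.coeff P f n \<in> I n}"

lemma rees_eq: "rees_ring R I = P \<downharpoonright> S"
  by (simp add: rees_ring_def S_def P_def)

sublocale RO: cring_over R "carrier R" by (rule R_over)

lemma I_submod: "RO.submod (I n)" and I_carrier: "I n \<subseteq> carrier R"
proof -
  have "ideal (I n) (R \<downharpoonright> carrier R)" using filt by (simp add: filtration_def)
  then show "RO.submod (I n)" "I n \<subseteq> carrier R" using RO.ideal_iff by auto
qed

lemma I_mult: "a \<in> I i \<Longrightarrow> b \<in> I j \<Longrightarrow> a \<otimes> b \<in> I (i + j)"
  using filt ideal_prod.prod[of a "I i" b "I j" R] unfolding filtration_def by blast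

lemma I_0: "I 0 = carrier R"
  using filt by (simp add: filtration_def)

lemma S_carrier: "S \<subseteq> carrier P"
  by (auto simp: S_def)

lemma monom_S: "c \<in> I n \<Longrightarrow> up_ring.monom P c n \<in> S"
  using I_carrier[of n] RO.submodD(3)[OF I_submod] by (auto simp: S_def)

lemma S_subring: "subring S P"
proof (rule P.subringI)
  show "S \<subseteq> carrier P" by (rule S_carrier)
  show "\<one>\<^bsub>P\<^esub> \<in> S" using RO.submodD(3)[OF I_submod] I_0 by (auto simp: S_def)
  show "\<ominus>\<^bsub>P\<^esub> f \<in> S" if "f \<in> S" for f
    using that RO.submod_neg[OF I_submod] by (auto simp: S_def)
  fix f g assume fg: "f \<in> S" "g \<in> S"
  then show "f \<oplus>\<^bsub>P\<^esub> g \<in> S" using RO.submodD(4)[OF I_submod] by (auto simp: S_def)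
  have "(\<Oplus>i\<in>{..n}. up_ring.coeff P f i \<otimes> up_ring.coeff P g (n - i)) \<in> I n" for n
  proof (rule RO.finsum_submod[OF I_submod])
    fix i assume "i \<in> {..n}"
    then show "up_ring.coeff P f i \<otimes> up_ring.coeff P g (n - i) \<in> I n"
      using fg I_mult[of "up_ring.coeff P f i" i "up_ring.coeff P g (n - i)" "n - i"] by (simp add: S_def)
  qed simp
  then show "f \<otimes>\<^bsub>P\<^esub> g \<in> S" using fg by (auto simp: S_def)
qed

sublocale SO: cring_over P S
  by (rule P.cring_overI[OF S_subring])

abbreviation const where "const a \<equiv> up_ring.monom P a 0"

text \<open>The copy of R formed by the constants; the dimension inequality needs the base as a
  subring of the polynomial ring.\<close>

definition B where "B = const ` carrier R"

lemma const_hom: "ring_hom_ring R P const"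
  using const_ring_hom by (intro ring_hom_ringI2 R.ring_axioms P.ring_axioms)

lemma B_subring: "subring B P"
  unfolding B_def using ring_hom_ring.img_is_subring[OF const_hom R.carrier_is_subring] .

lemma BO: "cring_over P B"
  by (rule P.cring_overI[OF B_subring])

lemma const_S: "a \<in> carrier R \<Longrightarrow> const a \<in> S"
  using monom_S[of a 0] I_0 by simp

lemma B_S: "B \<subseteq> S"
  using const_S by (auto simp: B_def)

lemma const_hom_B: "ring_hom_ring R (P \<downharpoonright> B) const"
proof (rule ring_hom_ringI2)
  show "ring (P \<downharpoonright> B)" using cring_over.cring_B[OF BO] by (rule cring.axioms(1))
  show "const \<in> ring_hom R (P \<downharpoonright> B)"
    using const_ring_hom by (auto simp: ring_hom_def B_def)
qed (rule R.ring_axioms)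

lemma B_noeth: "noetherian_ring R \<Longrightarrow> noetherian_ring (P \<downharpoonright> B)"
  using surj_hom_noetherian[OF const_hom_B] by (simp add: B_def)

lemma chain_from_B:
  assumes "chain_between (P \<downharpoonright> B) l p q"
  shows "chain_between R l {a \<in> carrier R. const a \<in> p} {a \<in> carrier R. const a \<in> q}"
proof -
  obtain H where H: "prime_chain (P \<downharpoonright> B) l H" "H 0 = p" "H l = q"
    using assms by (auto simp: chain_between_def)
  then have "prime_chain R l (\<lambda>i. {a \<in> carrier R. const a \<in> H i})"
    using prime_chain_vimage[OF const_hom_B _ R.is_cring] by (simp add: B_def)
  then show ?thesis using H unfolding chain_between_def by auto
qed

end

section \<open>Primes of the Rees ring\<close>

lemma (in cring_over) gen_least:
  assumes D: "subring D C" "B \<subseteq> D" and z: "z \<in> D"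
  shows "gen z \<subseteq> D"
proof -
  interpret D: cring_over C D by (rule cring_overI[OF D(1)])
  have DD: "submod D" using D.submod_B D(2) by (auto simp: submod_def D.submod_def)
  have zC: "z \<in> carrier C" using z D.B_carrier by blast
  have "polys_lt {\<zero>} z n \<subseteq> D" for n
    using polys_lt_least[OF zC DD] D.B_pow[OF z] by auto
  then show ?thesis by (auto simp: gen_def[OF zC])
qed

lemma adjoin_list_least:
  assumes "cring_over C B" "subring D C" "B \<subseteq> D" "set zs \<subseteq> D"
  shows "adjoin_list C B zs \<subseteq> D"
  using assms
proof (induction zs arbitrary: B)
  case (Cons z zs)
  interpret cring_over C B by fact
  have "D \<subseteq> carrier C" using subringE(1)[OF Cons(3)] .
  then have z: "z \<in> carrier C" "z \<in> D" using Cons(5) by auto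
  have "cring_over C (gen z)"
    by (rule cring_overI[OF gen_subring[OF z(1)]])
  then show ?case using Cons(1)[of "gen z"] Cons(3,5) gen_least[OF Cons(3,4) z(2)] by simp
qed simp

context rees
begin

lemma mult_adjoin:
  assumes q: "RO.submod q" and bc: "b \<in> carrier R" "c \<in> carrier R" "b \<otimes> c \<in> q"
    and u: "u \<in> RO.adjoin q b" and v: "v \<in> RO.adjoin q c"
  shows "u \<otimes> v \<in> q"
proof -
  obtain m r where m: "u = m \<oplus> r \<otimes> b" "m \<in> q" "r \<in> carrier R" using u by (auto simp: RO.adjoin_def)
  obtain m' r' where m': "v = m' \<oplus> r' \<otimes> c" "m' \<in> q" "r' \<in> carrier R" using v by (auto simp: RO.adjoin_def)
  note mC = RO.submodD(2)[OF q m(2)] RO.submodD(2)[OF q m'(2)]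
  have eq: "u \<otimes> v = (m' \<oplus> r' \<otimes> c) \<otimes> m \<oplus> ((r \<otimes> b) \<otimes> m' \<oplus> (r \<otimes> r') \<otimes> (b \<otimes> c))"
    unfolding m(1) m'(1) using mC m(3) m'(3) bc(1,2) by algebra
  have "(m' \<oplus> r' \<otimes> c) \<otimes> m \<in> q" "(r \<otimes> b) \<otimes> m' \<in> q" "(r \<otimes> r') \<otimes> (b \<otimes> c) \<in> q"
    using RO.submodD(5)[OF q] mC m m' bc by auto
  then show ?thesis unfolding eq using RO.submodD(4)[OF q] by simp
qed

text \<open>An ideal \<open>q\<close> that is maximal among those with \<open>polys q \<inter> S \<subseteq> P\<^sub>0\<close> is automatically prime.\<close>

lemma exists_prime_below:
  assumes noeth: "noetherian_ring R" and P0: "primeideal P0 (P \<downharpoonright> S)" and y: "y \<in> carrier R" "const y \<in> P0" "y \<noteq> \<zero>"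
    and reg: "\<And>n g. g \<in> carrier R \<Longrightarrow> y \<otimes> g \<in> I n \<Longrightarrow> g \<in> I n"
  obtains q where "primeideal q R" "y \<in> q" "polys q \<inter> S \<subseteq> P0"
proof -
  note P0D = SO.primeD[OF P0]
  let ?A = "{J. RO.submod J \<and> J \<subseteq> carrier R \<and> y \<in> J \<and> polys J \<inter> S \<subseteq> P0}"
  \<comment> \<open>The family is nonempty because it contains yR: an element of \<open>S\<close>
    with coefficients y g_n is y times the polynomial with coefficients g_n, and \<open>reg\<close>
    puts that polynomial into \<open>S\<close>.\<close>
  let ?Y = "RO.adjoin {\<zero>} y"
  have "?Y \<in> ?A"
  proof (intro CollectI conjI)
    note s0 = RO.submod_zero
    show "RO.submod ?Y" by (rule RO.submod_adjoin[OF s0 y(1)])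
    show "?Y \<subseteq> carrier R" "y \<in> ?Y" using RO.adjoin_incl(2)[OF s0 y(1)] y by (auto simp: RO.adjoin_def)
    show "polys ?Y \<inter> S \<subseteq> P0"
    proof
      fix f assume f: "f \<in> polys ?Y \<inter> S"
      have "\<exists>g. g \<in> carrier R \<and> up_ring.coeff P f n = y \<otimes> g" for n
      proof -
        have "up_ring.coeff P f n \<in> ?Y" using f by auto
        then show ?thesis using y by (auto simp: RO.adjoin_def R.m_comm)
      qed
      then obtain g where g: "\<And>n. g n \<in> carrier R" "\<And>n. up_ring.coeff P f n = y \<otimes> g n" by metis
      have fC: "f \<in> carrier P" using f by auto
      have "g \<in> up R"
      proof (rule mem_upI)
        \<comment> \<open>The quotients g_n vanish beyond the degree of \<open>f\<close>, because
          \<open>y\<close> is nonzero and R is a domain.\<close>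
        have "bound \<zero> (deg R f) g"
        proof
          fix m assume "deg R f < m"
          then have "y \<otimes> g m = \<zero>" using deg_aboveD[OF _ fC] g(2)[of m] by simp
          then show "g m = \<zero>" using R.integral y g(1) by blast
        qed
        then show "\<exists>n. bound \<zero> n g" by blast
      qed (rule g(1))
      then have gP: "g \<in> carrier P" "\<And>n. up_ring.coeff P g n = g n" unfolding P_def UP_def by simp_all
      have "g \<in> S" using gP g reg f unfolding S_def by auto
      moreover have "f = g \<otimes>\<^bsub>P\<^esub> const y"
        by (rule up_eqI) (use fC gP g y in \<open>simp_all add: P.m_comm[of g] monom_mult_is_smult\<close>)
      ultimately show "f \<in> P0" using SO.submodD(5)[OF P0D(2) _ y(2)] by simp
    qed
  qed
  then obtain q where q: "q \<in> ?A" and max: "\<And>J. J \<in> ?A \<Longrightarrow> q \<subseteq> J \<Longrightarrow> J = q"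
    using RO.maximal_ideal_exists[of ?A] noeth by auto
  have sq: "RO.submod q" and qR: "q \<subseteq> carrier R" using q by auto
  have "primeideal q (R \<downharpoonright> carrier R)"
    unfolding RO.prime_iff
  proof (intro conjI ballI impI)
    show "\<one> \<notin> q"
    proof
      assume "\<one> \<in> q"
      then have "\<one>\<^bsub>P\<^esub> \<in> polys q \<inter> S" using RO.submodD(3)[OF sq] SO.B_one by auto
      then show False using q P0D(3) by blast
    qed
    fix b c assume bc: "b \<in> carrier R" "c \<in> carrier R" "b \<otimes> c \<in> q"
    \<comment> \<open>Each enlargement of \<open>q\<close> is witnessed by an element of
      \<open>S\<close> outside \<open>P0\<close>. For b c in \<open>q\<close>, the product of two
      such witnesses has all coefficients in \<open>q\<close>, so it lies in \<open>P0\<close>,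
      against primeness.\<close>
    have ex: "\<exists>f. f \<in> polys (RO.adjoin q x) \<inter> S \<and> f \<notin> P0" if x: "x \<in> carrier R" "x \<notin> q" for x
    proof (rule ccontr)
      assume "\<not> ?thesis"
      then have "polys (RO.adjoin q x) \<inter> S \<subseteq> P0" by blast
      moreover note inc = RO.adjoin_incl[OF sq x(1)]
      moreover have "y \<in> RO.adjoin q x" using inc(1) q by blast
      ultimately have "RO.adjoin q x \<in> ?A"
        using RO.submod_adjoin[OF sq x(1)] RO.adjoin_B[OF qR x(1)] by blast
      then show False using max[OF _ inc(1)] inc(2) x(2) by blast
    qed
    show "b \<in> q \<or> c \<in> q"
    proof (rule ccontr)
      assume "\<not> ?thesis"
      then have nq: "b \<notin> q" "c \<notin> q" by auto
      obtain f where f: "f \<in> polys (RO.adjoin q b)" "f \<in> S" "f \<notin> P0"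
        using ex[OF bc(1) nq(1)] by (elim exE conjE IntE)
      obtain g where g: "g \<in> polys (RO.adjoin q c)" "g \<in> S" "g \<notin> P0"
        using ex[OF bc(2) nq(2)] by (elim exE conjE IntE)
      have "(\<Oplus>i\<in>{..n}. up_ring.coeff P f i \<otimes> up_ring.coeff P g (n - i)) \<in> q" for n
        using f g mult_adjoin[OF sq bc] by (intro RO.finsum_submod[OF sq]) auto
      then have "f \<otimes>\<^bsub>P\<^esub> g \<in> polys q" using f g by simp
      then have "f \<otimes>\<^bsub>P\<^esub> g \<in> P0" using q SO.B_mult[OF f(2) g(2)] by blast
      then show False using P0D(5)[OF f(2) g(2)] f g by blast
    qed
  qed (use qR sq in auto)
  then show ?thesis using that q by simp
qed

lemma monoms_generate:
  assumes T: "subring T P" and f: "f \<in> carrier P" and m: "\<And>n. up_ring.monom P (up_ring.coeff P f n) n \<in> T"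
  shows "f \<in> T"
proof -
  interpret TO: cring_over P T by (rule P.cring_overI[OF T])
  have "(\<Oplus>\<^bsub>P\<^esub>i\<in>{..deg R f}. up_ring.monom P (up_ring.coeff P f i) i) \<in> T"
    by (intro TO.finsum_submod[OF TO.submod_B] m) auto
  then show ?thesis using up_repr[OF f] by simp
qed

text \<open>Homogeneity keeps the transcendence degree at most one. For a monomial a t^e of positive
  degree with \<open>a\<close> outside \<open>q\<close>, the identity a^n (c t^n)^e = c^e (a t^e)^n
  is an algebraic relation for every other monomial. If there is no such monomial, all those of
  positive degree vanish modulo q[t].\<close>

lemma monoms_algebraic:
  assumes q: "primeideal q R"
  obtains z0 where "z0 \<in> S" "\<And>c n. c \<in> I n \<Longrightarrow>
    cring_over.alg_mod P (cring_over.gen P B z0) (polys q \<inter> S) (up_ring.monom P c n)"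
proof (cases "\<exists>e\<ge>1. \<exists>a\<in>I e. a \<notin> q")
  case True
  then obtain e a where e: "e \<ge> 1" "a \<in> I e" "a \<notin> q" by blast
  let ?z0 = "up_ring.monom P a e"
  interpret BO: cring_over P B by (rule BO)
  have aR: "a \<in> carrier R" using e I_carrier by blast
  then have zP: "?z0 \<in> carrier P" by simp
  interpret GO: cring_over P "BO.gen ?z0"
    by (rule P.cring_overI[OF BO.gen_subring[OF zP]])
  show ?thesis
  proof (rule that)
    show "?z0 \<in> S" by (rule monom_S[OF e(2)])
    fix c n assume c: "c \<in> I n"
    have cR: "c \<in> carrier R" using c I_carrier by blast
    have acR: "a [^] k \<in> carrier R" "c [^] k \<in> carrier R" for k :: nat using aR cR by auto
    define l where "l = \<ominus>\<^bsub>P\<^esub> (const (c [^] e) \<otimes>\<^bsub>P\<^esub> ?z0 [^]\<^bsub>P\<^esub> n)"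
    have cB: "const x \<in> BO.gen ?z0" if "x \<in> carrier R" for x
      using that BO.B_gen[OF zP] by (auto simp: B_def)
    have "l \<in> BO.gen ?z0"
      unfolding l_def using cB acR GO.B_pow[OF BO.z_gen[OF zP]] by (intro GO.B_neg GO.B_mult) auto
    \<comment> \<open>As a polynomial in the monomial, \<open>l\<close> is a constant; it has degree
      below \<open>e\<close> because \<open>e\<close> is at least one.\<close>
    then have "l \<in> GO.polys_lt {\<zero>\<^bsub>P\<^esub>} (up_ring.monom P c n) e"
      using GO.B_polys_lt[of "up_ring.monom P c n"] cR e(1) by simp
    moreover have "const (a [^] n) \<in> BO.gen ?z0" using cB acR by blast
    moreover have "const (a [^] n) \<notin> polys q \<inter> S"
    proof
      assume "const (a [^] n) \<in> polys q \<inter> S"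
      then have "up_ring.coeff P (const (a [^] n)) 0 \<in> q" by blast
      then have "a [^] n \<in> q" using acR by simp
      then show False using RO.prime_full_pow[OF q aR] e(3) by blast
    qed
    moreover have "l \<oplus>\<^bsub>P\<^esub> const (a [^] n) \<otimes>\<^bsub>P\<^esub> up_ring.monom P c n [^]\<^bsub>P\<^esub> e = \<zero>\<^bsub>P\<^esub>"
    proof -
      have mm: "up_ring.monom P x i \<otimes>\<^bsub>P\<^esub> up_ring.monom P y j = up_ring.monom P (x \<otimes> y) (i + j)"
        if "x \<in> carrier R" "y \<in> carrier R" for x y i j
        using that by (simp only: monom_mult)
      have 1: "const (a [^] n) \<otimes>\<^bsub>P\<^esub> up_ring.monom P c n [^]\<^bsub>P\<^esub> e = up_ring.monom P (a [^] n \<otimes> c [^] e) (n * e)"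
        using acR cR monom_pow[OF cR, of n e] mm by (simp del: monom_mult)
      have "const (c [^] e) \<otimes>\<^bsub>P\<^esub> ?z0 [^]\<^bsub>P\<^esub> n = up_ring.monom P (c [^] e \<otimes> a [^] n) (e * n)"
        using acR aR monom_pow[OF aR, of e n] mm by (simp del: monom_mult)
      also have "\<dots> = up_ring.monom P (a [^] n \<otimes> c [^] e) (n * e)"
        using acR R.m_comm by (simp add: mult.commute)
      finally have 2: "l = \<ominus>\<^bsub>P\<^esub> up_ring.monom P (a [^] n \<otimes> c [^] e) (n * e)" by (simp add: l_def)
      show ?thesis unfolding 1 2 using acR by (simp add: P.l_neg)
    qed
    moreover have "\<zero>\<^bsub>P\<^esub> \<in> polys q \<inter> S"
    proof -
      have "\<zero> \<in> q" using additive_subgroup.zero_closed[OF ideal.axioms(1)[OF primeideal.axioms(1)[OF q]]] .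
      then show ?thesis using SO.B_zero by simp
    qed
    ultimately show "GO.alg_mod (polys q \<inter> S) (up_ring.monom P c n)"
      unfolding GO.alg_mod_def by fastforce
  qed
next
  case False
  interpret BO: cring_over P B by (rule BO)
  interpret GO: cring_over P "BO.gen \<one>\<^bsub>P\<^esub>"
    by (rule P.cring_overI[OF BO.gen_subring[OF P.one_closed]])
  have q0: "\<zero> \<in> q" using additive_subgroup.zero_closed[OF ideal.axioms(1)[OF primeideal.axioms(1)[OF q]]] .
  have oneq: "\<one> \<notin> q" using RO.prime_full(2)[OF q] .
  show ?thesis
  proof (rule that)
    show "\<one>\<^bsub>P\<^esub> \<in> S" by (rule SO.B_one)
    fix c n assume c: "c \<in> I n"
    have cR: "c \<in> carrier R" using c I_carrier by blast
    let ?z = "up_ring.monom P c n"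
    have zP: "?z \<in> carrier P" using cR by simp
    have oneQ: "\<one>\<^bsub>P\<^esub> \<notin> polys q \<inter> S" using oneq by auto
    \<comment> \<open>In degree zero the monomial is in the base and cancels against its negative;
      in positive degree it lies in the prime already, so the lower term is zero.\<close>
    define l where "l = (if n = 0 then \<ominus>\<^bsub>P\<^esub> ?z else \<zero>\<^bsub>P\<^esub>)"
    have "l \<in> BO.gen \<one>\<^bsub>P\<^esub>"
    proof (cases "n = 0")
      case True
      then have "?z \<in> B" using cR by (simp add: B_def)
      then show ?thesis using True BO.B_gen[OF P.one_closed] GO.B_neg by (auto simp: l_def)
    qed (simp add: l_def)
    then have "l \<in> GO.polys_lt {\<zero>\<^bsub>P\<^esub>} ?z 1" by (intro GO.B_polys_lt[OF zP]) auto
    moreover have "l \<oplus>\<^bsub>P\<^esub> \<one>\<^bsub>P\<^esub> \<otimes>\<^bsub>P\<^esub> ?z [^]\<^bsub>P\<^esub> (1::nat) \<in> polys q \<inter> S"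
    proof (cases "n = 0")
      case True
      then have "l \<oplus>\<^bsub>P\<^esub> \<one>\<^bsub>P\<^esub> \<otimes>\<^bsub>P\<^esub> ?z [^]\<^bsub>P\<^esub> (1::nat) = \<zero>\<^bsub>P\<^esub>" using zP by (simp add: l_def P.l_neg)
      then show ?thesis using q0 SO.B_zero by simp
    next
      case nz: False
      then have "c \<in> q" using False c by (metis One_nat_def Suc_leI neq0_conv)
      then have "?z \<in> polys q \<inter> S" using q0 cR monom_S[OF c] by auto
      then show ?thesis using nz zP by (simp add: l_def)
    qed
    ultimately show "GO.alg_mod (polys q \<inter> S) ?z"
      unfolding GO.alg_mod_def using oneQ GO.B_one by blast
  qed
qed

end

lemma chain_between_strict:
  assumes "chain_between A n p q" "0 < n"
  shows "p \<subset> q"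
proof -
  obtain H where H: "prime_chain A n H" "H 0 = p" "H n = q"
    using assms(1) by (auto simp: chain_between_def)
  have "H 0 \<subset> H i" if "0 < i" "i \<le> n" for i
    using that
  proof (induction i)
    case (Suc i)
    have "H i \<subset> H (Suc i)" using H(1) Suc(3) by (simp add: prime_chain_def)
    then show ?case using Suc by (cases "i = 0") auto
  qed simp
  then show ?thesis using H assms(2) by blast
qed

context rees
begin

lemma S_coeff: "f \<in> S \<Longrightarrow> up_ring.coeff P f n \<in> I n"
  unfolding S_def by blast

text \<open>The property \<open>reg\<close> carries all that is used of the valuations here, and
  \<open>contr\<close> says that the chain lies in the fibre over \<open>Q\<close>. The prime
  \<open>p\<close> provides the chain of length two for the case q = Q.\<close>

theorem fibre_chain_shorter:
  assumes noeth: "noetherian_ring R" and Q: "primeideal Q R" and y: "y \<in> Q" "y \<noteq> \<zero>"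
    and reg: "\<And>n g. g \<in> carrier R \<Longrightarrow> y \<otimes> g \<in> I n \<Longrightarrow> g \<in> I n"
    and p: "primeideal p R" "{\<zero>} \<subset> p" "p \<subset> Q"
    and rees_chain: "prime_chain (rees_ring R I) k H"
    and contr: "\<And>i. i \<le> k \<Longrightarrow> {a \<in> carrier R. const a \<in> H i} = Q"
  shows "\<exists>m>k. chain_between R m {\<zero>} Q"
proof -
  interpret BO: cring_over P B by (rule BO)
  have chain: "prime_chain (P \<downharpoonright> S) k H" using rees_chain by (simp only: rees_eq)
  have yR: "y \<in> carrier R" using RO.prime_full(6)[OF Q y(1)] .
  have H0: "primeideal (H 0) (P \<downharpoonright> S)" using chain by (simp add: prime_chain_def)
  have "const y \<in> H 0" using contr[of 0] y(1) by auto
  then obtain q where q: "primeideal q R" "y \<in> q" "polys q \<inter> S \<subseteq> H 0"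
    using exists_prime_below[OF noeth H0 yR _ y(2) reg] by blast
  let ?Q0 = "polys q \<inter> S"
  have Q0: "primeideal ?Q0 (P \<downharpoonright> S)" by (rule SO.prime_full(5)[OF polys_prime[OF q(1)]])
  have q0: "\<zero> \<in> q" using RO.submodD(3)[OF RO.prime_full(1)[OF q(1)]] .
  have Q0q: "{a \<in> carrier R. const a \<in> ?Q0} = q"
  proof
    show "{a \<in> carrier R. const a \<in> ?Q0} \<subseteq> q"
    proof clarify
      fix a assume a: "a \<in> carrier R" "\<forall>n. up_ring.coeff P (const a) n \<in> q"
      then have "up_ring.coeff P (const a) 0 \<in> q" by blast
      then show "a \<in> q" using a(1) by simp
    qed
    show "q \<subseteq> {a \<in> carrier R. const a \<in> ?Q0}"
      using RO.prime_full(6)[OF q(1)] q0 const_S by auto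
  qed
  \<comment> \<open>Equality with \<open>H 0\<close> forces q = Q by contraction; otherwise the
    prime below lengthens the chain by one.\<close>
  have "\<exists>n. chain_between (P \<downharpoonright> S) n ?Q0 (H k) \<and> k \<le> n \<and> (q \<noteq> Q \<longrightarrow> n = Suc k)"
  proof (cases "?Q0 = H 0")
    case True
    then have "q = Q" using Q0q contr[of 0] by simp
    then show ?thesis using chain True by (auto simp: chain_between_def intro!: exI[of _ k])
  next
    case False
    have "chain_between (P \<downharpoonright> S) k (H 0) (H k)" using chain by (auto simp: chain_between_def)
    then have "chain_between (P \<downharpoonright> S) (Suc k) ?Q0 (H k)"
      using chain_between_Cons[OF _ Q0] False q(3) by blast
    then show ?thesis by (intro exI[of _ "Suc k"]) simp
  qed
  then obtain n G where G: "prime_chain (P \<downharpoonright> S) n G" "G 0 = ?Q0" "G n = H k"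
    and n: "k \<le> n" "q \<noteq> Q \<Longrightarrow> n = Suc k" by (auto simp: chain_between_def)
  have Gp: "primeideal (G i) (P \<downharpoonright> S)" if "i \<le> n" for i using G(1) that by (simp add: prime_chain_def)
  have Gs: "G i \<subset> G (Suc i)" if "i < n" for i using G(1) that by (simp add: prime_chain_def)
  define g where "g i = (SOME x. x \<in> G (Suc i) \<and> x \<notin> G i)" for i
  have g: "g i \<in> G (Suc i) \<and> g i \<notin> G i" if "i < n" for i
  proof -
    have "\<exists>x. x \<in> G (Suc i) \<and> x \<notin> G i" using Gs[OF that] by blast
    then show ?thesis unfolding g_def by (rule someI_ex)
  qed
  have gS: "g i \<in> S" if "i < n" for i using g[OF that] SO.primeD(4)[OF Gp[of "Suc i"]] that by auto
  \<comment> \<open>The separating elements are split into monomials, since algebraicity over the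
    ring with \<open>z0\<close> is known for monomials. They are in \<open>S\<close>, because
    membership in \<open>S\<close> is tested coefficientwise.\<close>
  define Z where "Z = (\<Union>i<n. (\<lambda>j. up_ring.monom P (up_ring.coeff P (g i) j) j) ` {..deg R (g i)})"
  have "finite Z" by (simp add: Z_def)
  then obtain zs where zs: "set zs = Z" using finite_list by blast
  have Zm: "\<exists>c j. c \<in> I j \<and> z = up_ring.monom P c j" if "z \<in> Z" for z
  proof -
    obtain i j where i: "i < n" "z = up_ring.monom P (up_ring.coeff P (g i) j) j" using \<open>z \<in> Z\<close> by (auto simp: Z_def)
    moreover have "up_ring.coeff P (g i) j \<in> I j" by (rule S_coeff[OF gS[OF i(1)]])
    ultimately show ?thesis by blast
  qed
  have ZS: "Z \<subseteq> S" using Zm monom_S by blast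
  obtain z0 where z0: "z0 \<in> S" and alg: "\<And>c n. c \<in> I n \<Longrightarrow>
    cring_over.alg_mod P (BO.gen z0) ?Q0 (up_ring.monom P c n)" using monoms_algebraic[OF q(1)] by blast
  have z0P: "z0 \<in> carrier P" using z0 S_carrier by blast
  have zsP: "set (z0 # zs) \<subseteq> carrier P" using z0P zs ZS S_carrier by auto
  define T where "T = adjoin_list P B (z0 # zs)"
  interpret TO: cring_over P T unfolding T_def by (rule adjoin_list_subring(1)[OF BO zsP])
  have BT: "B \<subseteq> T" and zT: "set (z0 # zs) \<subseteq> T" unfolding T_def by (rule adjoin_list_subring[OF BO zsP])+
  have "set (z0 # zs) \<subseteq> S" using z0 zs ZS by auto
  then have TS: "T \<subseteq> S" unfolding T_def by (rule adjoin_list_least[OF BO S_subring B_S])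
  have gT: "g i \<in> T" if i: "i < n" for i
  proof (rule monoms_generate[OF TO.subring_B])
    show gP: "g i \<in> carrier P" using gS[OF i] S_carrier by blast
    fix j show "up_ring.monom P (up_ring.coeff P (g i) j) j \<in> T"
    proof (cases "j \<le> deg R (g i)")
      case True
      then have "up_ring.monom P (up_ring.coeff P (g i) j) j \<in> Z" using i by (auto simp: Z_def)
      then show ?thesis using zT zs by auto
    next
      case False
      then show ?thesis using deg_aboveD[OF _ gP, of j] TO.B_zero by simp
    qed
  qed
  interpret ST: cring_over "P \<downharpoonright> S" T by (rule TO.cring_over_sub[OF S_subring TS])
  have "prime_chain (P \<downharpoonright> T) n (\<lambda>i. G i \<inter> T)"
    unfolding prime_chain_def
  proof (intro conjI allI impI)
    show "primeideal (G i \<inter> T) (P \<downharpoonright> T)" if "i \<le> n" for i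
      using ST.prime_full(5)[OF Gp[OF that]] by simp
    show "G i \<inter> T \<subset> G (Suc i) \<inter> T" if "i < n" for i
      using Gs[OF that] g[OF that] gT[OF that] by blast
  qed
  then have TC: "chain_between (P \<downharpoonright> T) n (?Q0 \<inter> T) (H k \<inter> T)"
    unfolding chain_between_def using G by blast
  have TC': "chain_between (P \<downharpoonright> adjoin_list P B (z0 # zs)) n (?Q0 \<inter> T) (H k \<inter> T)"
    using TC by (simp only: T_def)
  have genO: "cring_over P (BO.gen z0)"
    by (rule P.cring_overI[OF BO.gen_subring[OF z0P]])
  have genT: "BO.gen z0 \<subseteq> T" unfolding T_def using adjoin_list_subring(2)[OF genO, of zs] zsP by simp
  have "cring_over.alg_mod P (BO.gen z0) (?Q0 \<inter> T) x" if x: "x \<in> set zs" for x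
  proof -
    have "x \<in> Z" using x zs by simp
    then obtain c j where c: "c \<in> I j" "x = up_ring.monom P c j" using Zm by blast
    have "cring_over.alg_mod P (BO.gen z0) (?Q0 \<inter> T) x = cring_over.alg_mod P (BO.gen z0) ?Q0 x"
      using alg_mod_restrict[OF genO genT TO.subring_B] zT x by auto
    then show ?thesis using alg[OF c(1)] c(2) by simp
  qed
  from dimension_inequality_transcendental[OF BO zsP B_noeth[OF noeth] TC' this]
  obtain l where l: "n \<le> Suc l" "chain_between (P \<downharpoonright> B) l (?Q0 \<inter> T \<inter> B) (H k \<inter> T \<inter> B)" by blast
  have inT: "const a \<in> T \<inter> B" if "a \<in> carrier R" for a using that BT by (auto simp: B_def)
  have "{a \<in> carrier R. const a \<in> ?Q0 \<inter> T \<inter> B} = q" using Q0q inT by blast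
  moreover have "{a \<in> carrier R. const a \<in> H k \<inter> T \<inter> B} = Q" using contr[of k] inT by blast
  ultimately have qQ: "chain_between R l q Q" using chain_from_B[OF l(2)] by simp
  have z: "primeideal {\<zero>} R" by (rule R.zeroprimeideal)
  show ?thesis
  proof (cases "q = Q")
    case True
    then have "l = 0" using chain_between_strict[OF qQ] by blast
    then have "k < 2" using l(1) n(1) by simp
    moreover have "chain_between R (Suc (Suc 0)) {\<zero>} Q"
      by (intro chain_between_Suc[OF _ Q p(3)] chain_between_Suc[OF _ p(1,2)] chain_between_0 z)
    ultimately show ?thesis by (intro exI[of _ "Suc (Suc 0)"]) simp
  next
    case False
    have "{\<zero>} \<subset> q" using q0 q(2) y(2) by blast
    then have "chain_between R (Suc l) {\<zero>} Q" by (rule chain_between_Cons[OF qQ z])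
    \<comment> \<open>Here \<open>n = Suc k\<close> and \<open>n\<close> is at most
      \<open>Suc l\<close>, so \<open>k\<close> is at most \<open>l\<close>; the step from zero to
      \<open>q\<close> gives \<open>Suc l > k\<close>.\<close>
    then show ?thesis using n(2)[OF False] l(1) by (intro exI[of _ "Suc l"]) simp
  qed
qed

end

section \<open>Localization at a prime\<close>

lemma prime_chain_mono:
  assumes "prime_chain A n G" "i \<le> j" "j \<le> n"
  shows "G i \<subseteq> G j"
  using assms(2,3)
proof (induction j)
  case (Suc j)
  have "G j \<subset> G (Suc j)" using assms(1) Suc(3) by (simp add: prime_chain_def)
  then show ?case using Suc by (cases "i = Suc j") auto
qed simp

lemma (in cring_over) finsum_sub:
  assumes "finite F" "\<And>i. i \<in> F \<Longrightarrow> g i \<in> B"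
  shows "finsum (C \<downharpoonright> B) g F = finsum C g F"
  using assms
proof (induction F rule: finite_induct)
  case empty
  interpret BR: cring "C \<downharpoonright> B" by (rule cring_B)
  show ?case by (simp add: BR.finsum_empty[simplified])
next
  case (insert x F)
  interpret BR: cring "C \<downharpoonright> B" by (rule cring_B)
  have "g \<in> F \<rightarrow> carrier C" "g x \<in> carrier C" "g \<in> F \<rightarrow> carrier (C \<downharpoonright> B)" "g x \<in> carrier (C \<downharpoonright> B)"
    using insert by auto
  then show ?case
    using insert BR.finsum_insert[of F x g] finsum_insert[of F x g] by simp
qed

locale localization = field K for K (structure) +
  fixes R Q
  assumes subR: "subring R K" and Q: "primeideal Q (K \<downharpoonright> R)"
begin

sublocale RO: cring_over K R
  by (rule cring_overI[OF subR])

abbreviation "W \<equiv> R - Q"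

lemma W: "RO.mult_set W"
  by (rule RO.mult_set_prime[OF Q])

lemma W_inv:
  assumes "u \<in> W"
  shows "u \<in> carrier K" "u \<noteq> \<zero>" "inv u \<in> carrier K" "u \<otimes> inv u = \<one>"
proof -
  show uC: "u \<in> carrier K" using assms RO.B_in by blast
  show nz: "u \<noteq> \<zero>" using assms RO.submodD(3)[OF RO.primeD(2)[OF Q]] by blast
  then have "u \<in> Units K" using uC field_Units by simp
  then show "inv u \<in> carrier K" "u \<otimes> inv u = \<one>" by (rule Units_inv_closed, rule Units_r_inv)
qed

definition A where "A = localization_at K R Q"

text \<open>Inside the field K the localization is the saturation of R by the complement of
  \<open>Q\<close>. Extending an ideal likewise becomes saturating it, so the earlier lemmas
  apply.\<close>

lemma A_eq: "A = RO.sat W R"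
proof
  show "A \<subseteq> RO.sat W R"
  proof
    fix x assume "x \<in> A"
    then obtain a b where x: "x = a \<otimes> inv b" "a \<in> R" "b \<in> W" by (auto simp: A_def localization_at_def)
    note b = W_inv[OF x(3)]
    have "b \<otimes> x = a \<otimes> (b \<otimes> inv b)" unfolding x(1) using b(1,3) RO.B_in[OF x(2)] by algebra
    then have "b \<otimes> x \<in> R" using x(2) b(4) RO.B_in[OF x(2)] by simp
    moreover have "x \<in> carrier K" using x(1,2) b(3) by simp
    ultimately show "x \<in> RO.sat W R" using x(3) by (auto simp: RO.sat_def)
  qed
  show "RO.sat W R \<subseteq> A"
  proof
    fix x assume "x \<in> RO.sat W R"
    then obtain u where u: "x \<in> carrier K" "u \<in> W" "u \<otimes> x \<in> R" by (auto simp: RO.sat_def)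
    note i = W_inv[OF u(2)]
    have "x = x \<otimes> (u \<otimes> inv u)" using u i by simp
    also have "\<dots> = (u \<otimes> x) \<otimes> inv u" using u(1) i(1,3) by algebra
    finally show "x \<in> A" using u by (auto simp: A_def localization_at_def)
  qed
qed

lemma A_I: "x \<in> carrier K \<Longrightarrow> u \<in> W \<Longrightarrow> u \<otimes> x \<in> R \<Longrightarrow> x \<in> A"
  unfolding A_eq RO.sat_def by blast

lemma A_E:
  assumes "x \<in> A"
  obtains u where "x \<in> carrier K" "u \<in> W" "u \<otimes> x \<in> R"
  using assms unfolding A_eq RO.sat_def by blast

lemma sat_mult:
  assumes x: "x \<in> RO.sat W M" and y: "y \<in> RO.sat W N" and MN: "\<And>a b. a \<in> M \<Longrightarrow> b \<in> N \<Longrightarrow> a \<otimes> b \<in> T"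
  shows "x \<otimes> y \<in> RO.sat W T"
proof -
  obtain u where u: "x \<in> carrier K" "u \<in> W" "u \<otimes> x \<in> M" using x by (auto simp: RO.sat_def)
  obtain v where v: "y \<in> carrier K" "v \<in> W" "v \<otimes> y \<in> N" using y by (auto simp: RO.sat_def)
  have "(u \<otimes> v) \<otimes> (x \<otimes> y) = (u \<otimes> x) \<otimes> (v \<otimes> y)"
    using u(1) v(1) W_inv(1)[OF u(2)] W_inv(1)[OF v(2)] by algebra
  then have "(u \<otimes> v) \<otimes> (x \<otimes> y) \<in> T" using MN u(3) v(3) by simp
  then show ?thesis using RO.mult_setD(3)[OF W u(2) v(2)] u v by (auto simp: RO.sat_def)
qed

lemma R_A: "R \<subseteq> A"
  unfolding A_eq by (rule RO.sat_incl[OF W RO.B_carrier])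

lemma A_subring: "subring A K"
proof (rule subringI)
  note S = RO.submod_sat[OF W RO.submod_B, folded A_eq]
  show "A \<subseteq> carrier K" by (rule RO.submodD(1)[OF S])
  show "\<one> \<in> A" using R_A RO.B_one by blast
  show "\<ominus> x \<in> A" if "x \<in> A" for x using RO.submod_neg[OF S that] .
  show "x \<oplus> y \<in> A" if "x \<in> A" "y \<in> A" for x y using RO.submodD(4)[OF S that] .
  show "x \<otimes> y \<in> A" if "x \<in> A" "y \<in> A" for x y
    using sat_mult[of x R y R R] that RO.B_mult unfolding A_eq by blast
qed

sublocale AO: cring_over K A
  by (rule cring_overI[OF A_subring])

lemma AO_submod_sat:
  assumes J: "RO.submod J" "J \<subseteq> R"
  shows "AO.submod (RO.sat W J)" "RO.sat W J \<subseteq> A"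
proof -
  note S = RO.submod_sat[OF W J(1)]
  show "RO.sat W J \<subseteq> A" unfolding A_eq by (rule RO.sat_mono[OF J(2)])
  show "AO.submod (RO.sat W J)"
    unfolding AO.submod_def
  proof (intro conjI ballI)
    show "b \<otimes> x \<in> RO.sat W J" if "b \<in> A" "x \<in> RO.sat W J" for b x
      using sat_mult[of b R x J J] that RO.submodD(5)[OF J(1)] unfolding A_eq by blast
    show "RO.sat W J \<subseteq> carrier K" "\<zero> \<in> RO.sat W J" by (rule RO.submodD(1)[OF S], rule RO.submodD(3)[OF S])
    show "x \<oplus> y \<in> RO.sat W J" if "x \<in> RO.sat W J" "y \<in> RO.sat W J" for x y
      using RO.submodD(4)[OF S that] .
  qed
qed

lemma AO_down: "AO.submod J \<Longrightarrow> RO.submod J"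
  using R_A by (auto simp: AO.submod_def RO.submod_def)

lemma unit_ideal:
  assumes J: "AO.submod J" and u: "u \<in> W" "u \<in> J"
  shows "\<one> \<in> J"
proof -
  note i = W_inv[OF u(1)]
  have "inv u \<in> A" by (rule A_I[OF i(3) u(1)]) (simp add: i(4))
  then have "inv u \<otimes> u \<in> J" using AO.submodD(5)[OF J _ u(2)] by blast
  then show ?thesis using i m_comm[OF i(3,1)] by simp
qed

lemma proper_ideal_le:
  assumes J: "AO.submod J" "J \<subseteq> A" "\<one> \<notin> J"
  shows "J \<subseteq> RO.sat W Q" "J \<inter> R \<subseteq> Q"
proof -
  show JQ: "J \<inter> R \<subseteq> Q"
  proof
    fix u assume "u \<in> J \<inter> R"
    then show "u \<in> Q" using unit_ideal[OF J(1), of u] J(3) by auto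
  qed
  show "J \<subseteq> RO.sat W Q"
  proof
    fix x assume x: "x \<in> J"
    then have "x \<in> A" using J(2) by blast
    then obtain u where u: "x \<in> carrier K" "u \<in> W" "u \<otimes> x \<in> R" by (rule A_E)
    have "u \<in> R" using u(2) by blast
    then have "u \<otimes> x \<in> J" using RO.submodD(5)[OF AO_down[OF J(1)] _ x] by blast
    then show "x \<in> RO.sat W Q" using JQ u unfolding RO.sat_def by blast
  qed
qed

lemma sat_prime:
  assumes p: "primeideal p (K \<downharpoonright> R)" "p \<subseteq> Q"
  shows "primeideal (RO.sat W p) (K \<downharpoonright> A)" "RO.sat W p \<inter> R = p"
proof -
  note pD = RO.primeD[OF p(1)]
  show *: "RO.sat W p \<inter> R = p"
  proof
    show "p \<subseteq> RO.sat W p \<inter> R" using RO.sat_incl[OF W RO.submodD(1)[OF pD(2)]] pD(1) by blast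
    show "RO.sat W p \<inter> R \<subseteq> p" using pD(5) p(2) by (fastforce simp: RO.sat_def)
  qed
  show "primeideal (RO.sat W p) (K \<downharpoonright> A)"
    unfolding AO.prime_iff
  proof (intro conjI ballI impI)
    show "RO.sat W p \<subseteq> A" "AO.submod (RO.sat W p)" using AO_submod_sat[OF pD(2,1)] by auto
    show "\<one> \<notin> RO.sat W p" using * pD(3) RO.B_one by blast
    fix x y assume xy: "x \<in> A" "y \<in> A" "x \<otimes> y \<in> RO.sat W p"
    obtain u where u: "x \<in> carrier K" "u \<in> W" "u \<otimes> x \<in> R" using A_E[OF xy(1)] .
    obtain v where v: "y \<in> carrier K" "v \<in> W" "v \<otimes> y \<in> R" using A_E[OF xy(2)] .
    obtain w where w: "w \<in> W" "w \<otimes> (x \<otimes> y) \<in> p" using xy(3) by (auto simp: RO.sat_def)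
    note c = W_inv(1)[OF u(2)] W_inv(1)[OF v(2)] W_inv(1)[OF w(1)]
    have "w \<otimes> ((u \<otimes> x) \<otimes> (v \<otimes> y)) = (u \<otimes> v) \<otimes> (w \<otimes> (x \<otimes> y))" using u(1) v(1) c by algebra
    also have "\<dots> \<in> p" using RO.submodD(5)[OF pD(2) RO.B_mult w(2)] u v by blast
    finally have "(u \<otimes> x) \<otimes> (v \<otimes> y) \<in> p"
      using pD(5)[of w "(u \<otimes> x) \<otimes> (v \<otimes> y)"] w p(2) RO.B_mult[OF u(3) v(3)] by blast
    then have "u \<otimes> x \<in> p \<or> v \<otimes> y \<in> p" using pD(5) u v by blast
    then show "x \<in> RO.sat W p \<or> y \<in> RO.sat W p" using u v unfolding RO.sat_def by blast
  qed
qed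

lemma max_ideal_eq: "max_ideal (K \<downharpoonright> A) = RO.sat W Q"
proof -
  let ?M = "RO.sat W Q"
  interpret AR: cring "K \<downharpoonright> A" by (rule AO.cring_B)
  note Mp = sat_prime(1)[OF Q subset_refl]
  note MD = AO.primeD[OF Mp]
  have max: "J \<subseteq> ?M" if J: "ideal J (K \<downharpoonright> A)" "J \<noteq> A" for J
  proof (rule proper_ideal_le)
    show "AO.submod J" "J \<subseteq> A" using J AO.ideal_iff by auto
    show "\<one> \<notin> J" using ideal.one_imp_carrier[OF J(1)] J(2) by auto
  qed
  have "maximalideal ?M (K \<downharpoonright> A)"
  proof (rule maximalidealI)
    show "ideal ?M (K \<downharpoonright> A)" using Mp by (rule primeideal.axioms(1))
    show "carrier (K \<downharpoonright> A) \<noteq> ?M" using MD(3) AO.B_one by auto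
    show "J = ?M \<or> J = carrier (K \<downharpoonright> A)"
      if "ideal J (K \<downharpoonright> A)" "?M \<subseteq> J" "J \<subseteq> carrier (K \<downharpoonright> A)" for J
      using max[OF that(1)] that(2) by auto
  qed
  moreover have "m = ?M" if "maximalideal m (K \<downharpoonright> A)" for m
  proof -
    interpret m: maximalideal m "K \<downharpoonright> A" by fact
    have "m \<subseteq> ?M" using max[OF m.is_ideal] m.I_notcarr by auto
    then have "?M = m \<or> ?M = carrier (K \<downharpoonright> A)"
      using m.I_maximal[OF primeideal.axioms(1)[OF Mp]] MD(1) by simp
    moreover have "?M \<noteq> carrier (K \<downharpoonright> A)" by (rule not_sym) (rule primeideal.I_notcarr[OF Mp])
    ultimately show ?thesis by blast
  qed
  ultimately show ?thesis unfolding max_ideal_def by (rule the_equality)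
qed

lemma chain_push:
  assumes "chain_between (K \<downharpoonright> R) m p Q"
  shows "enat m \<le> krull_dim (K \<downharpoonright> A)"
proof -
  obtain G where G: "prime_chain (K \<downharpoonright> R) m G" "G m = Q" using assms by (auto simp: chain_between_def)
  have GQ: "primeideal (G i) (K \<downharpoonright> R)" "G i \<subseteq> Q" if "i \<le> m" for i
    using G(1) that prime_chain_mono[OF G(1) that] G(2) by (auto simp: prime_chain_def)
  have "prime_chain (K \<downharpoonright> A) m (\<lambda>i. RO.sat W (G i))"
    unfolding prime_chain_def
  proof (intro conjI allI impI)
    show "primeideal (RO.sat W (G i)) (K \<downharpoonright> A)" if "i \<le> m" for i using sat_prime(1) GQ that by blast
    fix i assume i: "i < m"
    then have st: "G i \<subset> G (Suc i)" using G(1) by (simp add: prime_chain_def)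
    then have "RO.sat W (G i) \<subseteq> RO.sat W (G (Suc i))" by (intro RO.sat_mono) blast
    moreover have "RO.sat W (G i) \<noteq> RO.sat W (G (Suc i))"
      using sat_prime(2)[OF GQ, of i] sat_prime(2)[OF GQ, of "Suc i"] i st by auto
    ultimately show "RO.sat W (G i) \<subset> RO.sat W (G (Suc i))" by blast
  qed
  then show ?thesis unfolding krull_dim_def by (intro Sup_upper) blast
qed

lemma finite_dim:
  assumes noeth: "noetherian_ring (K \<downharpoonright> R)"
  obtains N where "krull_dim (K \<downharpoonright> A) \<le> enat N"
proof -
  obtain N where N: "\<And>n P. prime_chain (K \<downharpoonright> R) n P \<Longrightarrow> P n = Q \<Longrightarrow> n \<le> N"
    using RO.finite_height[OF noeth Q] by blast
  interpret RA: cring_over "K \<downharpoonright> A" R by (rule RO.cring_over_sub[OF A_subring R_A])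
  have "n \<le> N" if H: "prime_chain (K \<downharpoonright> A) n H" for n H
  proof -
    have Hp: "primeideal (H i) (K \<downharpoonright> A)" if "i \<le> n" for i using H that by (simp add: prime_chain_def)
    have Hs: "H i \<subset> H (Suc i)" if "i < n" for i using H that by (simp add: prime_chain_def)
    have ch: "chain_between (K \<downharpoonright> R) n (H 0 \<inter> R) (H n \<inter> R)"
    proof -
      have "prime_chain (K \<downharpoonright> R) n (\<lambda>i. H i \<inter> R)"
        unfolding prime_chain_def
      proof (intro conjI allI impI)
        show "primeideal (H i \<inter> R) (K \<downharpoonright> R)" if "i \<le> n" for i
          using RA.prime_full(5)[OF Hp[OF that]] by simp
        fix i assume i: "i < n"
        obtain x where x: "x \<in> H (Suc i)" "x \<notin> H i" using Hs[OF i] by blast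
        note D = AO.primeD[OF Hp[of "Suc i"]] and D' = AO.primeD[OF Hp[of i]]
        have xA: "x \<in> A" using D(4) x i by auto
        then obtain u where u: "u \<in> W" "u \<otimes> x \<in> R" using A_E by blast
        have uA: "u \<in> A" using u R_A by blast
        \<comment> \<open>Clearing the denominator moves the separating element into R;
          \<open>u\<close> is a unit of the localization and hence outside every prime
          there.\<close>
        have "u \<otimes> x \<in> H (Suc i)" using AO.submodD(5)[OF D(2) uA x(1)] i by simp
        moreover have "u \<otimes> x \<notin> H i"
          using D'(5)[OF _ uA xA] x(2) unit_ideal[OF D'(2) u(1)] D'(3) i by auto
        ultimately show "H i \<inter> R \<subset> H (Suc i) \<inter> R" using Hs[OF i] u by blast
      qed
      then show ?thesis unfolding chain_between_def by blast
    qed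
    have HQ: "H n \<inter> R \<subseteq> Q" using proper_ideal_le(2) AO.primeD(1-3)[OF Hp[of n]] by blast
    \<comment> \<open>The contracted chain may end strictly inside \<open>Q\<close>. Appending
      \<open>Q\<close> makes the bound for chains ending at \<open>Q\<close> applicable.\<close>
    have "\<exists>m\<ge>n. chain_between (K \<downharpoonright> R) m (H 0 \<inter> R) Q"
    proof (cases "H n \<inter> R = Q")
      case True
      then show ?thesis using ch by auto
    next
      case False
      then have "chain_between (K \<downharpoonright> R) (Suc n) (H 0 \<inter> R) Q"
        using chain_between_Suc[OF ch Q] HQ by blast
      then show ?thesis using le_SucI by blast
    qed
    then show ?thesis using N unfolding chain_between_def by fastforce
  qed
  then show ?thesis by (intro that[of N]) (auto simp: krull_dim_def intro!: Sup_least)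
qed

end

section \<open>Rees rings and localization\<close>

lemma carrier_UP: "carrier (UP S) = up S"
  by (simp add: UP_def)

lemma coeff_UP: "f \<in> up S \<Longrightarrow> up_ring.coeff (UP S) f n = f n"
  by (simp add: UP_def)

lemma mult_UP: "f \<in> up S \<Longrightarrow> g \<in> up S \<Longrightarrow>
    f \<otimes>\<^bsub>UP S\<^esub> g = (\<lambda>n. finsum S (\<lambda>i. f i \<otimes>\<^bsub>S\<^esub> g (n - i)) {..n})"
  by (simp add: UP_def)

lemma add_UP: "f \<in> up S \<Longrightarrow> g \<in> up S \<Longrightarrow> f \<oplus>\<^bsub>UP S\<^esub> g = (\<lambda>n. f n \<oplus>\<^bsub>S\<^esub> g n)"
  by (simp add: UP_def)

lemma monom_UP: "a \<in> carrier S \<Longrightarrow> up_ring.monom (UP S) a n = (\<lambda>i. if i = n then a else \<zero>\<^bsub>S\<^esub>)"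
  by (simp add: UP_def)

lemma up_iff: "f \<in> up S \<longleftrightarrow> (\<forall>n. f n \<in> carrier S) \<and> (\<exists>n. bound \<zero>\<^bsub>S\<^esub> n f)"
  by (auto simp: up_def)

context cring_over
begin

lemma up_sub: "f \<in> up (C \<downharpoonright> B) \<Longrightarrow> f \<in> up C"
  by (auto simp: up_iff)

text \<open>Polynomials over both rings are functions with the same values, so the Rees ring of R is
  literally contained in that of its localization, and contraction of primes is
  intersection.\<close>

lemma mult_UP_sub:
  assumes "f \<in> up (C \<downharpoonright> B)" "g \<in> up (C \<downharpoonright> B)"
  shows "f \<otimes>\<^bsub>UP (C \<downharpoonright> B)\<^esub> g = f \<otimes>\<^bsub>UP C\<^esub> g"
proof
  fix n
  have fg: "f i \<in> B" "g i \<in> B" for i using assms by (auto simp: up_iff)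
  have "finsum (C \<downharpoonright> B) (\<lambda>i. f i \<otimes> g (n - i)) {..n} = finsum C (\<lambda>i. f i \<otimes> g (n - i)) {..n}"
    using fg B_mult by (intro finsum_sub) auto
  then show "(f \<otimes>\<^bsub>UP (C \<downharpoonright> B)\<^esub> g) n = (f \<otimes>\<^bsub>UP C\<^esub> g) n"
    using mult_UP[OF assms] mult_UP[OF up_sub[OF assms(1)] up_sub[OF assms(2)]] by simp
qed

end

lemma (in rees) quotient_chain:
  assumes M: "M \<subseteq> carrier R"
    and chain: "prime_chain ((P \<downharpoonright> S) Quot (Idl\<^bsub>P \<downharpoonright> S\<^esub> (const ` M))) n H"
  shows "\<exists>G. prime_chain (P \<downharpoonright> S) n G \<and> (\<forall>i\<le>n. const ` M \<subseteq> G i)"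
proof -
  let ?A = "P \<downharpoonright> S" and ?J = "Idl\<^bsub>P \<downharpoonright> S\<^esub> (const ` M)"
  interpret A: cring ?A by (rule SO.cring_B)
  have MS: "const ` M \<subseteq> carrier ?A" using M const_S by auto
  interpret J: ideal ?J ?A by (rule A.genideal_ideal[OF MS])
  let ?h = "(+>\<^bsub>?A\<^esub>) ?J"
  have surj: "?h ` carrier ?A = carrier (?A Quot ?J)"
    by (auto simp: FactRing_def A_RCOSETS_def')
  let ?G = "\<lambda>i. {r \<in> carrier ?A. ?h r \<in> H i}"
  have "prime_chain ?A n ?G"
    by (rule prime_chain_vimage[OF J.rcos_ring_hom_ring surj A.is_cring chain])
  moreover have "const ` M \<subseteq> ?G i" if i: "i \<le> n" for i
  proof
    fix x assume x: "x \<in> const ` M"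
    then have xJ: "x \<in> ?J" using A.genideal_self[OF MS] by blast
    have "primeideal (H i) (?A Quot ?J)" using chain i by (simp add: prime_chain_def)
    then have "\<zero>\<^bsub>?A Quot ?J\<^esub> \<in> H i"
      by (intro additive_subgroup.zero_closed ideal.axioms(1) primeideal.axioms(1))
    moreover have "?h x = \<zero>\<^bsub>?A Quot ?J\<^esub>"
      using J.a_rcos_const[OF xJ] by (simp add: FactRing_def)
    ultimately show "x \<in> ?G i" using x MS by auto
  qed
  ultimately show ?thesis by blast
qed

context localization
begin

context
  fixes I assumes filt: "filtration (K \<downharpoonright> R) I"
begin

abbreviation "I' \<equiv> localized_filtration K R Q I"

lemma I_sub: "RO.submod (I n)" "I n \<subseteq> R"
  using filt RO.ideal_iff by (auto simp: filtration_def)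

text \<open>Every element of the extended ideal has a single denominator, and the elements of the
  complement of \<open>Q\<close> have their inverses in the localization.\<close>

lemma I'_eq: "I' n = RO.sat W (I n)"
proof -
  interpret AR: cring "K \<downharpoonright> A" by (rule AO.cring_B)
  note S = AO_submod_sat[OF I_sub, of n]
  have sub: "I n \<subseteq> RO.sat W (I n)" by (rule RO.sat_incl[OF W RO.submodD(1)[OF I_sub(1)]])
  have IA: "I n \<subseteq> carrier (K \<downharpoonright> A)" using sub S(2) by simp
  have eq: "I' n = Idl\<^bsub>K \<downharpoonright> A\<^esub> (I n)" by (simp add: localized_filtration_def A_def)
  show ?thesis
  proof
    show "I' n \<subseteq> RO.sat W (I n)"
      unfolding eq using AR.genideal_minimal[OF _ sub] S AO.ideal_iff by blast
    have "ideal (I' n) (K \<downharpoonright> A)" unfolding eq by (rule AR.genideal_ideal[OF IA])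
    then have I': "AO.submod (I' n)" using AO.ideal_iff by blast
    show "RO.sat W (I n) \<subseteq> I' n"
    proof
      fix x assume "x \<in> RO.sat W (I n)"
      then obtain u where u: "x \<in> carrier K" "u \<in> W" "u \<otimes> x \<in> I n" by (auto simp: RO.sat_def)
      note i = W_inv[OF u(2)]
      have "inv u \<in> A" by (rule A_I[OF i(3) u(2)]) (simp add: i(4))
      moreover have "u \<otimes> x \<in> I' n" using AR.genideal_self[OF IA] u(3) unfolding eq by blast
      ultimately have "inv u \<otimes> (u \<otimes> x) \<in> I' n" using AO.submodD(5)[OF I'] by blast
      moreover have "inv u \<otimes> (u \<otimes> x) = (u \<otimes> inv u) \<otimes> x" using u(1) i(1,3) by algebra
      ultimately show "x \<in> I' n" using i(4) u(1) by simp
    qed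
  qed
qed

lemma filt': "filtration (K \<downharpoonright> A) I'"
  unfolding filtration_def
proof (intro conjI allI)
  note S = AO_submod_sat[OF I_sub, folded I'_eq]
  show "ideal (I' n) (K \<downharpoonright> A)" for n using S AO.ideal_iff by blast
  show "I' 0 = carrier (K \<downharpoonright> A)" using filt by (simp add: I'_eq A_eq filtration_def)
  show "I' (Suc n) \<subseteq> I' n" for n
    unfolding I'_eq by (rule RO.sat_mono) (use filt in \<open>simp add: filtration_def\<close>)
  fix i j
  have mult: "a \<otimes> b \<in> I (i + j)" if "a \<in> I i" "b \<in> I j" for a b
  proof -
    have "a \<otimes> b \<in> I i \<cdot>\<^bsub>K \<downharpoonright> R\<^esub> I j" using ideal_prod.prod[OF that, of "K \<downharpoonright> R"] by simp
    then show ?thesis using filt unfolding filtration_def by blast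
  qed
  show "I' i \<cdot>\<^bsub>K \<downharpoonright> A\<^esub> I' j \<subseteq> I' (i + j)"
  proof
    fix x assume "x \<in> I' i \<cdot>\<^bsub>K \<downharpoonright> A\<^esub> I' j"
    then show "x \<in> I' (i + j)"
    proof (induction rule: ideal_prod.induct)
      case (prod a b)
      then show ?case using sat_mult[of a "I i" b "I j"] mult by (simp add: I'_eq)
    next
      case (sum a b)
      then show ?case using AO.submodD(4)[OF S(1)] by simp
    qed
  qed
qed

lemma domains: "domain (K \<downharpoonright> R)" "domain (K \<downharpoonright> A)"
  using subring_is_domain[OF subR] subring_is_domain[OF A_subring] by auto

lemma rees_R: "rees (K \<downharpoonright> R) I" and rees_A: "rees (K \<downharpoonright> A) I'"
  by (intro rees.intro rees_axioms.intro UP_domain.intro domains filt filt')+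

text \<open>Needed for polynomials: one factor has to clear the denominators of all coefficients at
  once.\<close>

lemma common_denominator:
  fixes x :: "nat \<Rightarrow> 'a"
  assumes "\<And>n. n < N \<Longrightarrow> x n \<in> I' n"
  shows "\<exists>u\<in>W. \<forall>n<N. u \<otimes> x n \<in> I n"
  using assms
proof (induction N)
  case 0
  show ?case using RO.mult_setD(2)[OF W] by (intro bexI[of _ \<one>]) simp_all
next
  case (Suc N)
  then obtain u where u: "u \<in> W" "\<forall>n<N. u \<otimes> x n \<in> I n" by fastforce
  have "x N \<in> I' N" using Suc(2) by simp
  then obtain v where v: "v \<in> W" "v \<otimes> x N \<in> I N" unfolding I'_eq RO.sat_def by blast
  have "(u \<otimes> v) \<otimes> x n \<in> I n" if n: "n < Suc N" for n
  proof -
    have xC: "x n \<in> carrier K" using Suc(2)[OF n] unfolding I'_eq RO.sat_def by blast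
    note c = W_inv(1)[OF u(1)] W_inv(1)[OF v(1)]
    have uv: "u \<in> R" "v \<in> R" using u v by auto
    show ?thesis
    proof (cases "n = N")
      case True
      have "(u \<otimes> v) \<otimes> x n = u \<otimes> (v \<otimes> x n)" using c xC by algebra
      then show ?thesis using RO.submodD(5)[OF I_sub(1) uv(1) v(2)] True by simp
    next
      case False
      then have "u \<otimes> x n \<in> I n" using u(2) n by simp
      moreover have "(u \<otimes> v) \<otimes> x n = v \<otimes> (u \<otimes> x n)" using c xC by algebra
      ultimately show ?thesis using RO.submodD(5)[OF I_sub(1) uv(2)] by simp
    qed
  qed
  then show ?case using RO.mult_setD(3)[OF W u(1) v(1)] by blast
qed

text \<open>Primes of the fibre pull back to primes containing the maximal ideal as constants.
  Intersected with the smaller Rees ring they contract to exactly \<open>Q\<close>: it is contained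
  by this, and elements outside \<open>Q\<close> are units.\<close>

lemma fibre_chain_contract:
  assumes "prime_chain (rees_ring (K \<downharpoonright> A) I' Quot (Idl\<^bsub>rees_ring (K \<downharpoonright> A) I'\<^esub>
    ((\<lambda>a. up_ring.monom (UP (K \<downharpoonright> A)) a 0) ` max_ideal (K \<downharpoonright> A)))) n H"
  shows "\<exists>G. prime_chain (rees_ring (K \<downharpoonright> R) I) n G \<and>
    (\<forall>i\<le>n. {a \<in> R. up_ring.monom (UP (K \<downharpoonright> R)) a 0 \<in> G i} = Q)"
proof -
  let ?KR = "K \<downharpoonright> R" and ?KA = "K \<downharpoonright> A"
  interpret R1: rees ?KR "UP ?KR" I by (rule rees_R)
  interpret R2: rees ?KA "UP ?KA" I' by (rule rees_A)
  let ?S1 = "R1.S" and ?S2 = "R2.S"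
  interpret AR: cring_over ?KA R by (rule RO.cring_over_sub[OF A_subring R_A])
  have MA: "max_ideal ?KA \<subseteq> carrier ?KA"
    unfolding max_ideal_eq using AO.primeD(1)[OF sat_prime(1)[OF Q subset_refl]] by simp
  obtain F where F: "prime_chain (UP ?KA \<downharpoonright> ?S2) n F"
    and FM: "\<And>i. i \<le> n \<Longrightarrow> R2.const ` max_ideal ?KA \<subseteq> F i"
    using R2.quotient_chain[OF MA] assms unfolding R2.rees_eq by blast
  have Fp: "primeideal (F i) (UP ?KA \<downharpoonright> ?S2)" if "i \<le> n" for i using F that by (simp add: prime_chain_def)
  have Fs: "F i \<subset> F (Suc i)" if "i < n" for i using F that by (simp add: prime_chain_def)
  have upRA: "f \<in> up ?KA" if "f \<in> up ?KR" for f
    using AR.up_sub[of f] that by simp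
  have S1: "f \<in> ?S1 \<longleftrightarrow> f \<in> up ?KR \<and> (\<forall>k. f k \<in> I k)" for f
    unfolding R1.S_def carrier_UP using coeff_UP[of f ?KR] by auto
  have S2: "f \<in> ?S2 \<longleftrightarrow> f \<in> up ?KA \<and> (\<forall>k. f k \<in> I' k)" for f
    unfolding R2.S_def carrier_UP using coeff_UP[of f ?KA] by auto
  have II': "I k \<subseteq> I' k" for k
    unfolding I'_eq by (rule RO.sat_incl[OF W RO.submodD(1)[OF I_sub(1)]])
  have S12: "f \<in> ?S2" if "f \<in> ?S1" for f
    using that upRA II' unfolding S1 S2 by blast
  have mult: "f \<otimes>\<^bsub>UP ?KR\<^esub> g = f \<otimes>\<^bsub>UP ?KA\<^esub> g" if "f \<in> ?S1" "g \<in> ?S1" for f g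
    using AR.mult_UP_sub[of f g] that unfolding S1 by simp
  have add: "f \<oplus>\<^bsub>UP ?KR\<^esub> g = f \<oplus>\<^bsub>UP ?KA\<^esub> g" if "f \<in> ?S1" "g \<in> ?S1" for f g
    using add_UP[of f ?KR g] add_UP[of f ?KA g] upRA that unfolding S1 by simp
  have const: "R1.const a = R2.const a" if "a \<in> R" for a
  proof -
    have "a \<in> carrier ?KR" "a \<in> carrier ?KA" using that R_A by auto
    then show ?thesis by (simp only: monom_UP) (simp add: fun_eq_iff)
  qed
  have one: "\<one>\<^bsub>UP ?KR\<^esub> = \<one>\<^bsub>UP ?KA\<^esub>" and zero: "\<zero>\<^bsub>UP ?KR\<^esub> = \<zero>\<^bsub>UP ?KA\<^esub>"
    by (simp_all add: UP_def fun_eq_iff)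
  have oneA: "\<one>\<^bsub>?KA\<^esub> = \<one>" by simp
  have unit: "R2.const u \<in> ?S2" "R2.const u \<notin> F i" if u: "u \<in> W" and i: "i \<le> n" for u i
  proof -
    note v = W_inv[OF u]
    have uA: "u \<in> carrier ?KA" using u R_A by auto
    have vA: "inv u \<in> carrier ?KA" using A_I[OF v(3) u] v(4) RO.B_one by simp
    show "R2.const u \<in> ?S2" by (rule R2.const_S[OF uA])
    have "R2.const (inv u) \<otimes>\<^bsub>UP ?KA\<^esub> R2.const u = R2.const (inv u \<otimes> u)"
      using R2.monom_mult[OF vA uA, of 0 0] by simp
    also have "inv u \<otimes> u = \<one>" using v m_comm[OF v(3,1)] by simp
    finally have eq: "R2.const (inv u) \<otimes>\<^bsub>UP ?KA\<^esub> R2.const u = \<one>\<^bsub>UP ?KA\<^esub>"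
      by (simp only: R2.monom_one[unfolded oneA])
    show "R2.const u \<notin> F i"
    proof
      assume "R2.const u \<in> F i"
      then have "\<one>\<^bsub>UP ?KA\<^esub> \<in> F i"
        using R2.SO.submodD(5)[OF R2.SO.primeD(2)[OF Fp[OF i]] R2.const_S[OF vA]] eq by metis
      then show False using R2.SO.primeD(3)[OF Fp[OF i]] by blast
    qed
  qed
  define G where "G i = F i \<inter> ?S1" for i
  have "prime_chain (UP ?KR \<downharpoonright> ?S1) n G"
    unfolding prime_chain_def
  proof (intro conjI allI impI)
    fix i assume i: "i \<le> n"
    note D = R2.SO.primeD[OF Fp[OF i]] and ss = R2.SO.submodD[OF R2.SO.primeD(2)[OF Fp[OF i]]]
    note s1 = R1.SO.submodD[OF R1.SO.submod_B]
    show "primeideal (G i) (UP ?KR \<downharpoonright> ?S1)"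
      unfolding R1.SO.prime_iff R1.SO.submod_def
    proof (intro conjI ballI impI)
      show "G i \<subseteq> ?S1" "G i \<subseteq> carrier (UP ?KR)" using s1(1) unfolding G_def by blast+
      show "\<zero>\<^bsub>UP ?KR\<^esub> \<in> G i" using s1(3) ss(3) zero unfolding G_def by simp
      show "x \<oplus>\<^bsub>UP ?KR\<^esub> y \<in> G i" if "x \<in> G i" "y \<in> G i" for x y
        using that add[of x y] s1(4)[of x y] ss(4)[of x y] unfolding G_def by simp
      show "b \<otimes>\<^bsub>UP ?KR\<^esub> x \<in> G i" if "b \<in> ?S1" "x \<in> G i" for b x
        using that mult[of b x] s1(5)[of b x] ss(5)[OF S12, of b x] unfolding G_def by simp
      show "\<one>\<^bsub>UP ?KR\<^esub> \<notin> G i" using D(3) one unfolding G_def by simp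
      show "a \<in> G i \<or> b \<in> G i" if "a \<in> ?S1" "b \<in> ?S1" "a \<otimes>\<^bsub>UP ?KR\<^esub> b \<in> G i" for a b
        using that mult[of a b] D(5)[OF S12 S12, of a b] unfolding G_def by simp
    qed
  next
    fix i assume i: "i < n"
    obtain x where x: "x \<in> F (Suc i)" "x \<notin> F i" using Fs[OF i] by blast
    have i': "Suc i \<le> n" "i \<le> n" using i by auto
    have xS: "x \<in> ?S2" using R2.SO.primeD(4)[OF Fp[OF i'(1)] x(1)] .
    then have xu: "x \<in> up ?KA" "\<And>k. x k \<in> I' k" unfolding S2 by auto
    then obtain N where N: "bound \<zero> N x" by (auto simp: up_iff)
    obtain u where u: "u \<in> W" "\<forall>k<Suc N. u \<otimes> x k \<in> I k" using common_denominator[of "Suc N" x] xu(2) by blast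
    \<comment> \<open>The separating element multiplied by a unit constant lies in the smaller Rees
      ring and still separates.\<close>
    define y where "y = R2.const u \<otimes>\<^bsub>UP ?KA\<^esub> x"
    have uA: "u \<in> carrier ?KA" using u(1) R_A by auto
    have uR: "u \<in> R" and uC: "u \<in> carrier K" using u(1) W_inv(1)[OF u(1)] by auto
    have xc: "x \<in> carrier (UP ?KA)" using xu(1) by (simp only: carrier_UP)
    have yc: "y \<in> carrier (UP ?KA)" unfolding y_def using uA xc by simp
    have yk: "y k = u \<otimes> x k" for k
    proof -
      have "y = u \<odot>\<^bsub>UP ?KA\<^esub> x" unfolding y_def by (rule R2.monom_mult_is_smult[OF uA xc])
      then show ?thesis
        using R2.coeff_smult[OF uA xc, of k] coeff_UP[OF xu(1), of k] coeff_UP[of y ?KA k] yc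
        by (simp add: carrier_UP)
    qed
    have x0: "x k = \<zero>" if "N < k" for k using bound.bound[OF N that] .
    have yI: "y k \<in> I k" for k
    proof (cases "k < Suc N")
      case False
      then show ?thesis using x0[of k] uC RO.submodD(3)[OF I_sub(1)] by (simp add: yk)
    qed (use u(2) in \<open>simp add: yk\<close>)
    have "bound \<zero> N y" by (rule bound.intro) (use x0 uC in \<open>simp add: yk\<close>)
    then have "y \<in> up ?KR" using yI I_sub(2) unfolding up_iff by auto
    then have yS: "y \<in> ?S1" using yI unfolding S1 by blast
    have "y \<in> F (Suc i)"
      unfolding y_def
      by (rule R2.SO.submodD(5)[OF R2.SO.primeD(2)[OF Fp[OF i'(1)]] unit(1)[OF u(1) i'(1)] x(1)])
    moreover have "y \<notin> F i"
      using R2.SO.primeD(5)[OF Fp[OF i'(2)] unit(1)[OF u(1) i'(2)] xS] x(2) unit(2)[OF u(1) i'(2)]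
      unfolding y_def by blast
    ultimately show "G i \<subset> G (Suc i)" using yS Fs[OF i] unfolding G_def by blast
  qed
  moreover have "{a \<in> R. R1.const a \<in> G i} = Q" if i: "i \<le> n" for i
  proof
    show "{a \<in> R. R1.const a \<in> G i} \<subseteq> Q"
    proof
      fix a assume a: "a \<in> {a \<in> R. R1.const a \<in> G i}"
      then have "R2.const a \<in> F i" using const[of a] unfolding G_def by simp
      then show "a \<in> Q" using unit(2)[of a i] i a by blast
    qed
    show "Q \<subseteq> {a \<in> R. R1.const a \<in> G i}"
    proof
      fix a assume a: "a \<in> Q"
      have aR: "a \<in> R" using RO.primeD(4)[OF Q a] .
      have "a \<in> max_ideal ?KA" unfolding max_ideal_eq using sat_prime(2)[OF Q subset_refl] a by blast
      then have "R1.const a \<in> F i" using FM[OF i] const[OF aR] by auto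
      moreover have "R1.const a \<in> ?S1" using R1.const_S aR by simp
      ultimately show "a \<in> {a \<in> R. R1.const a \<in> G i}" using aR unfolding G_def by blast
    qed
  qed
  ultimately show ?thesis unfolding R1.rees_eq by blast
qed

end

end

section \<open>Dimension of quotients and prime avoidance\<close>

text \<open>Primes of the quotient correspond to primes containing \<open>J\<close>. For the second
  part, a finite supremum of lengths is attained once there is some chain at all, which primeness of
  \<open>J\<close> provides.\<close>

lemma krull_dim_quotient:
  assumes cr: "cring S" and J: "ideal J S" and dim: "krull_dim (S Quot J) = enat s"
  shows "prime_chain S n G \<Longrightarrow> J \<subseteq> G 0 \<Longrightarrow> n \<le> s"
    and "primeideal J S \<Longrightarrow> \<exists>G. prime_chain S s G \<and> J \<subseteq> G 0"
proof -
  interpret cring S by fact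
  interpret J: ideal J S by fact
  let ?h = "(+>\<^bsub>S\<^esub>) J"
  have QC: "cring (S Quot J)" by (rule J.quotient_is_cring) fact
  interpret QR: cring "S Quot J" by (rule QC)
  interpret h: ring_hom_ring S "S Quot J" ?h by (rule J.rcos_ring_hom_ring)
  have surj: "?h ` carrier S = carrier (S Quot J)"
    unfolding FactRing_def A_RCOSETS_def' by auto
  \<comment> \<open>An ideal containing \<open>J\<close> is a union of cosets of \<open>J\<close>;
    this makes the image of a prime prime again and keeps inclusions strict.\<close>
  have mem: "x \<in> P" if "x \<in> carrier S" "ideal P S" "J \<subseteq> P" "?h x \<in> ?h ` P" for x P
  proof -
    interpret P: ideal P S by fact
    obtain z where z: "z \<in> P" "?h x = ?h z" using \<open>?h x \<in> ?h ` P\<close> by blast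
    have zC: "z \<in> carrier S" using P.Icarr[OF z(1)] .
    have "x \<ominus>\<^bsub>S\<^esub> z \<in> P"
      using z(2) quotient_eq_iff_same_a_r_cos[OF J that(1) zC] \<open>J \<subseteq> P\<close> by blast
    then have "(x \<ominus>\<^bsub>S\<^esub> z) \<oplus>\<^bsub>S\<^esub> z \<in> P" using z(1) by (rule P.a_closed)
    moreover have "(x \<ominus>\<^bsub>S\<^esub> z) \<oplus>\<^bsub>S\<^esub> z = x" using that(1) zC by algebra
    ultimately show ?thesis by simp
  qed
  have push: "primeideal (?h ` P) (S Quot J)" if P: "primeideal P S" "J \<subseteq> P" for P
  proof -
    interpret P: primeideal P S by fact
    show ?thesis
    proof (rule primeidealI[OF ring_ideal_imp_quot_ideal[OF J P.is_ideal] QC])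
      have "\<one>\<^bsub>S\<^esub> \<notin> P" using P.I_notcarr P.one_imp_carrier by auto
      then have "?h \<one>\<^bsub>S\<^esub> \<notin> ?h ` P" using mem[OF one_closed P.is_ideal P(2)] by blast
      moreover have "?h \<one>\<^bsub>S\<^esub> \<in> carrier (S Quot J)" by (rule h.hom_closed[OF one_closed])
      ultimately show "carrier (S Quot J) \<noteq> ?h ` P" by metis
      fix a b assume ab: "a \<in> carrier (S Quot J)" "b \<in> carrier (S Quot J)" "a \<otimes>\<^bsub>S Quot J\<^esub> b \<in> ?h ` P"
      obtain x where x: "x \<in> carrier S" "a = ?h x" using ab(1) unfolding surj[symmetric] by (rule imageE)
      obtain y where y: "y \<in> carrier S" "b = ?h y" using ab(2) unfolding surj[symmetric] by (rule imageE)
      note xy = x(1) y(1) x(2) y(2)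
      then have "?h (x \<otimes>\<^bsub>S\<^esub> y) \<in> ?h ` P" using ab(3) by simp
      then have "x \<otimes>\<^bsub>S\<^esub> y \<in> P" using mem[OF m_closed[OF xy(1,2)] P.is_ideal P(2)] by blast
      then show "a \<in> ?h ` P \<or> b \<in> ?h ` P" using P.I_prime xy by blast
    qed
  qed
  have bound: "n \<le> s" if "prime_chain (S Quot J) n G" for n G
  proof -
    have "enat n \<le> krull_dim (S Quot J)" unfolding krull_dim_def using that by (intro Sup_upper) blast
    then show ?thesis using dim by simp
  qed
  show "n \<le> s" if G: "prime_chain S n G" "J \<subseteq> G 0"
  proof (rule bound)
    have JG: "J \<subseteq> G i" if "i \<le> n" for i using prime_chain_mono[OF G(1), of 0 i] G(2) that by auto
    have Gp: "primeideal (G i) S" if "i \<le> n" for i using G(1) that by (simp add: prime_chain_def)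
    show "prime_chain (S Quot J) n (\<lambda>i. ?h ` G i)"
      unfolding prime_chain_def
    proof (intro conjI allI impI)
      show "primeideal (?h ` G i) (S Quot J)" if "i \<le> n" for i using push[OF Gp JG] that by blast
      fix i assume i: "i < n"
      then have st: "G i \<subset> G (Suc i)" using G(1) by (simp add: prime_chain_def)
      then obtain x where x: "x \<in> G (Suc i)" "x \<notin> G i" by blast
      have "x \<in> carrier S" using ideal.Icarr[OF primeideal.axioms(1)[OF Gp[of "Suc i"]] x(1)] i by simp
      then have "?h x \<notin> ?h ` G i"
        using mem[OF _ primeideal.axioms(1)[OF Gp[of i]] JG[of i]] x(2) i by auto
      then show "?h ` G i \<subset> ?h ` G (Suc i)" using st x(1) by blast
    qed
  qed
  show "\<exists>G. prime_chain S s G \<and> J \<subseteq> G 0" if JP: "primeideal J S"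
  proof -
    have "\<exists>H. prime_chain (S Quot J) s H"
    proof (rule ccontr)
      assume no: "\<not> ?thesis"
      have pr: "primeideal (?h ` J) (S Quot J)" by (rule push[OF JP]) simp
      have lt: "n < s" if "prime_chain (S Quot J) n G" for n G
        using bound[OF that] no that by (cases "n = s") auto
      \<comment> \<open>This chain of length zero excludes \<open>s = 0\<close>, where an empty
        supremum would also give the value zero; then \<open>s - 1\<close> is a genuine smaller
        bound.\<close>
      have "prime_chain (S Quot J) 0 (\<lambda>_. ?h ` J)" using pr by (simp add: prime_chain_def)
      then have "0 < s" using lt by blast
      moreover have "krull_dim (S Quot J) \<le> enat (s - 1)"
        unfolding krull_dim_def using lt by (intro Sup_least) fastforce
      ultimately show False using dim by simp
    qed
    then obtain H where H: "prime_chain (S Quot J) s H" by blast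
    let ?G = "\<lambda>i. {r \<in> carrier S. ?h r \<in> H i}"
    have "prime_chain S s ?G"
      by (rule prime_chain_vimage[OF J.rcos_ring_hom_ring surj is_cring H])
    moreover have "J \<subseteq> ?G 0"
    proof
      fix x assume x: "x \<in> J"
      have "primeideal (H 0) (S Quot J)" using H by (simp add: prime_chain_def)
      then have "\<zero>\<^bsub>S Quot J\<^esub> \<in> H 0"
        by (intro additive_subgroup.zero_closed ideal.axioms(1) primeideal.axioms(1))
      moreover have "?h x = \<zero>\<^bsub>S Quot J\<^esub>"
        unfolding J.a_rcos_const[OF x] unfolding FactRing_def by simp
      ultimately show "x \<in> ?G 0" using J.Icarr[OF x] by auto
    qed
    ultimately show ?thesis by blast
  qed
qed

text \<open>A strict inclusion would put \<open>p\<close> below a chain of length \<open>s\<close>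
  that starts over \<open>q\<close>, giving a chain over \<open>p\<close> that is too long.\<close>

lemma primes_equal_of_dim:
  assumes cr: "cring S" and p: "primeideal p S" "krull_dim (S Quot p) = enat s"
    and q: "primeideal q S" "krull_dim (S Quot q) = enat s" and sub: "p \<subseteq> q"
  shows "p = q"
proof (rule ccontr)
  assume "p \<noteq> q"
  obtain G where G: "prime_chain S s G" "q \<subseteq> G 0"
    using krull_dim_quotient(2)[OF cr primeideal.axioms(1)[OF q(1)] q(2,1)] by blast
  then have "chain_between S s (G 0) (G s)" by (auto simp: chain_between_def)
  then have "chain_between S (Suc s) p (G s)"
    using chain_between_Cons[OF _ p(1)] G(2) sub \<open>p \<noteq> q\<close> by blast
  then obtain H where "prime_chain S (Suc s) H" "H 0 = p" by (auto simp: chain_between_def)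
  then have "Suc s \<le> s"
    using krull_dim_quotient(1)[OF cr primeideal.axioms(1)[OF p(1)] p(2)] by blast
  then show False by simp
qed

text \<open>If \<open>y\<close> works for all earlier indices but lies in the new prime, it is
  corrected by w x, where \<open>x\<close> is in \<open>Q\<close> outside the new prime and
  \<open>w\<close> lies in all earlier primes but not in the new one.\<close>

lemma (in cring_over) prime_avoidance:
  assumes "finite T" "primeideal Q (C \<downharpoonright> B)"
    and "\<And>i. i \<in> T \<Longrightarrow> primeideal (p i) (C \<downharpoonright> B) \<and> \<not> Q \<subseteq> p i"
    and "\<And>i j. i \<in> T \<Longrightarrow> j \<in> T \<Longrightarrow> p i \<subseteq> p j \<Longrightarrow> p i = p j"
  shows "\<exists>y\<in>Q. \<forall>i\<in>T. y \<notin> p i"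
  using assms(1,3,4)
proof (induction T rule: finite_induct)
  case empty
  then show ?case using submodD(3)[OF primeD(2)[OF assms(2)]] by blast
next
  case (insert k T)
  note QD = primeD[OF assms(2)]
  have pk: "primeideal (p k) (C \<downharpoonright> B)" "\<not> Q \<subseteq> p k" using insert(4) by auto
  note kD = primeD[OF pk(1)]
  obtain y where y: "y \<in> Q" "\<forall>i\<in>T. y \<notin> p i" using insert by auto
  show ?case
  proof (cases "y \<in> p k")
    case True
    have "\<exists>w\<in>B. w \<notin> p k \<and> (\<forall>i\<in>F. w \<in> p i)" if "finite F" "F \<subseteq> T" for F
      using that
    proof (induction F rule: finite_induct)
      case empty
      then show ?case using kD(3) B_one by blast
    next
      case (insert j F)
      then obtain w where w: "w \<in> B" "w \<notin> p k" "\<forall>i\<in>F. w \<in> p i" by auto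
      have jT: "j \<in> T" using insert by simp
      \<comment> \<open>Different indices may carry the same prime; this is excluded here because
        \<open>y\<close> is in \<open>p k\<close> but not in \<open>p j\<close>.\<close>
      have "\<not> p j \<subseteq> p k"
        using insert.prems \<open>\<And>i j. i \<in> insert k T \<Longrightarrow> j \<in> insert k T \<Longrightarrow> p i \<subseteq> p j \<Longrightarrow> p i = p j\<close>[of j k]
          jT True y(2) by auto
      then obtain v where v: "v \<in> p j" "v \<notin> p k" by blast
      have pi: "primeideal (p i) (C \<downharpoonright> B)" if "i \<in> insert j F" for i
        using that insert.prems jT \<open>\<And>i. i \<in> insert k T \<Longrightarrow> primeideal (p i) (C \<downharpoonright> B) \<and> \<not> Q \<subseteq> p i\<close> by blast
      have vB: "v \<in> B" using primeD(4)[OF pi[of j] v(1)] by simp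
      have "w \<otimes> v \<in> p i" if i: "i \<in> insert j F" for i
      proof (cases "i = j")
        case True
        then show ?thesis using submodD(5)[OF primeD(2)[OF pi[of j]] w(1) v(1)] by simp
      next
        case False
        then have "v \<otimes> w \<in> p i" using submodD(5)[OF primeD(2)[OF pi[OF i]] vB] w(3) i by blast
        then show ?thesis using m_comm[OF B_in[OF vB] B_in[OF w(1)]] by simp
      qed
      moreover have "w \<otimes> v \<notin> p k" using kD(5)[OF w(1) vB] w(2) v(2) by blast
      ultimately show ?case using B_mult[OF w(1) vB] by blast
    qed
    from this[OF insert(1)] obtain w where w: "w \<in> B" "w \<notin> p k" "\<forall>i\<in>T. w \<in> p i" by auto
    obtain x where x: "x \<in> Q" "x \<notin> p k" using pk(2) by blast
    have xB: "x \<in> B" and yB: "y \<in> B" using QD(4) x y by auto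
    have wx: "w \<otimes> x \<in> Q" using submodD(5)[OF QD(2) w(1) x(1)] .
    have cl: "y \<in> carrier C" "w \<otimes> x \<in> carrier C" using QD(6) y(1) wx by auto
    have "y \<oplus> w \<otimes> x \<notin> p k"
    proof
      assume "y \<oplus> w \<otimes> x \<in> p k"
      then have "w \<otimes> x \<oplus> y \<in> p k" using a_comm cl by simp
      then have "w \<otimes> x \<in> p k" using submod_cancel[OF kD(2) _ True cl(2)] by blast
      then show False using kD(5)[OF w(1) xB] w x by blast
    qed
    moreover have "y \<oplus> w \<otimes> x \<notin> p i" if i: "i \<in> T" for i
    proof
      assume *: "y \<oplus> w \<otimes> x \<in> p i"
      have pi: "submod (p i)" using insert(4) i primeD(2) by blast
      have "x \<otimes> w \<in> p i" using submodD(5)[OF pi xB] w(3) i by blast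
      then have "w \<otimes> x \<in> p i" using m_comm[OF B_in[OF xB] B_in[OF w(1)]] by simp
      then have "y \<in> p i" using submod_cancel[OF pi * _ cl(1)] by blast
      then show False using y(2) i by blast
    qed
    ultimately show ?thesis using submodD(4)[OF QD(2) y(1) wx] by blast
  next
    case False
    then show ?thesis using y by blast
  qed
qed

section \<open>Centres of valuations\<close>

locale ring_valuation = field K for K (structure) +
  fixes R \<nu>
  assumes subR: "subring R K" and val: "discrete_valuation K \<nu>" and nonneg: "R \<subseteq> valuation_ring K \<nu>"
begin

sublocale RO: cring_over K R
  by (rule cring_overI[OF subR])

lemma v_mult:
  assumes "x \<in> carrier K" "x \<noteq> \<zero>" "y \<in> carrier K" "y \<noteq> \<zero>"
  shows "\<nu> (x \<otimes> y) = \<nu> x + \<nu> y"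
  using val assms unfolding discrete_valuation_def by blast

lemma v_add:
  assumes "x \<in> carrier K" "x \<noteq> \<zero>" "y \<in> carrier K" "y \<noteq> \<zero>" "x \<oplus> y \<noteq> \<zero>"
  shows "min (\<nu> x) (\<nu> y) \<le> \<nu> (x \<oplus> y)"
  using val assms unfolding discrete_valuation_def by blast

lemma v_nonneg: "x \<in> R \<Longrightarrow> x \<noteq> \<zero> \<Longrightarrow> 0 \<le> \<nu> x"
  using nonneg unfolding valuation_ring_def by blast

lemma v_one: "\<nu> \<one> = 0"
  using v_mult[of \<one> \<one>] by simp

lemma center_iff: "x \<in> valuation_center K R \<nu> \<longleftrightarrow> x \<in> R \<and> (x = \<zero> \<or> 0 < \<nu> x)"
  unfolding valuation_center_def valuation_ideal_def using RO.B_in by blast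

lemma center_prime: "primeideal (valuation_center K R \<nu>) (K \<downharpoonright> R)"
  unfolding RO.prime_iff RO.submod_def
proof (intro conjI ballI impI)
  show "valuation_center K R \<nu> \<subseteq> R" "valuation_center K R \<nu> \<subseteq> carrier K"
    using center_iff RO.B_in by blast+
  show "\<zero> \<in> valuation_center K R \<nu>" "\<one> \<notin> valuation_center K R \<nu>"
    using center_iff v_one RO.B_zero by simp_all
  show "x \<oplus> y \<in> valuation_center K R \<nu>"
    if "x \<in> valuation_center K R \<nu>" "y \<in> valuation_center K R \<nu>" for x y
  proof -
    have xy: "x \<in> R" "y \<in> R" "x = \<zero> \<or> 0 < \<nu> x" "y = \<zero> \<or> 0 < \<nu> y" using that center_iff by auto
    note c = RO.B_in[OF xy(1)] RO.B_in[OF xy(2)]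
    have "0 < \<nu> (x \<oplus> y)" if nz: "x \<noteq> \<zero>" "y \<noteq> \<zero>" "x \<oplus> y \<noteq> \<zero>"
    proof -
      have "0 < min (\<nu> x) (\<nu> y)" using xy nz by simp
      also have "\<dots> \<le> \<nu> (x \<oplus> y)" by (rule v_add[OF c(1) nz(1) c(2) nz(2,3)])
      finally show ?thesis .
    qed
    then have "x \<oplus> y = \<zero> \<or> 0 < \<nu> (x \<oplus> y)"
      using xy(3,4) c by (cases "x = \<zero>"; cases "y = \<zero>") auto
    then show ?thesis using center_iff RO.B_add xy by blast
  qed
  show "b \<otimes> x \<in> valuation_center K R \<nu>" if "b \<in> R" "x \<in> valuation_center K R \<nu>" for b x
  proof -
    have x: "x \<in> R" "x = \<zero> \<or> 0 < \<nu> x" using that center_iff by auto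
    have "b \<otimes> x = \<zero> \<or> 0 < \<nu> (b \<otimes> x)"
    proof (cases "b = \<zero> \<or> x = \<zero>")
      case True
      then show ?thesis using RO.B_in[OF that(1)] RO.B_in[OF x(1)] by auto
    next
      case False
      then show ?thesis using v_mult[of b x] v_nonneg[OF that(1)] x RO.B_in[OF that(1)] RO.B_in[OF x(1)] by auto
    qed
    then show ?thesis using center_iff RO.B_mult that(1) x(1) by blast
  qed
  show "a \<in> valuation_center K R \<nu> \<or> b \<in> valuation_center K R \<nu>"
    if ab: "a \<in> R" "b \<in> R" "a \<otimes> b \<in> valuation_center K R \<nu>" for a b
  proof (cases "a = \<zero> \<or> b = \<zero>")
    case True
    then show ?thesis using center_iff ab by blast
  next
    case False
    note c = RO.B_in[OF ab(1)] RO.B_in[OF ab(2)]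
    have "a \<otimes> b \<noteq> \<zero>" using False integral[OF _ c] by blast
    then have "0 < \<nu> a + \<nu> b" using ab(3) center_iff v_mult[of a b] False c by simp
    then have "0 < \<nu> a \<or> 0 < \<nu> b" by linarith
    then show ?thesis using center_iff ab by blast
  qed
qed

text \<open>If every nonzero element of R had value zero, so would every fraction, whereas the value
  1 is attained.\<close>

lemma center_nonzero:
  assumes "has_quotient_field R K"
  shows "{\<zero>} \<subset> valuation_center K R \<nu>"
proof -
  have "\<exists>x\<in>R. x \<noteq> \<zero> \<and> 0 < \<nu> x"
  proof (rule ccontr)
    assume "\<not> ?thesis"
    then have z: "\<nu> x = 0" if "x \<in> R" "x \<noteq> \<zero>" for x using v_nonneg that by fastforce
    have "(1::int) \<in> \<nu> ` (carrier K - {\<zero>})" using val unfolding discrete_valuation_def by blast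
    then obtain x where x1: "1 = \<nu> x" "x \<in> carrier K - {\<zero>}" by (rule imageE)
    then have x: "x \<in> carrier K" "x \<noteq> \<zero>" "\<nu> x = 1" by simp_all
    obtain a b where ab: "a \<in> R" "b \<in> R" "b \<noteq> \<zero>" "x = a \<otimes> inv b"
      using assms x(1) unfolding has_quotient_field_def by blast
    note c = RO.B_in[OF ab(1)] RO.B_in[OF ab(2)]
    have bU: "b \<in> Units K" using c ab(3) field_Units by simp
    have "x \<otimes> b = a \<otimes> (inv b \<otimes> b)" unfolding ab(4) using c bU by (simp add: m_assoc)
    then have eq: "x \<otimes> b = a" using c bU by simp
    then have "a \<noteq> \<zero>" using integral[OF _ x(1) c(2)] x(2) ab(3) by blast
    then show False using v_mult[OF x(1,2) c(2) ab(3)] eq z ab x(3) by simp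
  qed
  then show ?thesis using center_iff RO.B_zero by blast
qed

lemma value_ideal_iff: "x \<in> value_ideal K R \<nu> n \<longleftrightarrow> x \<in> R \<and> (x = \<zero> \<or> int n \<le> \<nu> x)"
  unfolding value_ideal_def by blast

text \<open>An element of R outside the centre has value zero, so multiplying by it does not change
  values.\<close>

lemma value_ideal_cancel:
  assumes y: "y \<in> R" "y \<notin> valuation_center K R \<nu>" and g: "g \<in> R" "y \<otimes> g \<in> value_ideal K R \<nu> n"
  shows "g \<in> value_ideal K R \<nu> n"
proof (cases "g = \<zero>")
  case False
  have y0: "y \<noteq> \<zero>" "\<nu> y = 0" using y center_iff v_nonneg[OF y(1)] by auto
  note c = RO.B_in[OF y(1)] RO.B_in[OF g(1)]
  have "y \<otimes> g \<noteq> \<zero>" using integral[OF _ c] False y0 by blast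
  then show ?thesis using g value_ideal_iff v_mult[OF c(1) y0(1) c(2) False] y0 by simp
qed (use g value_ideal_iff in simp)

lemma value_ideal_mult:
  assumes "b \<in> R" "x \<in> value_ideal K R \<nu> n"
  shows "b \<otimes> x \<in> value_ideal K R \<nu> n"
proof -
  have x: "x \<in> R" "x = \<zero> \<or> int n \<le> \<nu> x" using assms value_ideal_iff by auto
  note c = RO.B_in[OF assms(1)] RO.B_in[OF x(1)]
  have "b \<otimes> x = \<zero> \<or> int n \<le> \<nu> (b \<otimes> x)"
    using v_mult[of b x] v_nonneg[OF assms(1)] x c by (cases "b = \<zero>"; cases "x = \<zero>") auto
  then show ?thesis using value_ideal_iff RO.B_mult[OF assms(1) x(1)] by blast
qed

text \<open>Values are integers, so a positive one is at least 1.\<close>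

lemma center_pow:
  assumes "x \<in> valuation_center K R \<nu>"
  shows "x [^] n \<in> value_ideal K R \<nu> n"
proof (induction n)
  case 0
  then show ?case using v_one value_ideal_iff by simp
next
  case (Suc n)
  have x: "x \<in> R" "x = \<zero> \<or> 0 < \<nu> x" using assms center_iff by auto
  have pR: "x [^] n \<in> R" "x [^] Suc n \<in> R" using RO.B_pow[OF x(1)] by blast+
  note c = RO.B_in[OF x(1)] RO.B_in[OF pR(1)]
  have "x [^] Suc n = \<zero> \<or> int (Suc n) \<le> \<nu> (x [^] Suc n)"
    using Suc x v_mult[of "x [^] n" x] c value_ideal_iff
    by (cases "x = \<zero>"; cases "x [^] n = \<zero>") auto
  then show ?case using value_ideal_iff pR by blast
qed

end

theorem corollary1p5:
  fixes K :: "('a, 'b) ring_scheme" and R :: "'a set" and s :: nat and I :: "nat \<Rightarrow> 'a set"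
  assumes "has_quotient_field R K"
    and "local_domain (K \<downharpoonright> R)"
    and "s_divisorial_filtration K R s I"
  shows "\<forall>Q. primeideal Q (K \<downharpoonright> R) \<and> I 1 \<subseteq> Q \<and> \<not> minimal_prime_over (K \<downharpoonright> R) (I 1) Q \<longrightarrow>
    analytic_spread (K \<downharpoonright> localization_at K R Q) (localized_filtration K R Q I)
      < krull_dim (K \<downharpoonright> localization_at K R Q)"
proof (intro allI impI, elim conjE)
  fix Q assume Q: "primeideal Q (K \<downharpoonright> R)" and IQ: "I 1 \<subseteq> Q"
    and nm: "\<not> minimal_prime_over (K \<downharpoonright> R) (I 1) Q"
  have fld: "field K" and sub: "subring R K" using assms(1) by (auto simp: has_quotient_field_def)
  interpret L: localization K R Q
    by (intro localization.intro localization_axioms.intro fld sub Q)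
  have noeth: "noetherian_ring (K \<downharpoonright> R)"
    using assms(2) noetherian_domain.axioms(1) unfolding local_domain_def by blast
  have filt: "filtration (K \<downharpoonright> R) I" using assms(3) unfolding s_divisorial_filtration_def by blast
  obtain r :: nat and \<nu> :: "nat \<Rightarrow> 'a \<Rightarrow> int" and a :: "nat \<Rightarrow> nat" where
    sv: "\<And>i. i \<in> {1..r} \<Longrightarrow> s_valuation K R s (\<nu> i)"
    and In: "\<And>n. I n = (\<Inter>i\<in>{1..r}. value_ideal K R (\<nu> i) (n * a i))"
    using assms(3) unfolding s_divisorial_filtration_def by blast
  have V: "ring_valuation K R (\<nu> i)" if "i \<in> {1..r}" for i
    using sv[OF that] fld sub unfolding s_valuation_def divisorial_valuation_def
    by (intro ring_valuation.intro ring_valuation_axioms.intro) auto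
  define p where "p i = valuation_center K R (\<nu> i)" for i
  have pp: "primeideal (p i) (K \<downharpoonright> R)" if "i \<in> {1..r}" for i
    unfolding p_def by (rule ring_valuation.center_prime[OF V[OF that]])
  have pdim: "krull_dim ((K \<downharpoonright> R) Quot p i) = enat s" if "i \<in> {1..r}" for i
    using sv[OF that] unfolding s_valuation_def p_def by blast
  \<comment> \<open>An index of weight zero imposes the condition of nonnegative value, which holds
    on all of R; its centre need not contain I_1.\<close>
  define T where "T = {i \<in> {1..r}. 0 < a i}"
  have T: "i \<in> {1..r}" if "i \<in> T" for i using that by (simp add: T_def)
  have peq: "p i = p j" if "i \<in> T" "j \<in> T" "p i \<subseteq> p j" for i j
    using primes_equal_of_dim[OF L.RO.cring_B pp pdim pp pdim] that T by blast
  \<comment> \<open>Otherwise choose in each such centre an element outside \<open>P\<close>. The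
    product of their powers with the weights as exponents lies in I_1 but not in \<open>P\<close>;
    for empty \<open>T\<close> it is 1.\<close>
  have over: "\<exists>i\<in>T. p i \<subseteq> P" if P: "primeideal P (K \<downharpoonright> R)" "I 1 \<subseteq> P" for P
  proof (rule ccontr)
    note PD = L.RO.primeD[OF P(1)]
    assume "\<not> ?thesis"
    then have ex: "\<exists>x. x \<in> p i \<and> x \<notin> P" if "i \<in> T" for i using that by blast
    have "\<exists>f\<in>R. f \<notin> P \<and> (\<forall>i\<in>F. f \<in> value_ideal K R (\<nu> i) (a i))" if "finite F" "F \<subseteq> T" for F
      using that
    proof (induction F rule: finite_induct)
      case empty
      then show ?case using PD(3) L.RO.B_one by blast
    next
      case (insert j F)
      then obtain f where f: "f \<in> R" "f \<notin> P" "\<forall>i\<in>F. f \<in> value_ideal K R (\<nu> i) (a i)" by auto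
      have jT: "j \<in> T" using insert by simp
      then obtain x where x: "x \<in> p j" "x \<notin> P" using ex by blast
      have xR: "x \<in> R" using L.RO.primeD(4)[OF pp[OF T[OF jT]] x(1)] .
      let ?y = "x [^]\<^bsub>K\<^esub> a j"
      have yR: "?y \<in> R" by (rule L.RO.B_pow[OF xR])
      have yP: "?y \<notin> P" using L.RO.prime_pow[OF P(1) xR] x(2) by blast
      have yv: "?y \<in> value_ideal K R (\<nu> j) (a j)"
        using ring_valuation.center_pow[OF V[OF T[OF jT]]] x(1) unfolding p_def by blast
      have "f \<otimes>\<^bsub>K\<^esub> ?y \<in> value_ideal K R (\<nu> i) (a i)" if i: "i \<in> insert j F" for i
      proof (cases "i = j")
        case True
        then show ?thesis using ring_valuation.value_ideal_mult[OF V[OF T[OF jT]] f(1) yv] by simp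
      next
        case False
        then have fi: "f \<in> value_ideal K R (\<nu> i) (a i)" and iT: "i \<in> T" using f(3) i insert(4) by auto
        have "?y \<otimes>\<^bsub>K\<^esub> f \<in> value_ideal K R (\<nu> i) (a i)"
          by (rule ring_valuation.value_ideal_mult[OF V[OF T[OF iT]] yR fi])
        then show ?thesis using L.m_comm[OF L.RO.B_in[OF yR] L.RO.B_in[OF f(1)]] by simp
      qed
      moreover have "f \<otimes>\<^bsub>K\<^esub> ?y \<notin> P" using PD(5)[OF f(1) yR] f(2) yP by blast
      ultimately show ?case using L.RO.B_mult[OF f(1) yR] by blast
    qed
    from this[of T] obtain f where f: "f \<in> R" "f \<notin> P" "\<forall>i\<in>T. f \<in> value_ideal K R (\<nu> i) (a i)"
      unfolding T_def by auto
    have "f \<in> value_ideal K R (\<nu> i) (1 * a i)" if i: "i \<in> {1..r}" for i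
    proof (cases "i \<in> T")
      case False
      then have "a i = 0" using i by (simp add: T_def)
      then show ?thesis
        using ring_valuation.value_ideal_iff[OF V[OF i]] ring_valuation.v_nonneg[OF V[OF i]] f(1) by auto
    qed (use f(3) in simp)
    then have "f \<in> I 1" unfolding In by blast
    then show False using P(2) f(2) by blast
  qed
  obtain j where j: "j \<in> T" "p j \<subseteq> Q" using over[OF Q IQ] by blast
  \<comment> \<open>If \<open>Q\<close> were inside a centre, incomparability would make
    \<open>Q\<close> equal to it; every smaller prime over I_1 contains a centre as well, so
    \<open>Q\<close> would be minimal over I_1.\<close>
  have nQ: "\<not> Q \<subseteq> p i" if i: "i \<in> T" for i
  proof
    assume Qp: "Q \<subseteq> p i"
    then have "p j = p i" using peq[OF j(1) i] j(2) by blast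
    then have Qi: "Q = p i" using Qp j(2) by blast
    have "P' = Q" if P': "primeideal P' (K \<downharpoonright> R)" "I 1 \<subseteq> P'" "P' \<subseteq> Q" for P'
    proof -
      obtain k where k: "k \<in> T" "p k \<subseteq> P'" using over[OF P'(1,2)] by blast
      then have "p k = p i" using peq[OF k(1) i] P'(3) Qi by blast
      then show ?thesis using k(2) P'(3) Qi by blast
    qed
    then show False using nm Q IQ unfolding minimal_prime_over_def by blast
  qed
  have "\<exists>y\<in>Q. \<forall>i\<in>T. y \<notin> p i"
    by (rule L.RO.prime_avoidance[OF _ Q]) (use pp T nQ peq in \<open>auto simp: T_def\<close>)
  then obtain y where y: "y \<in> Q" "\<And>i. i \<in> T \<Longrightarrow> y \<notin> p i" by blast
  have yR: "y \<in> R" using L.RO.primeD(4)[OF Q y(1)] .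
  have pjz: "{\<zero>\<^bsub>K\<^esub>} \<subset> p j"
    unfolding p_def by (rule ring_valuation.center_nonzero[OF V[OF T[OF j(1)]] assms(1)])
  have y0: "y \<noteq> \<zero>\<^bsub>K\<^esub>" using y(2)[OF j(1)] pjz by blast
  have pjQ: "p j \<subset> Q" using j y by blast
  \<comment> \<open>For positive weight \<open>y\<close> has value zero and cancels; for weight zero
    the condition on \<open>g\<close> is empty.\<close>
  have reg: "g \<in> I n" if g: "g \<in> R" "y \<otimes>\<^bsub>K\<^esub> g \<in> I n" for g n
  proof -
    have "g \<in> value_ideal K R (\<nu> i) (n * a i)" if i: "i \<in> {1..r}" for i
    proof (cases "i \<in> T")
      case True
      have "y \<otimes>\<^bsub>K\<^esub> g \<in> value_ideal K R (\<nu> i) (n * a i)" using g(2) i unfolding In by blast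
      then show ?thesis
        using ring_valuation.value_ideal_cancel[OF V[OF i] yR _ g(1)] y(2)[OF True] unfolding p_def by blast
    next
      case False
      then have "a i = 0" using i by (simp add: T_def)
      then show ?thesis
        using ring_valuation.value_ideal_iff[OF V[OF i]] ring_valuation.v_nonneg[OF V[OF i]] g(1) by auto
    qed
    then show ?thesis unfolding In by blast
  qed
  let ?KA = "K \<downharpoonright> localization_at K R Q"
  obtain N where N: "krull_dim ?KA \<le> enat N" using L.finite_dim[OF noeth] unfolding L.A_def by blast
  then obtain d where d: "krull_dim ?KA = enat d" by (cases "krull_dim ?KA") auto
  have low: "m \<le> d" if "chain_between (K \<downharpoonright> R) m q Q" for m q
    using L.chain_push[OF that] d unfolding L.A_def by simp
  have lt: "k < d" if H: "prime_chain (rees_ring ?KA (localized_filtration K R Q I) Quot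
    (Idl\<^bsub>rees_ring ?KA (localized_filtration K R Q I)\<^esub>
      ((\<lambda>a. up_ring.monom (UP ?KA) a 0) ` max_ideal ?KA))) k H" for k H
  proof -
    obtain G where G: "prime_chain (rees_ring (K \<downharpoonright> R) I) k G"
      "\<forall>i\<le>k. {a \<in> R. up_ring.monom (UP (K \<downharpoonright> R)) a 0 \<in> G i} = Q"
      using L.fibre_chain_contract[OF filt, of k H] H unfolding L.A_def by blast
    have "\<exists>m>k. chain_between (K \<downharpoonright> R) m {\<zero>\<^bsub>K \<downharpoonright> R\<^esub>} Q"
      by (rule rees.fibre_chain_shorter[OF L.rees_R[OF filt] noeth Q y(1) _ _ pp[OF T[OF j(1)]] _ pjQ G(1)])
        (use y0 reg pjz G(2) in simp_all)
    then show ?thesis using low by fastforce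
  qed
  \<comment> \<open>Positivity of \<open>d\<close> is needed for the supremum: it turns lengths
    \<open>k < d\<close> into the bound \<open>d - 1\<close>, and it also covers an empty set of
    chains, whose supremum is zero.\<close>
  have "chain_between (K \<downharpoonright> R) (Suc 0) (p j) Q"
    by (rule chain_between_Suc[OF chain_between_0[OF pp[OF T[OF j(1)]]] Q pjQ])
  then have d1: "1 \<le> d" using low by fastforce
  have "analytic_spread ?KA (localized_filtration K R Q I) \<le> enat (d - 1)"
    unfolding analytic_spread_def krull_dim_def
  proof (rule Sup_least, clarify)
    fix k H
    assume "prime_chain (rees_ring ?KA (localized_filtration K R Q I) Quot
      (Idl\<^bsub>rees_ring ?KA (localized_filtration K R Q I)\<^esub>
        ((\<lambda>a. up_ring.monom (UP ?KA) a 0) ` max_ideal ?KA))) k H"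
    then have "k < d" by (rule lt)
    then show "enat k \<le> enat (d - 1)" by simp
  qed
  also have "\<dots> < enat d" using d1 by simp
  finally show "analytic_spread ?KA (localized_filtration K R Q I) < krull_dim ?KA" using d by simp
qed

end
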